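(* Let $(C_\bullet,\mathcal{B}_\bullet,f)$ be a based chain complex with a filter over a field $\mathbb{F}$ and let $(C_\bullet,\mathcal{B}_\bullet,\mathrm{w})$ be the corresponding weighted based chain complex, with weights $\mathrm{w}(a,b)=|f(a)-f(b)|$. In case of multiple pairs having the same weight, choose an arbitrary order. Then there is a bijection of multisets $$\bigcup_{n\in\mathbb{N}}\mathrm{Bar}(H_n(F(C_\bullet,\mathcal{B}_\bullet,f)))\longrightarrow\bigcup_{n\in\mathbb{N}}\mathrm{tBar}_n(Y(C_\bullet,\mathcal{B}_\bullet,\mathrm{w})),$$ defined by $$\mathrm{Bar}(H_n(F(C_\bullet,\mathcal{B}_\bullet,f)))\ni[s,t)\longmapsto[0,t-s,t-s)\in\mathrm{tBar}_{n+1}(Y(C_\bullet,\mathcal{B}_\bullet,\mathrm{w}))\quad (t<\infty),$$ $$\mathrm{Bar}(H_n(F(C_\bullet,\mathcal{B}_\bullet,f)))\ni[s,\infty)\longmapsto[0,0,\infty)\in\mathrm{tBar}_n(Y(C_\bullet,\mathcal{B}_\bullet,\mathrm{w})).$$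
   Context: $\mathbb{N}=\{0,1,2,\dots\}$; $\mathbb{F}$ is a fixed field. Chain complexes are over $\mathbb{F}$, non-negative ($C_i=0$ for $i<0$) and compact (finite-dimensional in each degree, zero in all but finitely many degrees); $\mathrm{Ch}$ is their category. A based chain complex is a chain complex with a basis $\mathcal{B}_k$ of each $C_k$; $\langle\partial a,b\rangle$ denotes the coefficient of the basis element $b$ in $\partial a$. A based chain complex with a filter is a based chain complex together with a monotone function $f\colon\bigcup_k\mathcal{B}_k\to[0,\infty)$, i.e. for $a\in\mathcal{B}_k$, $b\in\mathcal{B}_{k-1}$, $\langle\partial a,b\rangle\neq0$ implies $f(b)<f(a)$. It induces the filtered chain complex $F(C_\bullet,\mathcal{B}_\bullet,f)\colon[0,\infty)\to\mathrm{Ch}$, $t\mapsto C^{f\le t}_\bullet$, where $C^{f\le t}_k=\mathrm{Span}\{b\in\mathcal{B}_k\mid f(b)\le t\}$ with the restricted differential and inclusions as internal maps. $H_n(F(\dots))$ is the functor $[0,\infty)\to\mathrm{Vect}$, $t\mapsto H_n(C^{f\le t}_\bullet)$ (homology with coefficients in $\mathbb{F}$), and $\mathrm{Bar}$ is its persistence barcode: the unique finite multiset of intervals $[s,t)$, $0\le s<t\le\infty$, such that the functor is isomorphic to $\bigoplus\mathbb{F}[s,t)$, where $\mathbb{F}[s,t)$ is $\mathbb{F}$ on $[s,t)$ with identity internal maps and $0$ elsewhere. Unions over $n$ are disjoint (the degree of each bar is remembered). Construction of $Y$: weights are functions $\mathrm{w}\colon\mathcal{B}_k\times\mathcal{B}_{k-1}\to[0,\infty)$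 for all $k$, with a total order on each set of pairs of equal weight. For $a\in\mathcal{B}_m$, $b\in\mathcal{B}_{m-1}$ with $\langle\partial a,b\rangle\ne0$, simplifying $(a,b)$ gives the complex with $C_m$ replaced by $C_m/\mathrm{Span}(a)$, $C_{m-1}$ by $C_{m-1}/\mathrm{Span}(\partial a)$, other degrees unchanged, induced differentials, bases the classes of the basis elements other than $a,b$, and inherited weights $\mathrm{w}([a'],[b'])=\mathrm{w}(a',b')$ and orders. Starting with $C_\bullet$, as long as the differential is non-zero, simplify the pair of minimal weight (the first in the order in case of ties) among all pairs of current basis elements in adjacent degrees with $\langle\partial a,b\rangle\neq0$. This yields pairs $(a_1,b_1),\dots,(a_r,b_r)$, $a_i$ of degree $n_i$, and a final complex $Z_\bullet$ with zero differential. Then $Y(C_\bullet,\mathcal{B}_\bullet,\mathrm{w})=\bigoplus_{i=1}^r\mathcal{I}^{n_i}[0,w_i,w_i)\oplus\bigoplus_k(\mathcal{I}^k[0,0,\infty))^{\dim Z_k}$ with $w_i=\mathrm{w}(a_i,b_i)$ (summands with $w_i=0$ omitted). Here a tagged interval $[0,s,t)$ consists of $0<t\le\infty$ and $s\in[0,t]$; $D^n$ is the complex with $\mathbb{F}$ in degrees $n,n-1$ and $\partial_n=\mathrm{id}$, $S^n$ has $\mathbb{F}$ in degree $n$ only; $\mathcal{I}^n[0,s,t)\colon[0,\infty)\to\mathrm{Ch}$ (with $s=0$ if $n=0$) is $D^n$ on $[0,s)$, $S^n$ on $[s,t)$, $0$ on $[t,\infty)$, with internal maps identities, the map $D^n\to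 S^n$ that is the identity in degree $n$, or zero. The tagged barcodes $\mathrm{tBar}_n(Y)$ are the unique finite multisets of tagged intervals with $Y\cong\bigoplus_n\bigoplus_{[0,s,t)\in\mathrm{tBar}_n(Y)}\mathcal{I}^n[0,s,t)$. *)

theory Defs
  imports "Jordan_Normal_Form.Missing_VectorSpace" "HOL-Library.Extended_Real"
begin

section \<open>Quotients and direct sums of vector spaces\<close>

text \<open>
  The quotient of \<open>V\<close> by a subspace \<open>W\<close> is realised on a system of representatives: the class
  \<open>cls V W x\<close> of \<open>x\<close> is a chosen element of the coset \<open>W + x\<close>, so that \<open>cls V W x = cls V W y\<close> iff
  \<open>x\<close> and \<open>y\<close> have the same coset. In contrast to the space of cosets, \<open>quot V W\<close> has the
  element type of \<open>V\<close>, which makes it possible to iterate quotients.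
\<close>

definition cls :: "('f, 'v) module \<Rightarrow> 'v set \<Rightarrow> 'v \<Rightarrow> 'v" where
  "cls V W x = (SOME y. \<exists>w\<in>W. y = w \<oplus>\<^bsub>V\<^esub> x)"

definition quot :: "('f, 'v) module \<Rightarrow> 'v set \<Rightarrow> ('f, 'v) module" where
  "quot V W = V\<lparr>carrier := cls V W ` carrier V,
                zero := cls V W \<zero>\<^bsub>V\<^esub>,
                add := (\<lambda>x y. cls V W (x \<oplus>\<^bsub>V\<^esub> y)),
                smult := (\<lambda>c x. cls V W (c \<odot>\<^bsub>V\<^esub> x))\<rparr>"

text \<open>The fields \<open>mult\<close> and \<open>one\<close> of a module record are irrelevant.\<close>

definition line :: "('f, 'r) ring_scheme \<Rightarrow> ('f, 'f) module" where
  "line F = \<lparr>carrier = carrier F, mult = mult F, one = one F,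
             zero = zero F, add = add F, smult = mult F\<rparr>"

definition zero_space :: "('f, 'r) ring_scheme \<Rightarrow> ('f, 'f) module" where
  "zero_space F = (line F)\<lparr>carrier := {\<zero>\<^bsub>F\<^esub>}\<rparr>"

text \<open>Only used for finite index sets \<open>J\<close>, where the product is the direct sum.\<close>

definition mod_sum :: "'j set \<Rightarrow> ('j \<Rightarrow> ('f, 'v) module) \<Rightarrow> ('f, 'j \<Rightarrow> 'v) module" where
  "mod_sum J V = \<lparr>carrier = (\<Pi>\<^sub>E j\<in>J. carrier (V j)),
                  mult = (\<lambda>g h. undefined), one = undefined,
                  zero = (\<lambda>j\<in>J. \<zero>\<^bsub>V j\<^esub>),
                  add = (\<lambda>g h. \<lambda>j\<in>J. g j \<oplus>\<^bsub>V j\<^esub> h j),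
                  smult = (\<lambda>c g. \<lambda>j\<in>J. c \<odot>\<^bsub>V j\<^esub> g j)\<rparr>"

definition coef :: "('f, 'r) ring_scheme \<Rightarrow> ('f, 'v) module \<Rightarrow> 'v set \<Rightarrow> 'v \<Rightarrow> 'v \<Rightarrow> 'f" where
  "coef F V A x = (THE c. c \<in> A \<rightarrow>\<^sub>E carrier F \<and> x = LinearCombinations.module.lincomb V c A)"


section \<open>Chain complexes\<close>

text \<open>
  \<open>bd C k\<close> is the differential from degree \<open>k\<close> to degree \<open>k - 1\<close>. It is relevant only for
  \<open>k \<ge> 1\<close>; the differential on degree 0 is zero because there are no negative degrees.
\<close>

record ('f, 'v) complex_data =
  grade :: "nat \<Rightarrow> ('f, 'v) module"
  bd :: "nat \<Rightarrow> 'v \<Rightarrow> 'v"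

definition chain_complex :: "('f, 'r) ring_scheme \<Rightarrow> ('f, 'v) complex_data \<Rightarrow> bool" where
  "chain_complex F C \<longleftrightarrow>
     (\<forall>k. vectorspace F (grade C k)) \<and>
     (\<forall>k. bd C (Suc k) \<in> LinearCombinations.module_hom F (grade C (Suc k)) (grade C k)) \<and>
     (\<forall>k. \<forall>x\<in>carrier (grade C (Suc (Suc k))).
        bd C (Suc k) (bd C (Suc (Suc k)) x) = \<zero>\<^bsub>grade C k\<^esub>)"

definition compact_complex :: "('f, 'r) ring_scheme \<Rightarrow> ('f, 'v) complex_data \<Rightarrow> bool" where
  "compact_complex F C \<longleftrightarrow>
     (\<forall>k. vectorspace.fin_dim F (grade C k)) \<and>
     finite {k. carrier (grade C k) \<noteq> {\<zero>\<^bsub>grade C k\<^esub>}}"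

definition based_complex ::
    "('f, 'r) ring_scheme \<Rightarrow> ('f, 'v) complex_data \<Rightarrow> (nat \<Rightarrow> 'v set) \<Rightarrow> bool" where
  "based_complex F C B \<longleftrightarrow>
     chain_complex F C \<and> compact_complex F C \<and> (\<forall>k. vectorspace.basis F (grade C k) (B k))"

text \<open>Here \<open>a\<close> has degree \<open>m \<ge> 1\<close>.\<close>

definition incidence ::
    "('f, 'r) ring_scheme \<Rightarrow> ('f, 'v) complex_data \<Rightarrow> (nat \<Rightarrow> 'v set) \<Rightarrow> nat \<Rightarrow> 'v \<Rightarrow> 'v \<Rightarrow> 'f" where
  "incidence F C B m a b = coef F (grade C (m - 1)) (B (m - 1)) (bd C m a) b"

text \<open>
  The components of the union of the bases are kept apart by passing the degree to \<open>f\<close>.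
\<close>

definition based_filter ::
    "('f, 'r) ring_scheme \<Rightarrow> ('f, 'v) complex_data \<Rightarrow> (nat \<Rightarrow> 'v set) \<Rightarrow> (nat \<Rightarrow> 'v \<Rightarrow> real) \<Rightarrow> bool" where
  "based_filter F C B f \<longleftrightarrow>
     (\<forall>k. \<forall>a\<in>B k. 0 \<le> f k a) \<and>
     (\<forall>k. \<forall>a\<in>B (Suc k). \<forall>b\<in>B k.
        incidence F C B (Suc k) a b \<noteq> \<zero>\<^bsub>F\<^esub> \<longrightarrow> f k b < f (Suc k) a)"

definition cycles :: "('f, 'v) complex_data \<Rightarrow> nat \<Rightarrow> 'v set" where
  "cycles C n = {x \<in> carrier (grade C n). n > 0 \<longrightarrow> bd C n x = \<zero>\<^bsub>grade C (n - 1)\<^esub>}"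

definition boundaries :: "('f, 'v) complex_data \<Rightarrow> nat \<Rightarrow> 'v set" where
  "boundaries C n = bd C (Suc n) ` carrier (grade C (Suc n))"

definition homology :: "nat \<Rightarrow> ('f, 'v) complex_data \<Rightarrow> ('f, 'v) module" where
  "homology n C = quot ((grade C n)\<lparr>carrier := cycles C n\<rparr>) (boundaries C n)"

definition complex_sum :: "'j set \<Rightarrow> ('j \<Rightarrow> ('f, 'v) complex_data) \<Rightarrow> ('f, 'j \<Rightarrow> 'v) complex_data" where
  "complex_sum J C = \<lparr>grade = (\<lambda>k. mod_sum J (\<lambda>j. grade (C j) k)),
                      bd = (\<lambda>k g. \<lambda>j\<in>J. bd (C j) k (g j))\<rparr>"


section \<open>Functors on the half-line\<close>

text \<open>
  Functors from \<open>[0,\<infinity>)\<close> to vector spaces and to chain complexes; only the values at parameters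
  \<open>0 \<le> s \<le> t\<close> are relevant. \<open>pmap P s t\<close> and \<open>cmap P s t n\<close> are the internal maps from
  time \<open>s\<close> to time \<open>t\<close>.
\<close>

record ('f, 'v) pmodule =
  pobj :: "real \<Rightarrow> ('f, 'v) module"
  pmap :: "real \<Rightarrow> real \<Rightarrow> 'v \<Rightarrow> 'v"

record ('f, 'v) pcomplex =
  cobj :: "real \<Rightarrow> ('f, 'v) complex_data"
  cmap :: "real \<Rightarrow> real \<Rightarrow> nat \<Rightarrow> 'v \<Rightarrow> 'v"

definition pmodule_iso ::
    "('f, 'r) ring_scheme \<Rightarrow> ('f, 'v) pmodule \<Rightarrow> ('f, 'u) pmodule \<Rightarrow> bool" where
  "pmodule_iso F P Q \<longleftrightarrow> (\<exists>\<eta>.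
     (\<forall>t\<ge>0. \<eta> t \<in> LinearCombinations.module_hom F (pobj P t) (pobj Q t) \<and>
        bij_betw (\<eta> t) (carrier (pobj P t)) (carrier (pobj Q t))) \<and>
     (\<forall>s t. 0 \<le> s \<and> s \<le> t \<longrightarrow>
        (\<forall>x\<in>carrier (pobj P s). \<eta> t (pmap P s t x) = pmap Q s t (\<eta> s x))))"

definition pcomplex_iso ::
    "('f, 'r) ring_scheme \<Rightarrow> ('f, 'v) pcomplex \<Rightarrow> ('f, 'u) pcomplex \<Rightarrow> bool" where
  "pcomplex_iso F P Q \<longleftrightarrow> (\<exists>\<eta>.
     (\<forall>t\<ge>0. \<forall>k. \<eta> t k \<in> LinearCombinations.module_hom F (grade (cobj P t) k) (grade (cobj Q t) k) \<and>
        bij_betw (\<eta> t k) (carrier (grade (cobj P t) k)) (carrier (grade (cobj Q t) k))) \<and>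
     (\<forall>t\<ge>0. \<forall>k. \<forall>x\<in>carrier (grade (cobj P t) (Suc k)).
        \<eta> t k (bd (cobj P t) (Suc k) x) = bd (cobj Q t) (Suc k) (\<eta> t (Suc k) x)) \<and>
     (\<forall>s t. 0 \<le> s \<and> s \<le> t \<longrightarrow>
        (\<forall>k. \<forall>x\<in>carrier (grade (cobj P s) k).
           \<eta> t k (cmap P s t k x) = cmap Q s t k (\<eta> s k x))))"

definition pmodule_sum :: "'j set \<Rightarrow> ('j \<Rightarrow> ('f, 'v) pmodule) \<Rightarrow> ('f, 'j \<Rightarrow> 'v) pmodule" where
  "pmodule_sum J P = \<lparr>pobj = (\<lambda>t. mod_sum J (\<lambda>j. pobj (P j) t)),
                      pmap = (\<lambda>s t g. \<lambda>j\<in>J. pmap (P j) s t (g j))\<rparr>"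

definition pcomplex_sum :: "'j set \<Rightarrow> ('j \<Rightarrow> ('f, 'v) pcomplex) \<Rightarrow> ('f, 'j \<Rightarrow> 'v) pcomplex" where
  "pcomplex_sum J P = \<lparr>cobj = (\<lambda>t. complex_sum J (\<lambda>j. cobj (P j) t)),
                       cmap = (\<lambda>s t k g. \<lambda>j\<in>J. cmap (P j) s t k (g j))\<rparr>"

definition filtered_complex ::
    "('f, 'r) ring_scheme \<Rightarrow> ('f, 'v) complex_data \<Rightarrow> (nat \<Rightarrow> 'v set) \<Rightarrow> (nat \<Rightarrow> 'v \<Rightarrow> real)
      \<Rightarrow> ('f, 'v) pcomplex" where
  "filtered_complex F C B f =
     \<lparr>cobj = (\<lambda>t. \<lparr>grade = (\<lambda>k. (grade C k)
                     \<lparr>carrier := LinearCombinations.module.span F (grade C k) {b \<in> B k. f k b \<le> t}\<rparr>),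
                   bd = bd C\<rparr>),
      cmap = (\<lambda>s t k x. x)\<rparr>"

definition phomology :: "nat \<Rightarrow> ('f, 'v) pcomplex \<Rightarrow> ('f, 'v) pmodule" where
  "phomology n P =
     \<lparr>pobj = (\<lambda>t. homology n (cobj P t)),
      pmap = (\<lambda>s t x. cls (grade (cobj P t) n) (boundaries (cobj P t) n) (cmap P s t n x))\<rparr>"


section \<open>Barcodes\<close>

text \<open>A bar \<open>[s,t)\<close> is the pair \<open>(s, t)\<close>; a tagged interval \<open>[0,s,t)\<close> is the pair \<open>(s, t)\<close>.\<close>

type_synonym bar = "real \<times> ereal"
type_synonym tagged_interval = "ereal \<times> ereal"

definition interval_module :: "('f, 'r) ring_scheme \<Rightarrow> bar \<Rightarrow> ('f, 'f) pmodule" where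
  "interval_module F I = (case I of (s, t) \<Rightarrow>
     \<lparr>pobj = (\<lambda>x. if s \<le> x \<and> ereal x < t then line F else zero_space F),
      pmap = (\<lambda>x y v. if s \<le> x \<and> ereal y < t then v else \<zero>\<^bsub>F\<^esub>)\<rparr>)"

definition is_barcode :: "('f, 'r) ring_scheme \<Rightarrow> ('f, 'v) pmodule \<Rightarrow> bar multiset \<Rightarrow> bool" where
  "is_barcode F P M \<longleftrightarrow>
     (\<forall>(s, t) \<in> set_mset M. 0 \<le> s \<and> ereal s < t) \<and>
     pmodule_iso F P (pmodule_sum {(I, i). i < count M I} (\<lambda>(I, i). interval_module F I))"

definition Bar :: "('f, 'r) ring_scheme \<Rightarrow> ('f, 'v) pmodule \<Rightarrow> bar multiset" where
  "Bar F P = (THE M. is_barcode F P M)"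

definition disk :: "('f, 'r) ring_scheme \<Rightarrow> nat \<Rightarrow> ('f, 'f) complex_data" where
  "disk F n = \<lparr>grade = (\<lambda>k. if k = n \<or> Suc k = n then line F else zero_space F),
               bd = (\<lambda>k v. if k = n then v else \<zero>\<^bsub>F\<^esub>)\<rparr>"

definition sphere :: "('f, 'r) ring_scheme \<Rightarrow> nat \<Rightarrow> ('f, 'f) complex_data" where
  "sphere F n = \<lparr>grade = (\<lambda>k. if k = n then line F else zero_space F), bd = (\<lambda>k v. \<zero>\<^bsub>F\<^esub>)\<rparr>"

definition zero_complex :: "('f, 'r) ring_scheme \<Rightarrow> ('f, 'f) complex_data" where
  "zero_complex F = \<lparr>grade = (\<lambda>k. zero_space F), bd = (\<lambda>k v. \<zero>\<^bsub>F\<^esub>)\<rparr>"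

text \<open>
  The internal map from time \<open>x\<close> to time \<open>y \<ge> x\<close> is the identity in every degree in which the
  complex at time \<open>y\<close> is non-zero.
\<close>

definition interval_sphere ::
    "('f, 'r) ring_scheme \<Rightarrow> nat \<Rightarrow> tagged_interval \<Rightarrow> ('f, 'f) pcomplex" where
  "interval_sphere F n I = (case I of (s, t) \<Rightarrow>
     \<lparr>cobj = (\<lambda>x. if ereal x < s then disk F n
                   else if ereal x < t then sphere F n
                   else zero_complex F),
      cmap = (\<lambda>x y k v. if (k = n \<and> ereal y < t) \<or> (Suc k = n \<and> ereal y < s) then v else \<zero>\<^bsub>F\<^esub>)\<rparr>)"

text \<open>
  The occurrences in the disjoint union of the multisets \<open>M n\<close>, each with its degree \<open>n\<close>.
\<close>

definition occurrences :: "(nat \<Rightarrow> 'a multiset) \<Rightarrow> (nat \<times> 'a \<times> nat) set" where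
  "occurrences M = {(n, I, i). i < count (M n) I}"

text \<open>
  Finiteness of the set of degrees that occur is forced by compactness of the complexes.
\<close>

definition is_tagged_barcode ::
    "('f, 'r) ring_scheme \<Rightarrow> ('f, 'v) pcomplex \<Rightarrow> (nat \<Rightarrow> tagged_interval multiset) \<Rightarrow> bool" where
  "is_tagged_barcode F P M \<longleftrightarrow>
     finite {n. M n \<noteq> {#}} \<and>
     (\<forall>n. \<forall>(s, t) \<in> set_mset (M n). 0 < t \<and> 0 \<le> s \<and> s \<le> t \<and> (n = 0 \<longrightarrow> s = 0)) \<and>
     pcomplex_iso F P (pcomplex_sum (occurrences M) (\<lambda>(n, I, i). interval_sphere F n I))"

definition tBar :: "('f, 'r) ring_scheme \<Rightarrow> ('f, 'v) pcomplex \<Rightarrow> nat \<Rightarrow> tagged_interval multiset" where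
  "tBar F P = (THE M. is_tagged_barcode F P M)"


section \<open>Simplification of weighted based chain complexes\<close>

text \<open>
  A triple \<open>(m, a, b)\<close> stands for the pair \<open>(a, b)\<close> with \<open>a\<close> in degree \<open>m\<close> and \<open>b\<close> in degree
  \<open>m - 1\<close>, and \<open>wt D m a b\<close> is its weight. \<open>ties D x\<close> is the (reflexive) total order on the pairs
  of weight \<open>x\<close>.
\<close>

record ('f, 'v) weighted_complex =
  cpx :: "('f, 'v) complex_data"
  bas :: "nat \<Rightarrow> 'v set"
  wt :: "nat \<Rightarrow> 'v \<Rightarrow> 'v \<Rightarrow> real"
  ties :: "real \<Rightarrow> (nat \<times> 'v \<times> 'v) rel"

definition adjacent_pairs :: "(nat \<Rightarrow> 'v set) \<Rightarrow> (nat \<times> 'v \<times> 'v) set" where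
  "adjacent_pairs B = {(m, a, b). m \<ge> 1 \<and> a \<in> B m \<and> b \<in> B (m - 1)}"

definition orders_ties ::
    "(nat \<Rightarrow> 'v set) \<Rightarrow> (nat \<Rightarrow> 'v \<Rightarrow> 'v \<Rightarrow> real) \<Rightarrow> (real \<Rightarrow> (nat \<times> 'v \<times> 'v) rel) \<Rightarrow> bool" where
  "orders_ties B w R \<longleftrightarrow>
     (\<forall>x. linear_order_on {(m, a, b) \<in> adjacent_pairs B. w m a b = x} (R x))"

definition quot_complex :: "('f, 'v) complex_data \<Rightarrow> (nat \<Rightarrow> 'v set) \<Rightarrow> ('f, 'v) complex_data" where
  "quot_complex C W =
     \<lparr>grade = (\<lambda>k. quot (grade C k) (W k)),
      bd = (\<lambda>k x. cls (grade C (k - 1)) (W (k - 1)) (bd C k x))\<rparr>"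

text \<open>
  The differential of \<open>quot_complex\<close> and the inherited weights are evaluated on representatives.
  \<open>W\<close> is the subcomplex spanned by \<open>a\<close> and its boundary, and \<open>S\<close> the set of the basis elements
  other than \<open>a\<close> and \<open>b\<close>, whose classes form the new basis.
\<close>

definition simplify ::
    "('f, 'r) ring_scheme \<Rightarrow> ('f, 'v) weighted_complex \<Rightarrow> nat \<times> 'v \<times> 'v \<Rightarrow> ('f, 'v) weighted_complex" where
  "simplify F D p = (case p of (m, a, b) \<Rightarrow>
     let C = cpx D;
         W = (\<lambda>k. if k = m then LinearCombinations.module.span F (grade C k) {a}
                  else if Suc k = m then LinearCombinations.module.span F (grade C k) {bd C m a}
                  else {\<zero>\<^bsub>grade C k\<^esub>});
         q = (\<lambda>k. cls (grade C k) (W k));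
         S = (\<lambda>k. if k = m then bas D k - {a} else if Suc k = m then bas D k - {b} else bas D k);
         l = (\<lambda>k. inv_into (S k) (q k))
     in \<lparr>cpx = quot_complex C W,
         bas = (\<lambda>k. q k ` S k),
         wt = (\<lambda>k x y. wt D k (l k x) (l (k - 1) y)),
         ties = (\<lambda>r. {((i, q i a1, q (i - 1) b1), (j, q j a2, q (j - 1) b2)) | i a1 b1 j a2 b2.
                   ((i, a1, b1), (j, a2, b2)) \<in> ties D r \<and>
                   (i, a1, b1) \<in> adjacent_pairs S \<and> (j, a2, b2) \<in> adjacent_pairs S})\<rparr>)"

definition candidates ::
    "('f, 'r) ring_scheme \<Rightarrow> ('f, 'v) weighted_complex \<Rightarrow> (nat \<times> 'v \<times> 'v) set" where
  "candidates F D =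
     {(m, a, b) \<in> adjacent_pairs (bas D). incidence F (cpx D) (bas D) m a b \<noteq> \<zero>\<^bsub>F\<^esub>}"

definition weight :: "('f, 'v) weighted_complex \<Rightarrow> nat \<times> 'v \<times> 'v \<Rightarrow> real" where
  "weight D p = (case p of (m, a, b) \<Rightarrow> wt D m a b)"

definition min_pair ::
    "('f, 'r) ring_scheme \<Rightarrow> ('f, 'v) weighted_complex \<Rightarrow> nat \<times> 'v \<times> 'v" where
  "min_pair F D = (THE p. p \<in> candidates F D \<and>
     (\<forall>p' \<in> candidates F D. weight D p < weight D p' \<or>
        (weight D p = weight D p' \<and> (p, p') \<in> ties D (weight D p))))"

definition zero_differential :: "('f, 'v) complex_data \<Rightarrow> bool" where
  "zero_differential C \<longleftrightarrow> (\<forall>k. \<forall>x\<in>carrier (grade C (Suc k)). bd C (Suc k) x = \<zero>\<^bsub>grade C k\<^esub>)"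

definition stage ::
    "('f, 'r) ring_scheme \<Rightarrow> ('f, 'v) weighted_complex \<Rightarrow> nat \<Rightarrow> ('f, 'v) weighted_complex" where
  "stage F D i = ((\<lambda>E. simplify F E (min_pair F E)) ^^ i) D"

definition num_steps :: "('f, 'r) ring_scheme \<Rightarrow> ('f, 'v) weighted_complex \<Rightarrow> nat" where
  "num_steps F D = (LEAST r. zero_differential (cpx (stage F D r)))"

text \<open>The pairs are numbered from 0.\<close>

definition step_degree :: "('f, 'r) ring_scheme \<Rightarrow> ('f, 'v) weighted_complex \<Rightarrow> nat \<Rightarrow> nat" where
  "step_degree F D i = fst (min_pair F (stage F D i))"

definition step_weight :: "('f, 'r) ring_scheme \<Rightarrow> ('f, 'v) weighted_complex \<Rightarrow> nat \<Rightarrow> real" where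
  "step_weight F D i = weight (stage F D i) (min_pair F (stage F D i))"

definition final_complex ::
    "('f, 'r) ring_scheme \<Rightarrow> ('f, 'v) weighted_complex \<Rightarrow> ('f, 'v) complex_data" where
  "final_complex F D = cpx (stage F D (num_steps F D))"

definition Y_functor ::
    "('f, 'r) ring_scheme \<Rightarrow> ('f, 'v) weighted_complex \<Rightarrow> ('f, nat + nat \<times> nat \<Rightarrow> 'f) pcomplex" where
  "Y_functor F D = pcomplex_sum
     (Inl ` {i. i < num_steps F D \<and> step_weight F D i \<noteq> 0} \<union>
      Inr ` {(k, j). j < vectorspace.dim F (grade (final_complex F D) k)})
     (\<lambda>x. case x of
        Inl i \<Rightarrow> interval_sphere F (step_degree F D i)
                   (ereal (step_weight F D i), ereal (step_weight F D i))
      | Inr (k, j) \<Rightarrow> interval_sphere F k (0, \<infinity>))"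

definition filter_weight :: "(nat \<Rightarrow> 'v \<Rightarrow> real) \<Rightarrow> nat \<Rightarrow> 'v \<Rightarrow> 'v \<Rightarrow> real" where
  "filter_weight f m a b = \<bar>f m a - f (m - 1) b\<bar>"

end

theory Submission
  imports Defs
begin

text \<open>
  Let \<open>(a, b)\<close> be a pair with non-zero incidence for which \<open>f a - f b\<close> is minimal. Minimality makes the
  filtered complex split as the direct sum of the subcomplex spanned by \<open>a\<close> and \<open>\<partial>a\<close>, whose homology
  is the bar \<open>[f b, f a)\<close> in the degree of \<open>b\<close>, and a complement isomorphic to the simplified complex,
  on which \<open>f\<close> is again a filter inducing the inherited weights. By induction the simplification
  algorithm splits the filtered complex into bars \<open>[f b\<^sub>i, f a\<^sub>i)\<close> of length \<open>w\<^sub>i\<close> and infinite bars that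
  correspond to a basis of the final complex. Both barcodes are therefore indexed by the summands of \<open>Y\<close>;
  they are unique because multiplicities are determined by dimensions of images of structure maps.
\<close>

section \<open>Coordinates in vector spaces\<close>

text \<open>The algorithm produces iterated quotients, so generators of bars would have to be lifted
  through all steps. Coordinate functionals avoid this, because they pull back along quotient maps.
  Filtration and differential are therefore described by the values of functionals throughout. The
  complement of the span of \<open>a\<close> and \<partial>a is the kernel of a functional that
  reads the coefficient of \<open>b\<close>: in \<open>x\<close> in the lower degree, in \<partial>x
  in the upper one. The coefficient of \<open>a\<close> would be the obvious choice in the upper
  degree, but then the kernel need not be closed under the differential. The price is a cancellation
  argument for the filtration in the upper degree (\<open>sublevel_split_upper\<close>). The orders
  on ties only serve to make the description \<open>min_pair\<close> denote a pair; what the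
  splitting uses is minimality of the weight. The filter is strictly monotone, so every finite bar
  has positive length and no summand of weight 0 is lost.\<close>

abbreviation "lin_hom \<equiv> LinearCombinations.module_hom"

lemmas lin_hom_def = LinearCombinations.module_hom_def
  and lin_hom_add = LinearCombinations.module_hom_add
  and lin_hom_smult = LinearCombinations.module_hom_smult

definition linfun :: "('f, 'r) ring_scheme \<Rightarrow> ('f, 'v, 'm) module_scheme \<Rightarrow> ('v \<Rightarrow> 'f) \<Rightarrow> bool" where
  "linfun F V l \<longleftrightarrow>
     (\<forall>x\<in>carrier V. l x \<in> carrier F) \<and>
     (\<forall>x\<in>carrier V. \<forall>y\<in>carrier V. l (x \<oplus>\<^bsub>V\<^esub> y) = l x \<oplus>\<^bsub>F\<^esub> l y) \<and>
     (\<forall>c\<in>carrier F. \<forall>x\<in>carrier V. l (c \<odot>\<^bsub>V\<^esub> x) = c \<otimes>\<^bsub>F\<^esub> l x)"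

lemma linfun_closed: "linfun F V l \<Longrightarrow> x \<in> carrier V \<Longrightarrow> l x \<in> carrier F"
  and linfun_add: "linfun F V l \<Longrightarrow> x \<in> carrier V \<Longrightarrow> y \<in> carrier V \<Longrightarrow> l (x \<oplus>\<^bsub>V\<^esub> y) = l x \<oplus>\<^bsub>F\<^esub> l y"
  and linfun_smult: "linfun F V l \<Longrightarrow> c \<in> carrier F \<Longrightarrow> x \<in> carrier V \<Longrightarrow> l (c \<odot>\<^bsub>V\<^esub> x) = c \<otimes>\<^bsub>F\<^esub> l x"
  by (auto simp: linfun_def)

lemma linfun_comp: "linfun F V l \<Longrightarrow> h \<in> lin_hom F U V \<Longrightarrow> linfun F U (\<lambda>x. l (h x))"
  by (auto simp: linfun_def lin_hom_def Pi_def)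

locale coordinate_space = vectorspace K V
  for K :: "('a, 'k) ring_scheme" (structure) and V :: "('a, 'c) module"
begin

lemma linfun_zero [simp]: assumes "linfun K V l" shows "l \<zero>\<^bsub>V\<^esub> = \<zero>"
proof -
  have "l (\<zero> \<odot>\<^bsub>V\<^esub> \<zero>\<^bsub>V\<^esub>) = \<zero> \<otimes> l \<zero>\<^bsub>V\<^esub>"
    using assms by (intro linfun_smult) auto
  then show ?thesis using linfun_closed[OF assms, of "\<zero>\<^bsub>V\<^esub>"] by simp
qed

lemma linfun_minus:
  assumes l: "linfun K V l" and x: "x \<in> carrier V" and y: "y \<in> carrier V"
  shows "l (x \<ominus>\<^bsub>V\<^esub> y) = l x \<ominus> l y"
proof -
  have "x = (x \<ominus>\<^bsub>V\<^esub> y) \<oplus>\<^bsub>V\<^esub> y"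
    using x y by (simp add: a_minus_def M.a_assoc M.l_neg)
  then have "l x = l (x \<ominus>\<^bsub>V\<^esub> y) \<oplus> l y"
    using linfun_add[OF l, of "x \<ominus>\<^bsub>V\<^esub> y" y] x y by simp
  then show ?thesis
    using linfun_closed[OF l, of "x \<ominus>\<^bsub>V\<^esub> y"] linfun_closed[OF l y] x y
    by (simp add: a_minus_def R.a_assoc R.r_neg)
qed

lemma linfun_diff_smult:
  assumes "linfun K V l" "linfun K V m" "c \<in> carrier K"
  shows "linfun K V (\<lambda>x. l x \<ominus> m x \<otimes> c)"
proof -
  have "(a \<oplus> b) \<ominus> (a' \<oplus> b') \<otimes> c = (a \<ominus> a' \<otimes> c) \<oplus> (b \<ominus> b' \<otimes> c)"
    if "a \<in> carrier K" "b \<in> carrier K" "a' \<in> carrier K" "b' \<in> carrier K" for a b a' b'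
    using that assms(3) by algebra
  moreover have "d \<otimes> a \<ominus> d \<otimes> a' \<otimes> c = d \<otimes> (a \<ominus> a' \<otimes> c)"
    if "a \<in> carrier K" "d \<in> carrier K" "a' \<in> carrier K" for a d a'
    using that assms(3) by algebra
  ultimately show ?thesis
    using assms by (auto simp: linfun_def)
qed

lemma linfun_span_zero:
  assumes l: "linfun K V l" and A: "A \<subseteq> carrier V" and "\<And>v. v \<in> A \<Longrightarrow> l v = \<zero>"
    and x: "x \<in> span A"
  shows "l x = \<zero>"
proof -
  have "submodule K {x \<in> carrier V. l x = \<zero>} V"
    using l by unfold_locales (auto simp: linfun_add linfun_smult)
  from span_is_subset[OF _ this, of A] assms show ?thesis by auto
qed

lemma linfun_lincomb_dual:
  assumes l: "linfun K V l" and A: "finite A" "A \<subseteq> carrier V" and c: "c \<in> A \<rightarrow> carrier K"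
    and a: "a \<in> A" "l a = \<one>" and z: "\<And>v. v \<in> A \<Longrightarrow> v \<noteq> a \<Longrightarrow> l v = \<zero>"
  shows "l (lincomb c A) = c a"
proof -
  have fin: "finite (A - {a})" and sub: "A - {a} \<subseteq> carrier V" and c': "c \<in> A - {a} \<rightarrow> carrier K"
    using A c by auto
  have "lincomb c (A - {a}) \<in> span (A - {a})"
    unfolding span_def using fin c' by blast
  then have 0: "l (lincomb c (A - {a})) = \<zero>"
    by (rule linfun_span_zero[OF l sub, rotated]) (use z in auto)
  have "lincomb c A = c a \<odot>\<^bsub>V\<^esub> a \<oplus>\<^bsub>V\<^esub> lincomb c (A - {a})"
    by (rule lincomb_del2[OF A c a(1)])
  moreover have ca: "c a \<in> carrier K" and aV: "a \<in> carrier V" using A c a by auto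
  moreover have "c a \<odot>\<^bsub>V\<^esub> a \<in> carrier V" using ca aV by (rule smult_closed)
  ultimately have "l (lincomb c A) = c a \<otimes> l a \<oplus> l (lincomb c (A - {a}))"
    by (simp only: linfun_add[OF l _ lincomb_closed[OF sub c']] linfun_smult[OF l])
  then show ?thesis using 0 a(2) ca by simp
qed

text \<open>By linearity \<open>sep\<close> can be applied to the difference of \<open>x\<close> and
  \<open>y\<close>.\<close>

lemma eq_of_linfuns:
  assumes "\<And>j. j \<in> J \<Longrightarrow> linfun K V (\<theta> j)"
    and sep: "\<And>x. x \<in> carrier V \<Longrightarrow> (\<And>j. j \<in> J \<Longrightarrow> \<theta> j x = \<zero>) \<Longrightarrow> x = \<zero>\<^bsub>V\<^esub>"
    and x: "x \<in> carrier V" and y: "y \<in> carrier V" and eq: "\<And>j. j \<in> J \<Longrightarrow> \<theta> j x = \<theta> j y"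
  shows "x = y"
proof -
  have "\<theta> j (x \<ominus>\<^bsub>V\<^esub> y) = \<zero>" if "j \<in> J" for j
    using linfun_minus[OF assms(1)[OF that] x y] eq[OF that] linfun_closed[OF assms(1)[OF that] y]
    by (simp add: a_minus_def R.r_neg)
  then have "x \<ominus>\<^bsub>V\<^esub> y = \<zero>\<^bsub>V\<^esub>" using x y by (intro sep) auto
  moreover have "x = (x \<ominus>\<^bsub>V\<^esub> y) \<oplus>\<^bsub>V\<^esub> y"
    using x y by (simp add: a_minus_def M.a_assoc M.l_neg)
  ultimately show ?thesis using y by simp
qed

text \<open>Separation takes the place of spanning: the combination of the \<open>e j\<close> with
  coefficients \<open>\<theta> j x\<close> has the same \<theta>-values as \<open>x\<close> and
  hence equals \<open>x\<close>. Duality gives uniqueness of the coefficients.\<close>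

lemma dual_basis:
  fixes e :: "'j \<Rightarrow> 'c" and \<theta> :: "'j \<Rightarrow> 'c \<Rightarrow> 'a"
  assumes fin: "finite J" and e: "\<And>j. j \<in> J \<Longrightarrow> e j \<in> carrier V"
    and \<theta>: "\<And>j. j \<in> J \<Longrightarrow> linfun K V (\<theta> j)"
    and dual: "\<And>i j. i \<in> J \<Longrightarrow> j \<in> J \<Longrightarrow> \<theta> i (e j) = (if i = j then \<one> else \<zero>)"
    and sep: "\<And>x. x \<in> carrier V \<Longrightarrow> (\<And>j. j \<in> J \<Longrightarrow> \<theta> j x = \<zero>) \<Longrightarrow> x = \<zero>\<^bsub>V\<^esub>"
  shows "inj_on e J" "basis (e ` J)"
    and "\<And>x j. x \<in> carrier V \<Longrightarrow> j \<in> J \<Longrightarrow> coef K V (e ` J) x (e j) = \<theta> j x"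
proof -
  show inj: "inj_on e J"
    by (rule inj_onI) (metis dual one_not_zero)
  let ?A = "e ` J"
  have A: "finite ?A" "?A \<subseteq> carrier V" using fin e by auto
  have lin: "\<theta> j (lincomb c ?A) = c (e j)" if "c \<in> ?A \<rightarrow> carrier K" "j \<in> J" for c j
    using that A dual inj by (intro linfun_lincomb_dual[OF \<theta>]) (auto simp: inj_on_eq_iff)
  have ex: "\<exists>!c. c \<in> ?A \<rightarrow>\<^sub>E carrier K \<and> lincomb c ?A = x" if x: "x \<in> carrier V" for x
  proof -
    \<comment> \<open>Coefficients are functions of basis vectors, not of indices, hence the inverse
      of \<open>e\<close>.\<close>
    define c where "c = (\<lambda>v\<in>?A. \<theta> (inv_into J e v) x)"
    have c: "c \<in> ?A \<rightarrow>\<^sub>E carrier K" using x inj by (auto simp: c_def intro!: linfun_closed[OF \<theta>])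
    have "lincomb c ?A = x"
    proof (rule eq_of_linfuns[of J \<theta>])
      show "lincomb c ?A \<in> carrier V" using A c by (intro lincomb_closed) auto
      show "\<theta> j (lincomb c ?A) = \<theta> j x" if "j \<in> J" for j
        using lin[of c j] c that inj by (auto simp: c_def)
    qed (use \<theta> sep x in auto)
    moreover have "c' = c" if "c' \<in> ?A \<rightarrow>\<^sub>E carrier K" "lincomb c' ?A = x" for c'
    proof (rule PiE_ext[OF that(1) c])
      fix v assume "v \<in> ?A"
      then obtain j where j: "j \<in> J" "v = e j" by auto
      have "c \<in> ?A \<rightarrow> carrier K" "c' \<in> ?A \<rightarrow> carrier K" using c that(1) by (auto simp only: PiE_iff Pi_iff)
      then show "c' v = c v"
        using lin[OF _ j(1), of c] lin[OF _ j(1), of c'] j(2) that(2) \<open>lincomb c ?A = x\<close> by simp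
    qed
    ultimately show ?thesis using c by blast
  qed
  then show "basis ?A" using basis_criterion[OF A] by auto
  show "coef K V ?A x (e j) = \<theta> j x" if x: "x \<in> carrier V" and j: "j \<in> J" for x j
  proof -
    obtain c where c: "c \<in> ?A \<rightarrow>\<^sub>E carrier K \<and> lincomb c ?A = x" using ex[OF x] by auto
    then have "coef K V ?A x = c" unfolding coef_def using ex[OF x] by (intro the_equality) auto
    moreover have "c \<in> ?A \<rightarrow> carrier K" using c by (auto simp only: PiE_iff Pi_iff)
    ultimately show ?thesis using lin[OF _ j, of c] c by simp
  qed
qed

text \<open>By \<open>ex1\<close>, evaluation is a bijection from the space onto all families over
  \<open>J\<close>; the preimages of the unit families form a basis. Two such systems on one space
  serve in \<open>card_eq_of_linear_bij\<close> to compare the sizes of their index sets.\<close>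

lemma dim_eq_card_dual:
  fixes \<theta> :: "'j \<Rightarrow> 'c \<Rightarrow> 'a"
  assumes "finite J" and "\<And>j. j \<in> J \<Longrightarrow> linfun K V (\<theta> j)"
    and ex1: "\<And>g. (\<And>j. j \<in> J \<Longrightarrow> g j \<in> carrier K) \<Longrightarrow> \<exists>!x. x \<in> carrier V \<and> (\<forall>j\<in>J. \<theta> j x = g j)"
  shows "dim = card J"
proof -
  have "\<exists>x\<in>carrier V. \<forall>i\<in>J. \<theta> i x = (if i = j then \<one> else \<zero>)" for j
  proof -
    have "\<exists>!x. x \<in> carrier V \<and> (\<forall>i\<in>J. \<theta> i x = (if i = j then \<one> else \<zero>))"
      by (rule ex1) auto
    then show ?thesis by blast
  qed
  then obtain e where e: "\<And>j. e j \<in> carrier V"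
      "\<And>i j. i \<in> J \<Longrightarrow> \<theta> i (e j) = (if i = j then \<one> else \<zero>)" by metis
  have sep: "x = \<zero>\<^bsub>V\<^esub>" if "x \<in> carrier V" "\<And>j. j \<in> J \<Longrightarrow> \<theta> j x = \<zero>" for x
    using ex1[of "\<lambda>_. \<zero>"] that assms(2) by auto
  have "inj_on e J" "basis (e ` J)"
    by (rule dual_basis[of J e \<theta>]; use assms(1,2) e sep in blast)+
  then show ?thesis using dim_basis[of "e ` J"] card_image[of e J] assms(1) by simp
qed

section \<open>Coefficients with respect to a finite basis\<close>

lemma coef_props:
  assumes "finite B" "basis B" "x \<in> carrier V"
  shows "coef K V B x \<in> B \<rightarrow>\<^sub>E carrier K" "lincomb (coef K V B x) B = x"
proof -
  have "\<exists>!c. c \<in> B \<rightarrow>\<^sub>E carrier K \<and> x = lincomb c B"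
    using basis_criterion[of B] assms basis_def by (auto simp: eq_commute)
  from theI'[OF this] show "coef K V B x \<in> B \<rightarrow>\<^sub>E carrier K" "lincomb (coef K V B x) B = x"
    by (auto simp: coef_def)
qed

lemma coef_unique:
  assumes "finite B" "basis B" "c \<in> B \<rightarrow> carrier K" "b \<in> B"
  shows "coef K V B (lincomb c B) b = c b"
proof -
  have B: "B \<subseteq> carrier V" using assms(2) by (simp add: basis_def)
  have c: "restrict c B \<in> B \<rightarrow>\<^sub>E carrier K" "lincomb (restrict c B) B = lincomb c B"
    using assms B by (auto intro!: lincomb_cong)
  have "\<exists>!c'. c' \<in> B \<rightarrow>\<^sub>E carrier K \<and> lincomb c' B = lincomb c B"
    using basis_criterion[of B] assms B by simp
  moreover have "coef K V B (lincomb c B) \<in> B \<rightarrow>\<^sub>E carrier K"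
      "lincomb (coef K V B (lincomb c B)) B = lincomb c B"
    using coef_props[OF assms(1,2), of "lincomb c B"] B assms(3) by auto
  ultimately have "coef K V B (lincomb c B) = restrict c B" using c by blast
  then show ?thesis using assms(4) by simp
qed

lemma linfun_coef:
  assumes "finite B" "basis B" "b \<in> B"
  shows "linfun K V (\<lambda>x. coef K V B x b)"
proof -
  have B: "B \<subseteq> carrier V" using assms(2) by (simp add: basis_def)
  note cp = coef_props[OF assms(1,2)]
  have 1: "coef K V B x b \<in> carrier K" if "x \<in> carrier V" for x
    using cp(1)[OF that] assms(3) by auto
  have 2: "coef K V B (x \<oplus>\<^bsub>V\<^esub> y) b = coef K V B x b \<oplus> coef K V B y b"
    if x: "x \<in> carrier V" and y: "y \<in> carrier V" for x y
  proof -
    have "coef K V B (lincomb (\<lambda>v. coef K V B x v \<oplus> coef K V B y v) B) b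
        = coef K V B x b \<oplus> coef K V B y b"
      using cp(1)[OF x] cp(1)[OF y] assms by (intro coef_unique) auto
    also have "lincomb (\<lambda>v. coef K V B x v \<oplus> coef K V B y v) B = x \<oplus>\<^bsub>V\<^esub> y"
      using lincomb_sum[OF assms(1) B, of "coef K V B x" "coef K V B y"]
        cp[OF x] cp[OF y] by (simp add: PiE_def)
    finally show ?thesis .
  qed
  have 3: "coef K V B (c \<odot>\<^bsub>V\<^esub> x) b = c \<otimes> coef K V B x b"
    if x: "x \<in> carrier V" and c: "c \<in> carrier K" for x c
  proof -
    have "coef K V B (lincomb (\<lambda>v. c \<otimes> coef K V B x v) B) b = c \<otimes> coef K V B x b"
      using cp(1)[OF x] c assms by (intro coef_unique) auto
    also have "lincomb (\<lambda>v. c \<otimes> coef K V B x v) B = c \<odot>\<^bsub>V\<^esub> x"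
      using lincomb_smult[OF B, of "coef K V B x" c] cp[OF x] c by (simp add: PiE_def)
    finally show ?thesis .
  qed
  show ?thesis using 1 2 3 by (auto simp: linfun_def)
qed

lemma coef_basis_elem:
  assumes "finite B" "basis B" "b \<in> B" "b' \<in> B"
  shows "coef K V B b b' = (if b' = b then \<one> else \<zero>)"
proof -
  have B: "B \<subseteq> carrier V" using assms(2) by (simp add: basis_def)
  let ?c = "\<lambda>v. if v = b then \<one> else \<zero>"
  have "lincomb ?c (B - {b}) = \<zero>\<^bsub>V\<^esub>"
    using B by (simp add: lincomb_def) (rule M.add.finprod_one_eqI, auto)
  then have "lincomb ?c B = b"
    using lincomb_del2[OF assms(1) B, of ?c b] assms B by auto
  then show ?thesis using coef_unique[OF assms(1,2), of ?c b'] assms by auto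
qed

lemma coef_eq_zero_iff:
  assumes "finite B" "basis B" "x \<in> carrier V"
  shows "x = \<zero>\<^bsub>V\<^esub> \<longleftrightarrow> (\<forall>b\<in>B. coef K V B x b = \<zero>)"
proof
  assume "\<forall>b\<in>B. coef K V B x b = \<zero>"
  moreover have B: "B \<subseteq> carrier V" using assms(2) by (simp add: basis_def)
  ultimately have "lincomb (coef K V B x) B = \<zero>\<^bsub>V\<^esub>"
    unfolding lincomb_def by (intro M.add.finprod_one_eqI) auto
  then show "x = \<zero>\<^bsub>V\<^esub>" using coef_props(2)[OF assms] by simp
qed (use linfun_zero[OF linfun_coef[OF assms(1,2)]] in auto)

text \<open>Sublevel spaces are spans of basis elements; this turns membership in them into
  vanishing of coefficients, the form in which the filtration is handled from here on.\<close>

lemma mem_span_iff_coef: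
  assumes fin: "finite B" and B: "basis B" and A: "A \<subseteq> B"
  shows "x \<in> span A \<longleftrightarrow> x \<in> carrier V \<and> (\<forall>b\<in>B - A. coef K V B x b = \<zero>)"
proof
  have BV: "B \<subseteq> carrier V" using B by (simp add: basis_def)
  assume x: "x \<in> span A"
  have "coef K V B x b = \<zero>" if "b \<in> B - A" for b
    using that A BV coef_basis_elem[OF fin B]
    by - (rule linfun_span_zero[OF linfun_coef[OF fin B] _ _ x], auto)
  then show "x \<in> carrier V \<and> (\<forall>b\<in>B - A. coef K V B x b = \<zero>)"
    using x A BV span_closed by blast
next
  assume r: "x \<in> carrier V \<and> (\<forall>b\<in>B - A. coef K V B x b = \<zero>)"
  have BV: "B \<subseteq> carrier V" using B by (simp add: basis_def)
  have c: "coef K V B x \<in> B \<rightarrow> carrier K" using coef_props(1)[OF fin B] r by auto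
  have "lincomb (coef K V B x) (B - A) = \<zero>\<^bsub>V\<^esub>"
    unfolding lincomb_def using r BV by (intro M.add.finprod_one_eqI) auto
  moreover have "lincomb (coef K V B x) (A \<union> (B - A))
      = lincomb (coef K V B x) A \<oplus>\<^bsub>V\<^esub> lincomb (coef K V B x) (B - A)"
    using fin A BV c by (intro lincomb_union) (auto intro: finite_subset simp: Pi_def)
  moreover have "A \<union> (B - A) = B" using A by auto
  moreover have "lincomb (coef K V B x) A \<in> carrier V" using A BV c by (intro lincomb_closed) auto
  ultimately have "x = lincomb (coef K V B x) A" using coef_props(2)[OF fin B] r by simp
  moreover have "finite A" using fin A by (rule finite_subset[rotated])
  ultimately show "x \<in> span A" unfolding span_def using c A by blast
qed

text \<open>\<open>x\<close> lies in the span of the basis elements that occur in it, so a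
  functional vanishing on all of these vanishes at \<open>x\<close>. Applied to a coefficient of the
  boundary, this produces an element of \<open>x\<close> whose boundary contains a given basis
  element.\<close>

lemma linfun_nonzero_coef:
  assumes fin: "finite B" and B: "basis B" and l: "linfun K V l" and x: "x \<in> carrier V"
    and nz: "l x \<noteq> \<zero>"
  shows "\<exists>b\<in>B. coef K V B x b \<noteq> \<zero> \<and> l b \<noteq> \<zero>"
proof (rule ccontr)
  assume "\<not> ?thesis"
  then have *: "l b = \<zero>" if "b \<in> {b \<in> B. coef K V B x b \<noteq> \<zero>}" for b using that by auto
  have "x \<in> span {b \<in> B. coef K V B x b \<noteq> \<zero>}" using x by (subst mem_span_iff_coef[OF fin B]) auto
  moreover have "{b \<in> B. coef K V B x b \<noteq> \<zero>} \<subseteq> carrier V" using B by (auto simp: basis_def)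
  ultimately show False using linfun_span_zero[OF l _ *] nz by blast
qed

lemma basis_finite: "fin_dim \<Longrightarrow> basis B \<Longrightarrow> finite B"
  using fin_dim_li_fin basis_def by blast

lemma fin_dim_of_basis: "finite B \<Longrightarrow> basis B \<Longrightarrow> fin_dim"
  unfolding fin_dim_def basis_def by blast

end

section \<open>Counting in multisets\<close>

text \<open>Occurrences of \<open>I\<close> are numbered by enumerating the fibre of
  \<open>g\<close> over \<open>I\<close>, whose size is the multiplicity of
  \<open>I\<close>.\<close>

lemma finite_bij_count:
  fixes g :: "'j \<Rightarrow> 'a"
  assumes "finite J" "M = image_mset g (mset_set J)"
  shows "\<exists>h. bij_betw h J {(I, i). i < count M I} \<and> (\<forall>j\<in>J. fst (h j) = g j)"
proof -
  have cnt: "count M I = card {j \<in> J. g j = I}" for I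
  proof -
    have "{j \<in> J. I = g j} = {j \<in> J. g j = I}" by auto
    then show ?thesis using assms by (simp add: count_image_mset' sum.If_cases) 
  qed
  have "\<exists>h. bij_betw h {j \<in> J. g j = I} {..<count M I}" for I
    using ex_bij_betw_finite_nat[of "{j \<in> J. g j = I}"] assms(1) by (simp add: cnt atLeast0LessThan)
  then obtain h where h: "\<And>I. bij_betw (h I) {j \<in> J. g j = I} {..<count M I}" by metis
  have "bij_betw (\<lambda>j. (g j, h (g j) j)) J {(I, i). i < count M I}"
    unfolding bij_betw_def
  proof
    show "inj_on (\<lambda>j. (g j, h (g j) j)) J"
      using h by (auto simp: inj_on_def bij_betw_def)
    show "(\<lambda>j. (g j, h (g j) j)) ` J = {(I, i). i < count M I}"
    proof safe
      fix j assume "j \<in> J" then show "h (g j) j < count M (g j)"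
        using bij_betwE[OF h[of "g j"]] by auto
    next
      fix I i assume "i < count M I"
      then have "i \<in> h I ` {j \<in> J. g j = I}" using h[of I] by (simp add: bij_betw_def)
      then show "(I, i) \<in> (\<lambda>j. (g j, h (g j) j)) ` J" by force
    qed
  qed
  then show ?thesis by force
qed

text \<open>The numberings in the single degrees are glued along \<open>n\<close>. Both barcodes are
  images of one index set, so two such bijections compose to the bijection between them.\<close>

lemma occurrences_bij:
  fixes n :: "'j \<Rightarrow> nat" and g :: "'j \<Rightarrow> 'a"
  assumes fin: "finite J" and M: "\<And>k. M k = image_mset g (mset_set {j \<in> J. n j = k})"
  shows "\<exists>h. bij_betw h J (occurrences M) \<and> (\<forall>j\<in>J. \<exists>i. h j = (n j, g j, i))"
proof -
  have "\<exists>h. bij_betw h {j \<in> J. n j = k} {(I, i). i < count (M k) I} \<and> (\<forall>j\<in>{j \<in> J. n j = k}. fst (h j) = g j)" for k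
    using fin by (intro finite_bij_count[OF _ M]) auto
  then have "\<exists>h. \<forall>k. bij_betw (h k) {j \<in> J. n j = k} {(I, i). i < count (M k) I} \<and>
      (\<forall>j\<in>{j \<in> J. n j = k}. fst (h k j) = g j)"
    by (intro choice allI)
  then obtain h where h: "\<And>k. bij_betw (h k) {j \<in> J. n j = k} {(I, i). i < count (M k) I}"
    and hg: "\<And>k j. j \<in> J \<Longrightarrow> n j = k \<Longrightarrow> fst (h k j) = g j"
    by auto
  have "bij_betw (\<lambda>j. (n j, h (n j) j)) J (occurrences M)"
    unfolding bij_betw_def
  proof
    show "inj_on (\<lambda>j. (n j, h (n j) j)) J"
      using h by (auto simp: inj_on_def bij_betw_def)
    show "(\<lambda>j. (n j, h (n j) j)) ` J = occurrences M"
    proof (intro equalityI subsetI)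
      fix x assume "x \<in> (\<lambda>j. (n j, h (n j) j)) ` J"
      then obtain j where "j \<in> J" "x = (n j, h (n j) j)" by auto
      then show "x \<in> occurrences M"
        using bij_betwE[OF h[of "n j"]] by (auto simp: occurrences_def)
    next
      fix x assume "x \<in> occurrences M"
      then have "snd x \<in> h (fst x) ` {j \<in> J. n j = fst x}"
        using h[of "fst x"] by (auto simp: bij_betw_def occurrences_def)
      then obtain j where "j \<in> J" "x = (n j, h (n j) j)" by (auto simp: prod_eq_iff)
      then show "x \<in> (\<lambda>j. (n j, h (n j) j)) ` J" by blast
    qed
  qed
  moreover have "\<exists>i. (n j, h (n j) j) = (n j, g j, i)" if "j \<in> J" for j
    using hg[OF that refl] by (cases "h (n j) j") auto
  ultimately show ?thesis by blast
qed

lemma finite_occurrences: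
  assumes "finite {n. M n \<noteq> {#}}"
  shows "finite (occurrences M)"
proof -
  have "occurrences M \<subseteq> (\<Union>n\<in>{n. M n \<noteq> {#}}. \<Union>I\<in>set_mset (M n). (\<lambda>i. (n, I, i)) ` {..<count (M n) I})"
    by (force simp: occurrences_def count_greater_zero_iff[symmetric] simp del: count_greater_zero_iff)
  then show ?thesis by (rule finite_subset) (use assms in auto)
qed

lemma finite_copies: "finite {(I, i). i < count M I}"
proof -
  have "{(I, i). i < count M I} \<subseteq> (\<Union>I\<in>set_mset M. (\<lambda>i. (I, i)) ` {..<count M I})"
    by (force simp: count_greater_zero_iff[symmetric] simp del: count_greater_zero_iff)
  then show ?thesis by (rule finite_subset) auto
qed

lemma card_copies: "card {x \<in> {(I, i). i < count M I}. fst x = J} = count M J"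
proof -
  have "{x \<in> {(I, i). i < count M I}. fst x = J} = Pair J ` {..<count M J}" by auto
  then show ?thesis by (simp add: card_image inj_on_def)
qed

lemma card_occurrences:
  "card {x \<in> occurrences M. fst x = n \<and> fst (snd x) = J} = count (M n) J"
proof -
  have "{x \<in> occurrences M. fst x = n \<and> fst (snd x) = J} = (\<lambda>i. (n, J, i)) ` {..<count (M n) J}"
    by (auto simp: occurrences_def)
  then show ?thesis by (simp add: card_image inj_on_def)
qed

lemma count_image_mset_set: "finite J \<Longrightarrow> count (image_mset g (mset_set J)) I = card {j \<in> J. g j = I}"
  by (simp add: count_image_mset' sum.If_cases) (metis (mono_tags, lifting) Collect_cong)

lemma card_diff_pred:
  assumes "finite J" "\<And>j. j \<in> J \<Longrightarrow> Q j \<Longrightarrow> P j"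
  shows "card {j \<in> J. P j \<and> \<not> Q j} = card {j \<in> J. P j} - card {j \<in> J. Q j}"
proof -
  have "{j \<in> J. P j \<and> \<not> Q j} = {j \<in> J. P j} - {j \<in> J. Q j}" by auto
  then show ?thesis using assms by (auto intro!: card_Diff_subset)
qed

text \<open>Inclusion-exclusion: the point \<open>(a, b)\<close> is the product of the differences \<open>p1 - p2\<close> and \<open>q1 - q2\<close>.\<close>
lemma card_eq_of_quadrants:
  fixes s :: "'j \<Rightarrow> 'a" and t :: "'j \<Rightarrow> 'b" and s' :: "'k \<Rightarrow> 'a" and t' :: "'k \<Rightarrow> 'b"
  assumes fin: "finite J" "finite J'"
    and N: "\<And>p q. p \<in> {p1, p2} \<Longrightarrow> q \<in> {q1, q2} \<Longrightarrow>
              card {j \<in> J. p (s j) \<and> q (t j)} = card {j \<in> J'. p (s' j) \<and> q (t' j)}"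
    and p: "\<And>x. x \<in> s ` J \<union> s' ` J' \<Longrightarrow> (p2 x \<longrightarrow> p1 x) \<and> (x = a \<longleftrightarrow> p1 x \<and> \<not> p2 x)"
    and q: "\<And>x. x \<in> t ` J \<union> t' ` J' \<Longrightarrow> (q2 x \<longrightarrow> q1 x) \<and> (x = b \<longleftrightarrow> q1 x \<and> \<not> q2 x)"
  shows "card {j \<in> J. s j = a \<and> t j = b} = card {j \<in> J'. s' j = a \<and> t' j = b}"
proof -
  have 1: "card {j \<in> J. s j = a \<and> t j = b} =
      (card {j \<in> J. p1 (s j) \<and> q1 (t j)} - card {j \<in> J. p2 (s j) \<and> q1 (t j)})
    - (card {j \<in> J. p1 (s j) \<and> q2 (t j)} - card {j \<in> J. p2 (s j) \<and> q2 (t j)})"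
    if fin: "finite J" and p: "\<And>j. j \<in> J \<Longrightarrow> (p2 (s j) \<longrightarrow> p1 (s j)) \<and> (s j = a \<longleftrightarrow> p1 (s j) \<and> \<not> p2 (s j))"
      and q: "\<And>j. j \<in> J \<Longrightarrow> (q2 (t j) \<longrightarrow> q1 (t j)) \<and> (t j = b \<longleftrightarrow> q1 (t j) \<and> \<not> q2 (t j))"
    for J :: "'i set" and s :: "'i \<Rightarrow> 'a" and t :: "'i \<Rightarrow> 'b"
  proof -
    have "{j \<in> J. s j = a \<and> r (t j)} = {j \<in> J. (p1 (s j) \<and> r (t j)) \<and> \<not> (p2 (s j) \<and> r (t j))}" for r
      using p by auto
    then have "card {j \<in> J. s j = a \<and> r (t j)} =
        card {j \<in> J. p1 (s j) \<and> r (t j)} - card {j \<in> J. p2 (s j) \<and> r (t j)}" for r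
      using p by (simp only:) (intro card_diff_pred fin, auto)
    moreover have "{j \<in> J. s j = a \<and> t j = b} =
        {j \<in> J. (s j = a \<and> q1 (t j)) \<and> \<not> (s j = a \<and> q2 (t j))}"
      using q by auto
    then have "card {j \<in> J. s j = a \<and> t j = b} =
        card {j \<in> J. s j = a \<and> q1 (t j)} - card {j \<in> J. s j = a \<and> q2 (t j)}"
      using q by (simp only:) (intro card_diff_pred fin, auto)
    ultimately show ?thesis by simp
  qed
  show ?thesis
    by (subst 1[OF fin(1)], use p in blast, use q in blast, subst 1[OF fin(2)], use p in blast, use q in blast)
      (simp add: N)
qed

text \<open>Only finitely many values occur, and on these \<open>c < x\<close> means
  \<open>z \<le> x\<close>. A half-line can thus be moved slightly below \<open>z\<close>, and the
  difference of two half-lines isolates \<open>z\<close>.\<close>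

lemma real_gap_below:
  fixes z :: real assumes "finite A"
  shows "\<exists>c<z. \<forall>x\<in>A. c < x \<longrightarrow> z \<le> x"
proof -
  \<comment> \<open>\<open>z - 1\<close> keeps the set non-empty.\<close>
  let ?A = "insert (z - 1) {x\<in>A. x < z}"
  have "finite ?A" using assms by auto
  then have "Max ?A < z" "\<And>x. x \<in> ?A \<Longrightarrow> x \<le> Max ?A" by (auto simp: Max_less_iff)
  then show ?thesis by (intro exI[of _ "Max ?A"]) force
qed

lemma ereal_gap_below:
  fixes z :: ereal and l :: real assumes "finite A" "ereal l < z"
  shows "\<exists>c\<ge>l. ereal c < z \<and> (\<forall>x\<in>A. ereal c < x \<longrightarrow> z \<le> x)"
proof -
  \<comment> \<open>\<open>l\<close> is the required lower bound; between \<open>l\<close> and the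
    strict upper bound \<open>z\<close> the maximum is a real number.\<close>
  let ?A = "insert (ereal l) {x\<in>A. x < z}"
  have A: "finite ?A" using assms by auto
  then have m: "Max ?A < z" "ereal l \<le> Max ?A" using assms(2) by (auto simp: Max_less_iff)
  then obtain c where c: "Max ?A = ereal c" by (cases "Max ?A") auto
  have "\<And>x. x \<in> ?A \<Longrightarrow> x \<le> ereal c" using A c Max_ge by metis
  then show ?thesis using m c by (intro exI[of _ c]) force
qed

section \<open>Quotients\<close>

lemma (in ring) minus_eq_zero_iff:
  assumes "x \<in> carrier R" "y \<in> carrier R"
  shows "x \<ominus> y = \<zero> \<longleftrightarrow> x = y"
proof
  assume "x \<ominus> y = \<zero>"
  moreover have "x = (x \<ominus> y) \<oplus> y" using assms by (simp add: a_minus_def a_assoc l_neg)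
  ultimately show "x = y" using assms by simp
qed (use assms in \<open>simp add: a_minus_def r_neg\<close>)

context coordinate_space
begin

lemma linfun_mult_right:
  assumes "linfun K V l" "c \<in> carrier K"
  shows "linfun K V (\<lambda>x. l x \<otimes> c)"
  using assms by (auto simp: linfun_def R.l_distr R.m_assoc)

section \<open>Cosets and their chosen representatives\<close>

lemma cls_obtain:
  assumes "submodule K W V" "x \<in> carrier V"
  obtains w where "w \<in> W" "cls V W x = w \<oplus>\<^bsub>V\<^esub> x"
proof -
  have "\<exists>w\<in>W. cls V W x = w \<oplus>\<^bsub>V\<^esub> x"
    unfolding cls_def
    by (rule someI[of "\<lambda>y. \<exists>w\<in>W. y = w \<oplus>\<^bsub>V\<^esub> x" "\<zero>\<^bsub>V\<^esub> \<oplus>\<^bsub>V\<^esub> x"])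
      (use submodule.zero_closed[OF assms(1)] in blast)
  then show thesis using that by blast
qed

lemma submodule_neg:
  assumes "submodule K W V" "w \<in> W"
  shows "\<ominus>\<^bsub>V\<^esub> w \<in> W"
proof -
  have "w \<in> carrier V" using assms submodule.subset by blast
  then have "\<ominus>\<^bsub>V\<^esub> w = (\<ominus> \<one>) \<odot>\<^bsub>V\<^esub> w" by (simp add: smult_minus_1)
  then show ?thesis using submodule.smult_closed[OF assms(1) _ assms(2), of "\<ominus> \<one>"] by simp
qed

lemma cls_closed: "submodule K W V \<Longrightarrow> x \<in> carrier V \<Longrightarrow> cls V W x \<in> carrier V"
  by (metis cls_obtain M.a_closed submodule.subset subsetD)

text \<open>Elements of one coset give the same predicate under the choice operator, hence literally
  the same representative.\<close>

lemma cls_absorb: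
  assumes W: "submodule K W V" and w: "w \<in> W" and x: "x \<in> carrier V"
  shows "cls V W (w \<oplus>\<^bsub>V\<^esub> x) = cls V W x"
proof -
  have sub: "u \<in> carrier V" if "u \<in> W" for u using that submodule.subset[OF W] by blast
  have "(\<exists>u\<in>W. y = u \<oplus>\<^bsub>V\<^esub> (w \<oplus>\<^bsub>V\<^esub> x)) \<longleftrightarrow> (\<exists>u\<in>W. y = u \<oplus>\<^bsub>V\<^esub> x)" for y
  proof
    assume "\<exists>u\<in>W. y = u \<oplus>\<^bsub>V\<^esub> (w \<oplus>\<^bsub>V\<^esub> x)"
    then obtain u where u: "u \<in> W" "y = u \<oplus>\<^bsub>V\<^esub> (w \<oplus>\<^bsub>V\<^esub> x)" by blast
    then have "y = (u \<oplus>\<^bsub>V\<^esub> w) \<oplus>\<^bsub>V\<^esub> x" using sub w x by (simp add: M.a_assoc)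
    then show "\<exists>u\<in>W. y = u \<oplus>\<^bsub>V\<^esub> x" using submodule.m_closed[OF W u(1) w] by blast
  next
    assume "\<exists>u\<in>W. y = u \<oplus>\<^bsub>V\<^esub> x"
    then obtain u where u: "u \<in> W" "y = u \<oplus>\<^bsub>V\<^esub> x" by blast
    have "(u \<oplus>\<^bsub>V\<^esub> \<ominus>\<^bsub>V\<^esub> w) \<oplus>\<^bsub>V\<^esub> (w \<oplus>\<^bsub>V\<^esub> x) = u \<oplus>\<^bsub>V\<^esub> ((\<ominus>\<^bsub>V\<^esub> w \<oplus>\<^bsub>V\<^esub> w) \<oplus>\<^bsub>V\<^esub> x)"
      using sub u w x by (simp add: M.a_assoc)
    then have "y = (u \<oplus>\<^bsub>V\<^esub> \<ominus>\<^bsub>V\<^esub> w) \<oplus>\<^bsub>V\<^esub> (w \<oplus>\<^bsub>V\<^esub> x)" using u sub w x by (simp add: M.l_neg)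
    then show "\<exists>u\<in>W. y = u \<oplus>\<^bsub>V\<^esub> (w \<oplus>\<^bsub>V\<^esub> x)"
      using submodule.m_closed[OF W u(1) submodule_neg[OF W w]] by blast
  qed
  then show ?thesis unfolding cls_def by simp
qed

lemma cls_idem: "submodule K W V \<Longrightarrow> x \<in> carrier V \<Longrightarrow> cls V W (cls V W x) = cls V W x"
  by (metis cls_obtain cls_absorb)

lemma cls_eq_iff:
  assumes W: "submodule K W V" and x: "x \<in> carrier V" and y: "y \<in> carrier V"
  shows "cls V W x = cls V W y \<longleftrightarrow> x \<ominus>\<^bsub>V\<^esub> y \<in> W"
proof
  have sub: "u \<in> carrier V" if "u \<in> W" for u using that submodule.subset[OF W] by blast
  obtain u where u: "u \<in> W" "cls V W x = u \<oplus>\<^bsub>V\<^esub> x" by (rule cls_obtain[OF W x])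
  obtain v where v: "v \<in> W" "cls V W y = v \<oplus>\<^bsub>V\<^esub> y" by (rule cls_obtain[OF W y])
  assume "cls V W x = cls V W y"
  then have eq: "u \<oplus>\<^bsub>V\<^esub> x = v \<oplus>\<^bsub>V\<^esub> y" using u v by simp
  have "x \<ominus>\<^bsub>V\<^esub> y = \<ominus>\<^bsub>V\<^esub> u \<oplus>\<^bsub>V\<^esub> (u \<oplus>\<^bsub>V\<^esub> x) \<oplus>\<^bsub>V\<^esub> \<ominus>\<^bsub>V\<^esub> y"
    using sub[OF u(1)] x y by (simp add: a_minus_def M.r_neg1)
  also have "\<dots> = \<ominus>\<^bsub>V\<^esub> u \<oplus>\<^bsub>V\<^esub> (v \<oplus>\<^bsub>V\<^esub> (y \<oplus>\<^bsub>V\<^esub> \<ominus>\<^bsub>V\<^esub> y))"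
    using sub[OF u(1)] sub[OF v(1)] x y by (simp only: eq) (simp add: M.a_assoc)
  also have "\<dots> = \<ominus>\<^bsub>V\<^esub> u \<oplus>\<^bsub>V\<^esub> v" using sub[OF u(1)] sub[OF v(1)] y by (simp add: M.r_neg)
  finally show "x \<ominus>\<^bsub>V\<^esub> y \<in> W" using submodule.m_closed[OF W submodule_neg[OF W u(1)] v(1)] by simp
next
  assume w: "x \<ominus>\<^bsub>V\<^esub> y \<in> W"
  have "x = (x \<ominus>\<^bsub>V\<^esub> y) \<oplus>\<^bsub>V\<^esub> y" using x y by (simp add: a_minus_def M.a_assoc M.l_neg)
  then show "cls V W x = cls V W y" using cls_absorb[OF W w y] by simp
qed

lemma cls_eq_zero_iff:
  assumes "submodule K W V" "x \<in> carrier V"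
  shows "cls V W x = cls V W \<zero>\<^bsub>V\<^esub> \<longleftrightarrow> x \<in> W"
  using cls_eq_iff[OF assms, of "\<zero>\<^bsub>V\<^esub>"] assms(2) M.minus_equality[of "\<zero>\<^bsub>V\<^esub>" "\<zero>\<^bsub>V\<^esub>"]
  by (simp add: a_minus_def)

lemma cls_add_right:
  assumes W: "submodule K W V" and x: "x \<in> carrier V" and y: "y \<in> carrier V"
  shows "cls V W (x \<oplus>\<^bsub>V\<^esub> cls V W y) = cls V W (x \<oplus>\<^bsub>V\<^esub> y)"
proof -
  obtain v where v: "v \<in> W" "cls V W y = v \<oplus>\<^bsub>V\<^esub> y" by (rule cls_obtain[OF W y])
  have "v \<in> carrier V" using v submodule.subset[OF W] by blast
  then have "x \<oplus>\<^bsub>V\<^esub> cls V W y = v \<oplus>\<^bsub>V\<^esub> (x \<oplus>\<^bsub>V\<^esub> y)"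
    using v x y by (simp add: M.a_lcomm)
  then show ?thesis using cls_absorb[OF W v(1)] x y by simp
qed

lemma cls_add_left:
  assumes W: "submodule K W V" and x: "x \<in> carrier V" and y: "y \<in> carrier V"
  shows "cls V W (cls V W x \<oplus>\<^bsub>V\<^esub> y) = cls V W (x \<oplus>\<^bsub>V\<^esub> y)"
  using cls_add_right[OF W y x] cls_closed[OF W x] x y by (simp add: M.a_comm)

lemma cls_smult:
  assumes W: "submodule K W V" and x: "x \<in> carrier V" and c: "c \<in> carrier K"
  shows "cls V W (c \<odot>\<^bsub>V\<^esub> cls V W x) = cls V W (c \<odot>\<^bsub>V\<^esub> x)"
proof -
  obtain v where v: "v \<in> W" "cls V W x = v \<oplus>\<^bsub>V\<^esub> x" by (rule cls_obtain[OF W x])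
  have "v \<in> carrier V" using v submodule.subset[OF W] by blast
  then have "c \<odot>\<^bsub>V\<^esub> cls V W x = c \<odot>\<^bsub>V\<^esub> v \<oplus>\<^bsub>V\<^esub> c \<odot>\<^bsub>V\<^esub> x"
    using v x c by (simp add: smult_r_distr)
  then show ?thesis using cls_absorb[OF W submodule.smult_closed[OF W c v(1)]] x c by simp
qed

lemmas cls_simps = cls_closed cls_idem cls_add_left cls_add_right cls_smult

lemma quot_sel [simp]:
  "carrier (quot V W) = cls V W ` carrier V"
  "\<zero>\<^bsub>quot V W\<^esub> = cls V W \<zero>\<^bsub>V\<^esub>"
  "x \<oplus>\<^bsub>quot V W\<^esub> y = cls V W (x \<oplus>\<^bsub>V\<^esub> y)"
  "c \<odot>\<^bsub>quot V W\<^esub> x = cls V W (c \<odot>\<^bsub>V\<^esub> x)"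
  by (simp_all add: quot_def)

lemma quot_coordinate_space:
  assumes W: "submodule K W V"
  shows "coordinate_space K (quot V W)"
  unfolding coordinate_space_def
proof (rule vs_criteria)
  show "field K" by (rule field_axioms)
  show "\<forall>v\<in>carrier (quot V W). \<exists>u\<in>carrier (quot V W). v \<oplus>\<^bsub>quot V W\<^esub> u = \<zero>\<^bsub>quot V W\<^esub>"
  proof
    fix v assume "v \<in> carrier (quot V W)"
    then obtain x where x: "x \<in> carrier V" "v = cls V W x" by auto
    then have "v \<oplus>\<^bsub>quot V W\<^esub> cls V W (\<ominus>\<^bsub>V\<^esub> x) = \<zero>\<^bsub>quot V W\<^esub>"
      by (simp add: cls_simps[OF W] M.r_neg)
    then show "\<exists>u\<in>carrier (quot V W). v \<oplus>\<^bsub>quot V W\<^esub> u = \<zero>\<^bsub>quot V W\<^esub>" using x by auto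
  qed
  show "\<forall>v w x. v \<in> carrier (quot V W) \<and> w \<in> carrier (quot V W) \<and> x \<in> carrier (quot V W) \<longrightarrow>
      (v \<oplus>\<^bsub>quot V W\<^esub> w) \<oplus>\<^bsub>quot V W\<^esub> x = v \<oplus>\<^bsub>quot V W\<^esub> (w \<oplus>\<^bsub>quot V W\<^esub> x)"
    by (auto simp: cls_simps[OF W] M.a_assoc)
qed (auto simp: cls_simps[OF W] M.a_comm smult_r_distr
    simp flip: smult_assoc1 smult_l_distr intro!: imageI cls_closed[OF W])

lemma cls_hom:
  assumes W: "submodule K W V"
  shows "cls V W \<in> lin_hom K V (quot V W)"
  by (auto simp: lin_hom_def cls_simps[OF W])

lemma linfun_cls:
  assumes W: "submodule K W V" and l: "linfun K V l" and z: "\<And>w. w \<in> W \<Longrightarrow> l w = \<zero>"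
    and x: "x \<in> carrier V"
  shows "l (cls V W x) = l x"
proof -
  obtain w where w: "w \<in> W" "cls V W x = w \<oplus>\<^bsub>V\<^esub> x" by (rule cls_obtain[OF W x])
  have "w \<in> carrier V" using w submodule.subset[OF W] by blast
  then show ?thesis using w linfun_add[OF l _ x] z linfun_closed[OF l x] by simp
qed

text \<open>Elements of the quotient are vectors of \<open>V\<close>, so a functional vanishing on
  \<open>W\<close> does not have to be descended: the same function works on the quotient.\<close>

lemma linfun_quot:
  assumes W: "submodule K W V" and l: "linfun K V l" and z: "\<And>w. w \<in> W \<Longrightarrow> l w = \<zero>"
  shows "linfun K (quot V W) l"
  unfolding linfun_def
  by (auto simp: linfun_cls[OF W l z] cls_closed[OF W] linfun_closed[OF l] linfun_add[OF l] linfun_smult[OF l])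

text \<open>\<open>W\<close> is the common kernel of the functionals, so they separate classes and
  \<open>dual_basis\<close> applies in the quotient. This yields the basis of a simplified complex
  together with its coefficients.\<close>

lemma quot_dual_basis:
  assumes W: "submodule K W V" and fin: "finite S" and S: "S \<subseteq> carrier V"
    and \<theta>: "\<And>s. s \<in> S \<Longrightarrow> linfun K V (\<theta> s)"
    and dual: "\<And>s s'. s \<in> S \<Longrightarrow> s' \<in> S \<Longrightarrow> \<theta> s s' = (if s = s' then \<one> else \<zero>)"
    and ker: "\<And>x. x \<in> carrier V \<Longrightarrow> x \<in> W \<longleftrightarrow> (\<forall>s\<in>S. \<theta> s x = \<zero>)"
  shows "inj_on (cls V W) S" "vectorspace.basis K (quot V W) (cls V W ` S)"
    and "\<And>x s. x \<in> carrier V \<Longrightarrow> s \<in> S \<Longrightarrow> coef K (quot V W) (cls V W ` S) (cls V W x) (cls V W s) = \<theta> s x"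
proof -
  interpret Q: coordinate_space K "quot V W" by (rule quot_coordinate_space[OF W])
  have z: "\<theta> s w = \<zero>" if "s \<in> S" "w \<in> W" for s w
    using ker[of w] that submodule.subset[OF W] by blast
  have 1: "cls V W s \<in> carrier (quot V W)" if "s \<in> S" for s using S that by auto
  have 2: "linfun K (quot V W) (\<theta> s)" if "s \<in> S" for s
    using linfun_quot[OF W \<theta>] z that by blast
  have 3: "\<theta> s (cls V W x) = \<theta> s x" if "s \<in> S" "x \<in> carrier V" for s x
    using linfun_cls[OF W \<theta>] z that by blast
  have 4: "\<theta> s (cls V W s') = (if s = s' then \<one> else \<zero>)" if "s \<in> S" "s' \<in> S" for s s'
    using 3[OF that(1)] S that dual by auto
  have 5: "y = \<zero>\<^bsub>quot V W\<^esub>"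
    if y: "y \<in> carrier (quot V W)" and y0: "\<And>s. s \<in> S \<Longrightarrow> \<theta> s y = \<zero>" for y
  proof -
    obtain x where x: "x \<in> carrier V" "y = cls V W x" using y by auto
    have "\<theta> s x = \<zero>" if "s \<in> S" for s using 3[OF that x(1)] y0[OF that] x(2) by simp
    then have "x \<in> W" using ker[OF x(1)] by blast
    then show ?thesis using cls_eq_zero_iff[OF W x(1)] x by simp
  qed
  note db = Q.dual_basis[of S "cls V W" \<theta>]
  show "inj_on (cls V W) S" by (rule db(1)[OF fin 1 2 4 5])
  show "vectorspace.basis K (quot V W) (cls V W ` S)" by (rule db(2)[OF fin 1 2 4 5])
  show "coef K (quot V W) (cls V W ` S) (cls V W x) (cls V W s) = \<theta> s x"
    if x: "x \<in> carrier V" and s: "s \<in> S" for x s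
  proof -
    have cx: "cls V W x \<in> carrier (quot V W)" using x by simp
    have "coef K (quot V W) (cls V W ` S) (cls V W x) (cls V W s) = \<theta> s (cls V W x)"
      by (rule db(3)[OF fin 1 2 4 5 cx s])
    then show ?thesis using 3[OF s x] by simp
  qed
qed

lemma span_singletonE:
  assumes "v \<in> carrier V" "x \<in> span {v}"
  obtains c where "c \<in> carrier K" "x = c \<odot>\<^bsub>V\<^esub> v"
proof -
  obtain a where a: "a \<in> {v} \<rightarrow> carrier K" "lincomb a {v} = x"
    using finite_in_span[of "{v}" x] assms by auto
  then have "x = a v \<odot>\<^bsub>V\<^esub> v" using assms(1) by (auto simp: lincomb_def)
  then show thesis using that a by auto
qed

lemma smult_mem_span_singleton: "v \<in> carrier V \<Longrightarrow> c \<in> carrier K \<Longrightarrow> c \<odot>\<^bsub>V\<^esub> v \<in> span {v}"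
  using submodule.smult_closed[OF span_is_submodule[of "{v}"]] in_own_span[of "{v}"] by auto

lemma submodule_zero: "submodule K {\<zero>\<^bsub>V\<^esub>} V"
  by unfold_locales auto

text \<open>The coset is a singleton, which forces the choice. In the degrees untouched by a
  simplification step the quotient map is therefore the identity.\<close>

lemma cls_trivial: "x \<in> carrier V \<Longrightarrow> cls V {\<zero>\<^bsub>V\<^esub>} x = x"
  by (simp add: cls_def)

end

section \<open>A single simplification step\<close>

abbreviation sublevel ::
    "('f, 'r) ring_scheme \<Rightarrow> ('f, 'v) complex_data \<Rightarrow> (nat \<Rightarrow> 'v set) \<Rightarrow> (nat \<Rightarrow> 'v \<Rightarrow> real) \<Rightarrow>
      nat \<Rightarrow> real \<Rightarrow> 'v set" where
  "sublevel F C B f k u \<equiv> LinearCombinations.module.span F (grade C k) {b \<in> B k. f k b \<le> u}"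

locale filtered_based_complex =
  fixes F :: "('f, 'r) ring_scheme" (structure) and C :: "('f, 'v) complex_data"
    and B :: "nat \<Rightarrow> 'v set" and f :: "nat \<Rightarrow> 'v \<Rightarrow> real"
  assumes based: "based_complex F C B" and filt: "based_filter F C B f"
begin

abbreviation co :: "nat \<Rightarrow> 'v \<Rightarrow> 'v \<Rightarrow> 'f" where
  "co k \<equiv> coef F (grade C k) (B k)"

abbreviation V :: "nat \<Rightarrow> ('f, 'v) module" where "V \<equiv> grade C"

lemma cs: "coordinate_space F (V k)"
  using based unfolding based_complex_def chain_complex_def coordinate_space_def by blast

lemma vs: "vectorspace F (V k)"
  using cs coordinate_space_def by blast

sublocale field F
  using vs[of 0] vectorspace.axioms(2) by blast

lemma B_basis: "vectorspace.basis F (V k) (B k)"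
  using based unfolding based_complex_def by blast

lemma B_finite: "finite (B k)"
  using based coordinate_space.basis_finite[OF cs _ B_basis]
  unfolding based_complex_def compact_complex_def by blast

lemma B_closed: "b \<in> B k \<Longrightarrow> b \<in> carrier (V k)"
  using B_basis[of k] vectorspace.basis_def[OF vs[of k]] by blast

lemma bd_hom: "bd C (Suc k) \<in> lin_hom F (V (Suc k)) (V k)"
  using based unfolding based_complex_def chain_complex_def by blast

lemma bd_closed: "x \<in> carrier (V (Suc k)) \<Longrightarrow> bd C (Suc k) x \<in> carrier (V k)"
  using bd_hom[of k] by (auto simp: lin_hom_def)

lemma bd_add: "x \<in> carrier (V (Suc k)) \<Longrightarrow> y \<in> carrier (V (Suc k)) \<Longrightarrow>
    bd C (Suc k) (x \<oplus>\<^bsub>V (Suc k)\<^esub> y) = bd C (Suc k) x \<oplus>\<^bsub>V k\<^esub> bd C (Suc k) y"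
  using lin_hom_add[OF bd_hom] by blast

lemma bd_smult: "c \<in> carrier F \<Longrightarrow> x \<in> carrier (V (Suc k)) \<Longrightarrow>
    bd C (Suc k) (c \<odot>\<^bsub>V (Suc k)\<^esub> x) = c \<odot>\<^bsub>V k\<^esub> bd C (Suc k) x"
  using lin_hom_smult[OF bd_hom] by blast

lemma bd_bd: "x \<in> carrier (V (Suc (Suc k))) \<Longrightarrow> bd C (Suc k) (bd C (Suc (Suc k)) x) = \<zero>\<^bsub>V k\<^esub>"
  using based unfolding based_complex_def chain_complex_def by blast

lemma linfun_co: "b \<in> B k \<Longrightarrow> linfun F (V k) (\<lambda>x. co k x b)"
  by (rule coordinate_space.linfun_coef[OF cs B_finite B_basis])

lemma linfun_co_bd: "b \<in> B k \<Longrightarrow> linfun F (V (Suc k)) (\<lambda>x. co k (bd C (Suc k) x) b)"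
  by (rule linfun_comp[OF linfun_co bd_hom])

lemma co_closed: "b \<in> B k \<Longrightarrow> x \<in> carrier (V k) \<Longrightarrow> co k x b \<in> carrier F"
  by (rule linfun_closed[OF linfun_co])

lemma co_zero: "b \<in> B k \<Longrightarrow> co k \<zero>\<^bsub>V k\<^esub> b = \<zero>"
  by (rule coordinate_space.linfun_zero[OF cs linfun_co])

lemma bd_zero: "bd C (Suc k) \<zero>\<^bsub>V (Suc k)\<^esub> = \<zero>\<^bsub>V k\<^esub>"
proof -
  interpret V: vectorspace F "V (Suc k)" by (rule vs)
  interpret W: vectorspace F "V k" by (rule vs)
  have "bd C (Suc k) (\<zero> \<odot>\<^bsub>V (Suc k)\<^esub> \<zero>\<^bsub>V (Suc k)\<^esub>) = \<zero>\<^bsub>V k\<^esub>"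
    using bd_smult[of "\<zero>" "\<zero>\<^bsub>V (Suc k)\<^esub>" k] bd_closed[of "\<zero>\<^bsub>V (Suc k)\<^esub>" k] by simp
  then show ?thesis by simp
qed

lemma co_basis: "b \<in> B k \<Longrightarrow> b' \<in> B k \<Longrightarrow> co k b b' = (if b' = b then \<one> else \<zero>)"
  by (rule coordinate_space.coef_basis_elem[OF cs B_finite B_basis])

lemma co_eqI:
  assumes "x \<in> carrier (V k)" "y \<in> carrier (V k)" "\<And>b. b \<in> B k \<Longrightarrow> co k x b = co k y b"
  shows "x = y"
  using coordinate_space.eq_of_linfuns[OF cs, where J = "B k" and \<theta> = "\<lambda>b x. co k x b"] linfun_co assms
    coordinate_space.coef_eq_zero_iff[OF cs B_finite B_basis] by blast

lemma incidence_co: "incidence F C B (Suc k) a b = co k (bd C (Suc k) a) b"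
  by (simp add: incidence_def)

lemma filter_nonneg: "b \<in> B k \<Longrightarrow> 0 \<le> f k b"
  using filt unfolding based_filter_def by blast

lemma filter_less: "a \<in> B (Suc k) \<Longrightarrow> b \<in> B k \<Longrightarrow> co k (bd C (Suc k) a) b \<noteq> \<zero> \<Longrightarrow> f k b < f (Suc k) a"
  using filt unfolding based_filter_def incidence_co by blast

lemma sublevel_iff:
  "x \<in> sublevel F C B f k t \<longleftrightarrow>
    x \<in> carrier (V k) \<and> (\<forall>b\<in>B k. co k x b \<noteq> \<zero> \<longrightarrow> f k b \<le> t)"
  using coordinate_space.mem_span_iff_coef[OF cs B_finite B_basis, of "{b \<in> B k. f k b \<le> t}" k x] by auto

lemma co_bd_nonzero:
  assumes "x \<in> carrier (V (Suc k))" "b \<in> B k" "co k (bd C (Suc k) x) b \<noteq> \<zero>"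
  shows "\<exists>a\<in>B (Suc k). co (Suc k) x a \<noteq> \<zero> \<and> co k (bd C (Suc k) a) b \<noteq> \<zero>"
  using coordinate_space.linfun_nonzero_coef[OF cs B_finite B_basis linfun_co_bd[OF assms(2)] assms(1,3)] .

end

text \<open>
  By minimality, \<open>f b' \<le> f b\<close> for all \<open>b'\<close> in \<open>\<partial>a\<close>, and \<open>f a \<le> f a'\<close> whenever \<open>b\<close> occurs in
  \<open>\<partial>a'\<close>. Hence the subcomplex spanned by \<open>a\<close> and \<open>\<partial>a\<close> has a complement that is compatible with
  the filtration: \<open>\<mu>\<close> is the coordinate along the subcomplex, and \<open>\<theta> k s\<close> the coordinate at \<open>s\<close> of
  the class modulo the subcomplex.
\<close>

locale pivot = filtered_based_complex F C B f
  for F :: "('f, 'r) ring_scheme" (structure) and C :: "('f, 'v) complex_data" and B f +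
  fixes n :: nat and a b :: 'v
  assumes a: "a \<in> B (Suc n)" and b: "b \<in> B n" and pivot: "co n (bd C (Suc n) a) b \<noteq> \<zero>"
    and minimal: "\<And>k a' b'. a' \<in> B (Suc k) \<Longrightarrow> b' \<in> B k \<Longrightarrow> co k (bd C (Suc k) a') b' \<noteq> \<zero> \<Longrightarrow>
      f (Suc n) a - f n b \<le> f (Suc k) a' - f k b'"
begin

text \<open>The conditions, here and in \<open>S\<close>, are left as they come from the body of
  \<open>simplify\<close> with \<open>m = Suc n\<close>, so that \<open>simplify_eq\<close> can fold
  them.\<close>

definition W :: "nat \<Rightarrow> 'v set" where
  "W k = (if k = Suc n then LinearCombinations.module.span F (V k) {a}
          else if Suc k = Suc n then LinearCombinations.module.span F (V k) {bd C (Suc n) a}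
          else {\<zero>\<^bsub>V k\<^esub>})"

definition S :: "nat \<Rightarrow> 'v set" where
  "S k = (if k = Suc n then B k - {a} else if Suc k = Suc n then B k - {b} else B k)"

abbreviation q :: "nat \<Rightarrow> 'v \<Rightarrow> 'v" where "q k \<equiv> cls (V k) (W k)"

abbreviation piv :: 'f where "piv \<equiv> co n (bd C (Suc n) a) b"

definition gen :: "nat \<Rightarrow> 'v" where "gen k = (if k = Suc n then a else bd C (Suc n) a)"

text \<open>Normalised to be 1 on \<open>gen k\<close>. Reading \<open>b\<close> in the boundary in
  the upper degree makes \<mu> commute with the differential (\<open>bd_\<mu>\<close>).\<close>

definition \<mu> :: "nat \<Rightarrow> 'v \<Rightarrow> 'f" where
  "\<mu> k x = (if k = Suc n then co n (bd C (Suc n) x) b else co n x b) \<otimes> inv piv"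

text \<open>Gaussian elimination: in the degree of \<open>b\<close>, the multiple of \<partial>a
  that cancels \<open>b\<close> is subtracted from \<open>x\<close>. At a boundary \<partial>a' the
  value is the reduced coefficient \<open><\<partial>a',s> - <\<partial>a',b> <\<partial>a,b>^-1
  <\<partial>a,s>\<close>. In the degree of \<open>a\<close> the subcomplex is spanned by a basis
  element, so the other coefficients stay as they are.\<close>

definition \<theta> :: "nat \<Rightarrow> 'v \<Rightarrow> 'v \<Rightarrow> 'f" where
  "\<theta> k s x = (if k = n then co n x s \<ominus> co n x b \<otimes> (inv piv \<otimes> co n (bd C (Suc n) a) s)
              else co k x s)"

lemma aV: "a \<in> carrier (V (Suc n))" by (rule B_closed[OF a])

lemma bdaV: "bd C (Suc n) a \<in> carrier (V n)" by (rule bd_closed[OF aV])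

lemma piv_closed: "piv \<in> carrier F" by (rule co_closed[OF b bdaV])

lemma piv_inv: "inv piv \<in> carrier F" "piv \<otimes> inv piv = \<one>" "inv piv \<otimes> piv = \<one>"
  using piv_closed pivot field_Units by auto

lemma piv_smult_nonzero: "x \<in> carrier F \<Longrightarrow> x \<otimes> inv piv = \<zero> \<longleftrightarrow> x = \<zero>"
proof -
  assume x: "x \<in> carrier F"
  have "inv piv \<noteq> \<zero>" using piv_inv piv_closed by auto
  then show ?thesis using integral_iff[OF x piv_inv(1)] by simp
qed

lemma gen_closed: "k = n \<or> k = Suc n \<Longrightarrow> gen k \<in> carrier (V k)"
  using aV bdaV by (auto simp: gen_def)

lemma W_gen: "k = n \<or> k = Suc n \<Longrightarrow> W k = LinearCombinations.module.span F (V k) {gen k}"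
  by (auto simp: W_def gen_def)

lemma W_other: "k \<noteq> n \<Longrightarrow> k \<noteq> Suc n \<Longrightarrow> W k = {\<zero>\<^bsub>V k\<^esub>}"
  by (simp add: W_def)

lemma linfun_\<theta>: "s \<in> B k \<Longrightarrow> linfun F (V k) (\<theta> k s)"
proof (cases "k = n")
  case True
  moreover assume "s \<in> B k"
  ultimately have "linfun F (V n)
      (\<lambda>x. co n x s \<ominus> co n x b \<otimes> (inv piv \<otimes> co n (bd C (Suc n) a) s))"
    using piv_inv co_closed[OF _ bdaV]
    by (intro coordinate_space.linfun_diff_smult[OF cs linfun_co linfun_co[OF b]]) auto
  then show ?thesis using True by (simp add: \<theta>_def[abs_def])
qed (simp add: \<theta>_def[abs_def] linfun_co)

lemma S_sub: "S k \<subseteq> B k" by (auto simp: S_def)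

lemma \<theta>_dual:
  assumes "s \<in> S k" "s' \<in> S k"
  shows "\<theta> k s s' = (if s = s' then \<one> else \<zero>)"
proof (cases "k = n")
  case True
  then have "s \<in> B n" "s' \<in> B n" "b \<noteq> s'" "b \<noteq> s" using assms S_sub by (auto simp: S_def)
  then show ?thesis
    using True piv_inv co_closed[OF \<open>s \<in> B n\<close> bdaV] b by (simp add: \<theta>_def co_basis a_minus_def)
next
  case False
  have "s \<in> B k" "s' \<in> B k" using assms S_sub by blast+
  then show ?thesis using False by (auto simp: \<theta>_def co_basis)
qed

lemma W_submodule: "submodule F (W k) (V k)"
proof -
  interpret V: coordinate_space F "V k" by (rule cs)
  show ?thesis
    using V.span_is_submodule[of "{gen k}"] gen_closed[of k] V.submodule_zero W_gen W_other by (cases "k = n \<or> k = Suc n") auto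
qed

lemma \<theta>_gen:
  assumes k: "k = n \<or> k = Suc n" and s: "s \<in> S k"
  shows "\<theta> k s (gen k) = \<zero>"
proof (cases "k = n")
  case True
  then have sB: "s \<in> B n" using s S_sub by blast
  have "piv \<otimes> (inv piv \<otimes> co n (bd C (Suc n) a) s) = co n (bd C (Suc n) a) s"
    using piv_inv piv_closed co_closed[OF sB bdaV] by (simp flip: m_assoc)
  then show ?thesis using True co_closed[OF sB bdaV] by (simp add: \<theta>_def gen_def a_minus_def r_neg)
next
  case False
  then show ?thesis using k s a S_sub by (auto simp: \<theta>_def gen_def co_basis S_def)
qed

text \<open>In degree \<open>n\<close>, vanishing of all \<theta> ties every coefficient of
  \<open>x\<close> to the one at \<open>b\<close> in the same ratio as in \<partial>a, so
  \<open>x\<close> is a multiple of \<partial>a.\<close>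

lemma W_iff:
  assumes x: "x \<in> carrier (V k)"
  shows "x \<in> W k \<longleftrightarrow> (\<forall>s\<in>S k. \<theta> k s x = \<zero>)"
proof -
  interpret V: coordinate_space F "V k" by (rule cs)
  consider "k = Suc n" | "k = n" | "k \<noteq> n" "k \<noteq> Suc n" by blast
  then show ?thesis
  proof cases
    case 1
    then show ?thesis
      using V.mem_span_iff_coef[OF B_finite B_basis, of "{a}" x] a x by (simp add: W_def S_def \<theta>_def)
  next
    case 2
    show ?thesis
    proof
      assume "x \<in> W k"
      then have xs: "x \<in> V.span {gen k}" using W_gen 2 by simp
      show "\<forall>s\<in>S k. \<theta> k s x = \<zero>"
      proof
        fix s assume s: "s \<in> S k"
        then have "s \<in> B k" using S_sub by blast
        from V.linfun_span_zero[OF linfun_\<theta>[OF this] _ _ xs] gen_closed[of k] \<theta>_gen[OF _ s] 2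
        show "\<theta> k s x = \<zero>" by auto
      qed
    next
      assume z: "\<forall>s\<in>S k. \<theta> k s x = \<zero>"
      \<comment> \<open>Comparing coefficients at \<open>b\<close> leaves only this multiple of
        \<open>gen k\<close>.\<close>
      let ?c = "co n x b \<otimes> inv piv"
      have xb: "co n x b \<in> carrier F" using co_closed[OF b] x 2 by blast
      then have c: "?c \<in> carrier F" using piv_inv by simp
      have "x = ?c \<odot>\<^bsub>V k\<^esub> gen k"
      proof (rule co_eqI[OF x])
        show "?c \<odot>\<^bsub>V k\<^esub> gen k \<in> carrier (V k)" using V.smult_closed[OF c gen_closed] 2 by simp
        fix b' assume b': "b' \<in> B k"
        have g: "co k (?c \<odot>\<^bsub>V k\<^esub> gen k) b' = ?c \<otimes> co k (gen k) b'"
          using linfun_smult[OF linfun_co[OF b'] c] gen_closed[of k] 2 by blast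
        have gk: "co k (gen k) b' = co n (bd C (Suc n) a) b'" using 2 by (simp add: gen_def)
        have cb: "co n (bd C (Suc n) a) b' \<in> carrier F" using b' 2 co_closed[OF _ bdaV] by blast
        have xb': "co n x b' \<in> carrier F" using b' 2 x co_closed by blast
        show "co k x b' = co k (?c \<odot>\<^bsub>V k\<^esub> gen k) b'"
        proof (cases "b' = b")
          case True
          then show ?thesis unfolding g gk using 2 xb piv_inv piv_closed by (simp add: m_assoc)
        next
          case False
          then have "\<theta> k b' x = \<zero>" using z b' 2 by (auto simp: S_def)
          then have "co n x b' = co n x b \<otimes> (inv piv \<otimes> co n (bd C (Suc n) a) b')"
            using 2 xb xb' cb piv_inv by (simp add: \<theta>_def minus_eq_zero_iff)
          then show ?thesis unfolding g gk using 2 xb piv_inv cb by (simp add: m_assoc)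
        qed
      qed
      then show "x \<in> W k"
        using V.smult_mem_span_singleton[OF gen_closed c] W_gen 2 by simp
    qed
  next
    case 3
    then have "x \<in> W k \<longleftrightarrow> x = \<zero>\<^bsub>V k\<^esub>" by (simp add: W_def)
    also have "\<dots> \<longleftrightarrow> (\<forall>s\<in>S k. \<theta> k s x = \<zero>)"
      using V.coef_eq_zero_iff[OF B_finite B_basis x] 3 by (simp add: S_def \<theta>_def)
    finally show ?thesis .
  qed
qed

lemma S_finite: "finite (S k)" using S_sub B_finite finite_subset by blast

lemma S_closed: "s \<in> S k \<Longrightarrow> s \<in> carrier (V k)" using S_sub B_closed by blast

lemma
  shows q_inj: "inj_on (q k) (S k)"
    and q_basis: "vectorspace.basis F (quot (V k) (W k)) (q k ` S k)"
    and q_coef: "x \<in> carrier (V k) \<Longrightarrow> s \<in> S k \<Longrightarrow>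
      coef F (quot (V k) (W k)) (q k ` S k) (q k x) (q k s) = \<theta> k s x"
proof -
  have 1: "S k \<subseteq> carrier (V k)" using S_closed by blast
  have 2: "linfun F (V k) (\<theta> k s)" if "s \<in> S k" for s using linfun_\<theta> S_sub that by blast
  note db = coordinate_space.quot_dual_basis[OF cs W_submodule S_finite 1 2 \<theta>_dual W_iff]
  show "inj_on (q k) (S k)" by (rule db(1))
  show "vectorspace.basis F (quot (V k) (W k)) (q k ` S k)" by (rule db(2))
  show "x \<in> carrier (V k) \<Longrightarrow> s \<in> S k \<Longrightarrow>
      coef F (quot (V k) (W k)) (q k ` S k) (q k x) (q k s) = \<theta> k s x" by (rule db(3))
qed

section \<open>The quotient complex and its induced filter\<close>

lemma bd_W: assumes "w \<in> W (Suc k)" shows "bd C (Suc k) w \<in> W k"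
proof -
  interpret V: coordinate_space F "V (Suc k)" by (rule cs)
  interpret V': coordinate_space F "V k" by (rule cs)
  have z: "\<zero>\<^bsub>V k\<^esub> \<in> W k" by (rule submodule.zero_closed[OF W_submodule])
  consider "k = n" | "Suc k = n" | "Suc k \<noteq> n" "k \<noteq> n" by blast
  then show ?thesis
  proof cases
    case 1
    then obtain c where c: "c \<in> carrier F" "w = c \<odot>\<^bsub>V (Suc k)\<^esub> a"
      using assms V.span_singletonE[of a w] aV by (auto simp: W_def)
    then have "bd C (Suc k) w = c \<odot>\<^bsub>V k\<^esub> bd C (Suc n) a" using bd_smult aV 1 by simp
    then show ?thesis using 1 V'.smult_mem_span_singleton[of "bd C (Suc n) a" c] bdaV c by (simp add: W_def)
  next
    case 2
    then obtain c where c: "c \<in> carrier F" "w = c \<odot>\<^bsub>V (Suc k)\<^esub> bd C (Suc n) a"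
      using assms V.span_singletonE[of "bd C (Suc n) a" w] bdaV by (auto simp: W_def)
    then have "bd C (Suc k) w = c \<odot>\<^bsub>V k\<^esub> bd C (Suc k) (bd C (Suc n) a)" using bd_smult[of c "bd C (Suc n) a" k] c bdaV 2 by simp
    also have "bd C (Suc k) (bd C (Suc n) a) = \<zero>\<^bsub>V k\<^esub>" using bd_bd[of a k] aV 2 by simp
    finally show ?thesis using c z by simp
  next
    case 3
    then have "w = \<zero>\<^bsub>V (Suc k)\<^esub>" using assms W_other by auto
    then show ?thesis using bd_zero z by simp
  qed
qed

text \<open>The differential of \<open>quot_complex\<close> is evaluated on chosen representatives.
  Since \<open>W\<close> is a subcomplex, the choice changes the boundary only by an element of
  \<open>W\<close>.\<close>

lemma q_bd_q:
  assumes x: "x \<in> carrier (V (Suc k))"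
  shows "q k (bd C (Suc k) (q (Suc k) x)) = q k (bd C (Suc k) x)"
proof -
  obtain w where w: "w \<in> W (Suc k)" "q (Suc k) x = w \<oplus>\<^bsub>V (Suc k)\<^esub> x"
    by (rule coordinate_space.cls_obtain[OF cs W_submodule x])
  have "w \<in> carrier (V (Suc k))" using w submodule.subset[OF W_submodule] by blast
  then show ?thesis
    using w x bd_add coordinate_space.cls_absorb[OF cs W_submodule bd_W[OF w(1)] bd_closed[OF x]] by simp
qed

abbreviation C' where "C' \<equiv> quot_complex C W"
abbreviation B' where "B' \<equiv> \<lambda>k. q k ` S k"
definition f' :: "nat \<Rightarrow> 'v \<Rightarrow> real" where "f' k x = f k (inv_into (S k) (q k) x)"

lemma f'_q: "s \<in> S k \<Longrightarrow> f' k (q k s) = f k s"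
  using q_inj by (simp add: f'_def)

lemma bd'_q: "x \<in> carrier (V (Suc k)) \<Longrightarrow> bd C' (Suc k) (q (Suc k) x) = q k (bd C (Suc k) x)"
  by (simp add: quot_complex_def q_bd_q)

lemma grade': "grade C' k = quot (V k) (W k)"
  by (simp add: quot_complex_def)

lemma incidence': 
  assumes "s \<in> S (Suc k)" "s' \<in> S k"
  shows "incidence F C' B' (Suc k) (q (Suc k) s) (q k s') = \<theta> k s' (bd C (Suc k) s)"
  using bd'_q[OF S_closed[OF assms(1)]] q_coef[OF bd_closed[OF S_closed[OF assms(1)]] assms(2)]
  by (simp add: incidence_def grade')

text \<open>The second alternative is the incidence created by elimination, along the zigzag from
  \<open>x\<close> down to \<open>b\<close>, up to \<open>a\<close> and down to
  \<open>s\<close>.\<close>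

lemma \<theta>_nonzero:
  assumes "x \<in> carrier (V k)" "s \<in> B k" "\<theta> k s x \<noteq> \<zero>"
  shows "co k x s \<noteq> \<zero> \<or> k = n \<and> co n x b \<noteq> \<zero> \<and> co n (bd C (Suc n) a) s \<noteq> \<zero>"
proof (rule ccontr)
  assume "\<not> ?thesis"
  then have 1: "co k x s = \<zero>" and 2: "k = n \<Longrightarrow> co n x b = \<zero> \<or> co n (bd C (Suc n) a) s = \<zero>" by auto
  have "k = n \<Longrightarrow> co n x b \<in> carrier F" "k = n \<Longrightarrow> co n (bd C (Suc n) a) s \<in> carrier F"
    using co_closed[OF b] co_closed[OF _ bdaV] assms by auto
  then have "\<theta> k s x = \<zero>"
    using 1 2 piv_inv by (auto simp: \<theta>_def a_minus_def)
  then show False using assms(3) by simp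
qed

text \<open>Against the pair \<open>(a, b')\<close> the value of \<open>a\<close> cancels in the
  minimality condition; in \<open>upper_ge\<close>, against \<open>(a', b)\<close>, the value of
  \<open>b\<close> cancels.\<close>

lemma lower_le: "b' \<in> B n \<Longrightarrow> co n (bd C (Suc n) a) b' \<noteq> \<zero> \<Longrightarrow> f n b' \<le> f n b"
  using minimal[OF a, of b'] by simp

lemma upper_ge: "a' \<in> B (Suc n) \<Longrightarrow> co n (bd C (Suc n) a') b \<noteq> \<zero> \<Longrightarrow> f (Suc n) a \<le> f (Suc n) a'"
  using minimal[OF _ b, of a'] by simp

lemma ab_less: "f n b < f (Suc n) a" by (rule filter_less[OF a b pivot])

lemma based_filter': "based_filter F C' B' f'"
  unfolding based_filter_def
proof (intro conjI allI ballI impI)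
  show "0 \<le> f' k x" if "x \<in> B' k" for k x
    using that S_sub f'_q filter_nonneg by (auto simp: subset_iff)
  fix k x y assume "x \<in> B' (Suc k)" "y \<in> B' k" and inc: "incidence F C' B' (Suc k) x y \<noteq> \<zero>"
  then obtain s s' where s: "s \<in> S (Suc k)" "x = q (Suc k) s" and s': "s' \<in> S k" "y = q k s'" by auto
  have sB: "s \<in> B (Suc k)" "s' \<in> B k" using s s' S_sub by blast+
  have "\<theta> k s' (bd C (Suc k) s) \<noteq> \<zero>" using inc incidence'[OF s(1) s'(1)] s s' by simp
  from \<theta>_nonzero[OF bd_closed[OF S_closed[OF s(1)]] sB(2) this]
  have "f k s' < f (Suc k) s"
  proof (elim disjE conjE)
    assume "co k (bd C (Suc k) s) s' \<noteq> \<zero>"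
    then show ?thesis by (rule filter_less[OF sB])
  next
    \<comment> \<open>A created incidence is bounded along its zigzag:
      \<open>f s' \<le> f b < f a \<le> f s\<close>.\<close>
    assume k: "k = n" and "co n (bd C (Suc k) s) b \<noteq> \<zero>" "co n (bd C (Suc n) a) s' \<noteq> \<zero>"
    then have "f n s' \<le> f n b" "f (Suc n) a \<le> f (Suc n) s"
      using lower_le upper_ge sB by auto
    then show ?thesis using ab_less k by simp
  qed
  then show "f' k y < f' (Suc k) x" using s s' f'_q by simp
qed

lemma cs': "coordinate_space F (grade C' k)"
  unfolding grade' by (rule coordinate_space.quot_coordinate_space[OF cs W_submodule])

lemma carrier': "carrier (grade C' k) = q k ` carrier (V k)"
  by (simp add: grade' coordinate_space.quot_sel[OF cs])

lemma bd'_hom: "bd C' (Suc k) \<in> lin_hom F (grade C' (Suc k)) (grade C' k)"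
proof -
  interpret V: coordinate_space F "V (Suc k)" by (rule cs)
  interpret U: coordinate_space F "V k" by (rule cs)
  have h1: "q k (u \<oplus>\<^bsub>V k\<^esub> v) = q k u \<oplus>\<^bsub>grade C' k\<^esub> q k v"
    if "u \<in> carrier (V k)" "v \<in> carrier (V k)" for u v
    using lin_hom_add[OF U.cls_hom[OF W_submodule] that] by (simp add: grade')
  have h2: "q k (c \<odot>\<^bsub>V k\<^esub> v) = c \<odot>\<^bsub>grade C' k\<^esub> q k v"
    if "c \<in> carrier F" "v \<in> carrier (V k)" for c v
    using lin_hom_smult[OF U.cls_hom[OF W_submodule] that] by (simp add: grade')
  have h3: "q (Suc k) u \<oplus>\<^bsub>grade C' (Suc k)\<^esub> q (Suc k) v = q (Suc k) (u \<oplus>\<^bsub>V (Suc k)\<^esub> v)"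
    if "u \<in> carrier (V (Suc k))" "v \<in> carrier (V (Suc k))" for u v
    using lin_hom_add[OF V.cls_hom[OF W_submodule] that] by (simp add: grade')
  have h4: "c \<odot>\<^bsub>grade C' (Suc k)\<^esub> q (Suc k) v = q (Suc k) (c \<odot>\<^bsub>V (Suc k)\<^esub> v)"
    if "c \<in> carrier F" "v \<in> carrier (V (Suc k))" for c v
    using lin_hom_smult[OF V.cls_hom[OF W_submodule] that] by (simp add: grade')
  show ?thesis
    unfolding lin_hom_def carrier'
    by (auto simp: bd'_q h1[symmetric] h2[symmetric] h3 h4 bd_closed bd_add bd_smult)
qed

lemma based_complex': "based_complex F C' B'"
proof -
  have "bd C' (Suc k) (bd C' (Suc (Suc k)) y) = \<zero>\<^bsub>grade C' k\<^esub>" if "y \<in> carrier (grade C' (Suc (Suc k)))" for k y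
  proof -
    obtain x where "x \<in> carrier (V (Suc (Suc k)))" "y = q (Suc (Suc k)) x" using \<open>y \<in> _\<close> carrier' by auto
    then show ?thesis by (simp add: bd'_q bd_closed bd_bd grade' coordinate_space.quot_sel[OF cs])
  qed
  then have 1: "chain_complex F C'"
    unfolding chain_complex_def using cs' bd'_hom by (simp add: coordinate_space_def)
  have "carrier (grade C' k) = {\<zero>\<^bsub>grade C' k\<^esub>}" if "carrier (V k) = {\<zero>\<^bsub>V k\<^esub>}" for k
    using that by (simp add: grade' coordinate_space.quot_sel[OF cs])
  then have "{k. carrier (grade C' k) \<noteq> {\<zero>\<^bsub>grade C' k\<^esub>}} \<subseteq> {k. carrier (V k) \<noteq> {\<zero>\<^bsub>V k\<^esub>}}" by blast
  moreover have "finite {k. carrier (V k) \<noteq> {\<zero>\<^bsub>V k\<^esub>}}"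
    using based unfolding based_complex_def compact_complex_def by blast
  ultimately have 2: "finite {k. carrier (grade C' k) \<noteq> {\<zero>\<^bsub>grade C' k\<^esub>}}" by (rule finite_subset)
  have 3: "vectorspace.basis F (grade C' k) (B' k)" for k using q_basis by (simp add: grade')
  then have "vectorspace.fin_dim F (grade C' k)" for k
    using coordinate_space.fin_dim_of_basis[OF cs'] S_finite by blast
  then show ?thesis unfolding based_complex_def compact_complex_def using 1 2 3 by blast
qed

sublocale step: filtered_based_complex F C' B' f'
  by unfold_locales (rule based_complex' based_filter')+

lemma sublevel'_iff:
  assumes x: "x \<in> carrier (V k)"
  shows "q k x \<in> sublevel F C' B' f' k t \<longleftrightarrow>
    (\<forall>s\<in>S k. \<theta> k s x \<noteq> \<zero> \<longrightarrow> f k s \<le> t)"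
proof -
  have "q k x \<in> carrier (quot (V k) (W k))" using x carrier' grade' by auto
  then show ?thesis using step.sublevel_iff[of "q k x" k t] x by (auto simp: grade' q_coef f'_q)
qed

section \<open>Splitting off the pair: coordinates, filtration and differential\<close>

lemma linfun_\<mu>: assumes "k = n \<or> k = Suc n" shows "linfun F (V k) (\<mu> k)"
proof -
  have "linfun F (V k) (\<lambda>x. if k = Suc n then co n (bd C (Suc n) x) b else co n x b)"
    using linfun_co_bd[OF b] linfun_co[OF b] assms by (cases "k = Suc n") auto
  from coordinate_space.linfun_mult_right[OF cs this piv_inv(1)]
  show ?thesis by (simp only: \<mu>_def[abs_def])
qed

lemma \<mu>_gen: "k = n \<or> k = Suc n \<Longrightarrow> \<mu> k (gen k) = \<one>"
  using piv_inv b by (auto simp: \<mu>_def gen_def)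

text \<open>As \<mu> is 1 on the generator of \<open>W\<close>, it restricts to an isomorphism from
  \<open>W\<close> onto the field. Hence the class and the \<mu>-value can be prescribed
  independently and determine the vector.\<close>

lemma split_ex1:
  assumes k: "k = n \<or> k = Suc n" and y: "y \<in> carrier (grade C' k)" and c: "c \<in> carrier F"
  shows "\<exists>!x. x \<in> carrier (V k) \<and> q k x = y \<and> \<mu> k x = c"
proof -
  interpret V: coordinate_space F "V k" by (rule cs)
  note \<mu> = linfun_\<mu>[OF k]
  note g = gen_closed[OF k]
  obtain x0 where x0: "x0 \<in> carrier (V k)" "y = q k x0" using y carrier' by auto
  define e where "e = c \<ominus> \<mu> k x0"
  have mx0: "\<mu> k x0 \<in> carrier F" using linfun_closed[OF \<mu> x0(1)] .
  then have e: "e \<in> carrier F" "e \<oplus> \<mu> k x0 = c"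
    using c by (auto simp: e_def a_minus_def a_assoc l_neg)
  \<comment> \<open>Adding a multiple of the generator keeps the class of \<open>x0\<close>; the
    factor \<open>e\<close> corrects the \<mu>-value to \<open>c\<close>.\<close>
  define x where "x = e \<odot>\<^bsub>V k\<^esub> gen k \<oplus>\<^bsub>V k\<^esub> x0"
  have eg: "e \<odot>\<^bsub>V k\<^esub> gen k \<in> carrier (V k)" using e g by simp
  have eW: "e \<odot>\<^bsub>V k\<^esub> gen k \<in> W k"
    unfolding W_gen[OF k] by (rule V.smult_mem_span_singleton[OF g e(1)])
  have x: "x \<in> carrier (V k)" using eg x0 by (simp add: x_def)
  have "q k x = y" unfolding x_def x0(2) by (rule V.cls_absorb[OF W_submodule eW x0(1)])
  moreover have "\<mu> k x = c"
    unfolding x_def linfun_add[OF \<mu> eg x0(1)] linfun_smult[OF \<mu> e(1) g] \<mu>_gen[OF k] using e by simp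
  moreover have "x1 = x2"
    if x1: "x1 \<in> carrier (V k)" "q k x1 = y" "\<mu> k x1 = c"
      and x2: "x2 \<in> carrier (V k)" "q k x2 = y" "\<mu> k x2 = c" for x1 x2
  proof -
    have "x1 \<ominus>\<^bsub>V k\<^esub> x2 \<in> W k" using V.cls_eq_iff[OF W_submodule x1(1) x2(1)] x1 x2 by simp
    then obtain d where d: "d \<in> carrier F" "x1 \<ominus>\<^bsub>V k\<^esub> x2 = d \<odot>\<^bsub>V k\<^esub> gen k"
      using V.span_singletonE[OF g] W_gen[OF k] by blast
    have "\<mu> k (x1 \<ominus>\<^bsub>V k\<^esub> x2) = d"
      unfolding d(2) linfun_smult[OF \<mu> d(1) g] \<mu>_gen[OF k] using d by simp
    moreover have "\<mu> k (x1 \<ominus>\<^bsub>V k\<^esub> x2) = \<zero>"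
      using V.linfun_minus[OF \<mu> x1(1) x2(1)] x1(3) x2(3) c by (simp add: a_minus_def r_neg)
    ultimately have "x1 \<ominus>\<^bsub>V k\<^esub> x2 = \<zero>\<^bsub>V k\<^esub>" using d g by simp
    moreover have "x1 = (x1 \<ominus>\<^bsub>V k\<^esub> x2) \<oplus>\<^bsub>V k\<^esub> x2"
      using x1(1) x2(1) by (simp add: a_minus_def V.M.a_assoc V.M.l_neg)
    ultimately show ?thesis using x2(1) by simp
  qed
  ultimately show ?thesis using x by blast
qed

lemma \<mu>_nonzero:
  assumes "x \<in> carrier (V k)"
  shows "k = n \<Longrightarrow> \<mu> k x \<noteq> \<zero> \<longleftrightarrow> co n x b \<noteq> \<zero>"
    and "k = Suc n \<Longrightarrow> \<mu> k x \<noteq> \<zero> \<longleftrightarrow> co n (bd C (Suc n) x) b \<noteq> \<zero>"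
  using assms co_closed[OF b] bd_closed[of x n] by (auto simp: \<mu>_def piv_smult_nonzero)

text \<open>The contribution of \<open>a\<close> to the coefficient of \<open>b\<close> in
  \<partial>x is non-zero, so it must be cancelled by some other \<open>a'\<close> in
  \<open>x\<close> with \<open>b\<close> in \<partial>a'. This \<open>a'\<close> has level at most
  \<open>t\<close>, and \<open>f a \<le> f a'\<close> by minimality.\<close>

lemma sublevel_split_upper:
  assumes x: "x \<in> carrier (V (Suc n))" and le: "\<And>s. s \<in> B (Suc n) - {a} \<Longrightarrow> co (Suc n) x s \<noteq> \<zero> \<Longrightarrow> f (Suc n) s \<le> t"
    and z: "co n (bd C (Suc n) x) b = \<zero>" and nz: "co (Suc n) x a \<noteq> \<zero>"
  shows "f (Suc n) a \<le> t"
proof -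
  interpret V: coordinate_space F "V (Suc n)" by (rule cs)
  let ?c = "co (Suc n) x a"
  have c: "?c \<in> carrier F" by (rule co_closed[OF a x])
  have ca: "?c \<odot>\<^bsub>V (Suc n)\<^esub> a \<in> carrier (V (Suc n))" using c aV by simp
  \<comment> \<open>Removing the term at \<open>a\<close> exposes the contribution that cancelled
    it.\<close>
  define x' where "x' = x \<ominus>\<^bsub>V (Suc n)\<^esub> ?c \<odot>\<^bsub>V (Suc n)\<^esub> a"
  have x': "x' \<in> carrier (V (Suc n))" using x ca by (simp add: x'_def)
  have "co n (bd C (Suc n) x') b = \<zero> \<ominus> ?c \<otimes> piv"
    unfolding x'_def V.linfun_minus[OF linfun_co_bd[OF b] x ca] linfun_smult[OF linfun_co_bd[OF b] c aV] z ..
  moreover have "?c \<otimes> piv \<noteq> \<zero>" using nz pivot integral_iff[OF c piv_closed] by simp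
  ultimately have "co n (bd C (Suc n) x') b \<noteq> \<zero>"
    using c piv_closed minus_eq_zero_iff[of "\<zero>" "?c \<otimes> piv"] by auto
  from co_bd_nonzero[OF x' b this] obtain a' where a': "a' \<in> B (Suc n)" "co (Suc n) x' a' \<noteq> \<zero>"
    "co n (bd C (Suc n) a') b \<noteq> \<zero>" by blast
  have xa': "co (Suc n) x' a' = co (Suc n) x a' \<ominus> ?c \<otimes> (if a' = a then \<one> else \<zero>)"
    unfolding x'_def V.linfun_minus[OF linfun_co[OF a'(1)] x ca] linfun_smult[OF linfun_co[OF a'(1)] c aV]
      co_basis[OF a a'(1)] ..
  have "a' \<noteq> a" using xa' a'(2) c by (auto simp: a_minus_def r_neg)
  then have "co (Suc n) x a' \<noteq> \<zero>" using xa' a'(2) c by (auto simp: a_minus_def)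
  then have "f (Suc n) a' \<le> t" using le a' \<open>a' \<noteq> a\<close> by blast
  then show ?thesis using upper_ge[OF a'(1,3)] by simp
qed

text \<open>\<partial>a has level \<open>f b\<close>, because \<open>b\<close> has the largest value
  in it; so eliminating \<open>b\<close> brings in no element above the level that \<open>b\<close>
  requires anyway. In the upper degree, \<open>b\<close> in \<partial>x forces some
  \<open>a'\<close> in \<open>x\<close> with \<open>f a \<le> f a'\<close>, so the \<mu>-component
  imposes nothing beyond the level of \<open>x\<close>; the converse is
  \<open>sublevel_split_upper\<close>. Thus sublevel spaces split along \<open>W\<close> and the
  kernel of \<mu>.\<close>

lemma sublevel_split:
  assumes x: "x \<in> carrier (V k)"
  shows "(\<forall>s\<in>B k. co k x s \<noteq> \<zero> \<longrightarrow> f k s \<le> t) \<longleftrightarrow>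
    (\<forall>s\<in>S k. \<theta> k s x \<noteq> \<zero> \<longrightarrow> f k s \<le> t) \<and>
    (k = n \<and> \<mu> k x \<noteq> \<zero> \<longrightarrow> f n b \<le> t) \<and> (k = Suc n \<and> \<mu> k x \<noteq> \<zero> \<longrightarrow> f (Suc n) a \<le> t)"
    (is "?L \<longleftrightarrow> ?R")
proof -
  consider "k = Suc n" | "k = n" | "k \<noteq> n" "k \<noteq> Suc n" by blast
  then show ?thesis
  proof cases
    case 1
    have xk: "x \<in> carrier (V (Suc n))" using x 1 by simp
    have \<mu>: "\<mu> k x \<noteq> \<zero> \<longleftrightarrow> co n (bd C (Suc n) x) b \<noteq> \<zero>" by (rule \<mu>_nonzero(2)[OF x 1])
    have \<theta>: "(\<forall>s\<in>S k. \<theta> k s x \<noteq> \<zero> \<longrightarrow> f k s \<le> t) \<longleftrightarrow>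
        (\<forall>s\<in>B (Suc n) - {a}. co (Suc n) x s \<noteq> \<zero> \<longrightarrow> f (Suc n) s \<le> t)"
      using 1 by (simp add: S_def \<theta>_def)
    show ?thesis
    proof
      assume L: ?L
      have "f (Suc n) a \<le> t" if nz: "co n (bd C (Suc n) x) b \<noteq> \<zero>"
      proof -
        obtain a' where a': "a' \<in> B (Suc n)" "co (Suc n) x a' \<noteq> \<zero>" "co n (bd C (Suc n) a') b \<noteq> \<zero>"
          using co_bd_nonzero[OF xk b nz] by blast
        then have "f (Suc n) a' \<le> t" using L 1 by blast
        then show ?thesis using upper_ge[OF a'(1,3)] by simp
      qed
      then show ?R using L 1 unfolding \<theta> \<mu> by auto
    next
      assume R: ?R
      then have R1: "\<And>s. s \<in> B (Suc n) - {a} \<Longrightarrow> co (Suc n) x s \<noteq> \<zero> \<Longrightarrow> f (Suc n) s \<le> t"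
        and R2: "co n (bd C (Suc n) x) b \<noteq> \<zero> \<Longrightarrow> f (Suc n) a \<le> t"
        unfolding \<theta> \<mu> using 1 by auto
      have "f (Suc n) a \<le> t" if "co (Suc n) x a \<noteq> \<zero>"
        using sublevel_split_upper[OF xk R1 _ that] R2 by blast
      then show ?L using R1 1 by blast
    qed
  next
    case 2
    have \<mu>: "\<mu> k x \<noteq> \<zero> \<longleftrightarrow> co n x b \<noteq> \<zero>" by (rule \<mu>_nonzero(1)[OF x 2])
    show ?thesis
    proof
      assume L: ?L
      then have xb: "co n x b \<noteq> \<zero> \<Longrightarrow> f n b \<le> t" using b 2 by blast
      have "f k s \<le> t" if s: "s \<in> S k" "\<theta> k s x \<noteq> \<zero>" for s
      proof -
        have sB: "s \<in> B k" using s S_sub by blast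
        from \<theta>_nonzero[OF x sB s(2)] show ?thesis
          using L sB xb lower_le[of s] by force
      qed
      then show ?R using xb 2 unfolding \<mu> by auto
    next
      assume R: ?R
      then have R1: "\<And>s. s \<in> S k \<Longrightarrow> \<theta> k s x \<noteq> \<zero> \<Longrightarrow> f k s \<le> t"
        and R2: "co n x b \<noteq> \<zero> \<Longrightarrow> f n b \<le> t"
        unfolding \<mu> using 2 by auto
      show ?L
      proof (intro ballI impI)
        fix s assume s: "s \<in> B k" "co k x s \<noteq> \<zero>"
        show "f k s \<le> t"
        proof (cases "s = b")
          case True
          then show ?thesis using R2 s 2 by simp
        next
          case False
          then have sS: "s \<in> S k" using s 2 by (simp add: S_def)
          show ?thesis
          proof (cases "\<theta> k s x = \<zero>")
            \<comment> \<open>The coefficient at \<open>s\<close> is exactly the one eliminated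
              together with \<open>b\<close>. Being non-zero, it shows that \<open>b\<close> occurs
              in \<open>x\<close> and \<open>s\<close> in \<partial>a.\<close>
            case True
            let ?d = "co n (bd C (Suc n) a) s"
            have cl: "co n x s \<in> carrier F" "co n x b \<in> carrier F" "?d \<in> carrier F"
              using co_closed[OF _ bdaV] co_closed[of _ n x] s b x 2 by auto
            have "co n x s = co n x b \<otimes> (inv piv \<otimes> ?d)"
              using True 2 cl piv_inv by (simp add: \<theta>_def)
            then have "co n x b \<noteq> \<zero>" "?d \<noteq> \<zero>" using s(2) 2 cl piv_inv by auto
            then show ?thesis using R2 lower_le[of s] s 2 by force
          next
            case False
            then show ?thesis using R1[OF sS] by blast
          qed
        qed
      qed
    qed
  next
    case 3
    then show ?thesis by (simp add: S_def \<theta>_def)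
  qed
qed

text \<open>One case is built into the definition of \<mu> in the upper degree, the other is
  \<partial>\<partial> = 0. This makes the kernel of \<mu> a subcomplex.\<close>

lemma bd_\<mu>:
  assumes x: "x \<in> carrier (V (Suc k))" and k: "k = n \<or> k = Suc n"
  shows "\<mu> k (bd C (Suc k) x) = (if k = n then \<mu> (Suc k) x else \<zero>)"
proof (cases "k = n")
  case False
  then have "k = Suc n" using k by simp
  then show ?thesis using bd_bd[of x n] x co_zero[OF b] piv_inv by (simp add: \<mu>_def)
qed (simp add: \<mu>_def)

end

section \<open>Splittings into bars\<close>

definition active :: "'j set \<Rightarrow> ('j \<Rightarrow> nat) \<Rightarrow> ('j \<Rightarrow> ereal) \<Rightarrow> nat \<Rightarrow> 'j set" where
  "active J d t k = {j \<in> J. d j = k \<or> (Suc (d j) = k \<and> t j < \<infinity>)}"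

text \<open>
  An isomorphism from the filtered complex of \<open>f\<close> onto a direct sum, indexed by \<open>J\<close>, of complexes
  with differential 0 or the identity. The bar \<open>j\<close> has a generator of degree \<open>d j\<close> entering at time
  \<open>s j\<close> and, if \<open>t j\<close> is finite, a generator of degree \<open>d j + 1\<close> that kills it at time \<open>t j\<close>; the
  coordinates of degree \<open>k\<close> with respect to these generators are \<open>\<phi> k j\<close> for \<open>j\<close> in \<open>active J d t k\<close>.
\<close>

definition splitting ::
    "('f, 'r) ring_scheme \<Rightarrow> ('f, 'v) complex_data \<Rightarrow> (nat \<Rightarrow> 'v set) \<Rightarrow> (nat \<Rightarrow> 'v \<Rightarrow> real) \<Rightarrow>
      'j set \<Rightarrow> ('j \<Rightarrow> nat) \<Rightarrow> ('j \<Rightarrow> real) \<Rightarrow> ('j \<Rightarrow> ereal) \<Rightarrow> (nat \<Rightarrow> 'j \<Rightarrow> 'v \<Rightarrow> 'f) \<Rightarrow> bool" where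
  "splitting F C B f J d s t \<phi> \<longleftrightarrow>
     finite J \<and> (\<forall>j\<in>J. 0 \<le> s j \<and> ereal (s j) < t j) \<and>
     (\<forall>k. \<forall>j\<in>active J d t k. linfun F (grade C k) (\<phi> k j)) \<and>
     (\<forall>k g. (\<forall>j\<in>active J d t k. g j \<in> carrier F) \<longrightarrow>
        (\<exists>!x. x \<in> carrier (grade C k) \<and> (\<forall>j\<in>active J d t k. \<phi> k j x = g j))) \<and>
     (\<forall>k u. \<forall>x\<in>carrier (grade C k).
        x \<in> sublevel F C B f k u \<longleftrightarrow>
        (\<forall>j\<in>active J d t k. \<phi> k j x \<noteq> \<zero>\<^bsub>F\<^esub> \<longrightarrow> (if d j = k then ereal (s j) else t j) \<le> ereal u)) \<and>
     (\<forall>k. \<forall>x\<in>carrier (grade C (Suc k)). \<forall>j\<in>active J d t k.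
        \<phi> k j (bd C (Suc k) x) = (if d j = k \<and> t j < \<infinity> then \<phi> (Suc k) j x else \<zero>\<^bsub>F\<^esub>))"

lemma splittingI:
  assumes "finite J" "\<And>j. j \<in> J \<Longrightarrow> 0 \<le> s j \<and> ereal (s j) < t j"
    "\<And>k j. j \<in> active J d t k \<Longrightarrow> linfun F (grade C k) (\<phi> k j)"
    "\<And>k g. \<forall>j\<in>active J d t k. g j \<in> carrier F \<Longrightarrow>
       \<exists>!x. x \<in> carrier (grade C k) \<and> (\<forall>j\<in>active J d t k. \<phi> k j x = g j)"
    "\<And>k u x. x \<in> carrier (grade C k) \<Longrightarrow>
        x \<in> sublevel F C B f k u \<longleftrightarrow>
        (\<forall>j\<in>active J d t k. \<phi> k j x \<noteq> \<zero>\<^bsub>F\<^esub> \<longrightarrow> (if d j = k then ereal (s j) else t j) \<le> ereal u)"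
    "\<And>k x j. x \<in> carrier (grade C (Suc k)) \<Longrightarrow> j \<in> active J d t k \<Longrightarrow>
        \<phi> k j (bd C (Suc k) x) = (if d j = k \<and> t j < \<infinity> then \<phi> (Suc k) j x else \<zero>\<^bsub>F\<^esub>)"
  shows "splitting F C B f J d s t \<phi>"
  unfolding splitting_def using assms by blast

context pivot
begin

text \<open>The bar of the pair gets the new index \<open>j0\<close>, and the bars of the simplified
  complex are moved along \<open>sh\<close>, with coordinates pulled back along the quotient map.
  The renumbering leaves room for the first pair in front of the later ones.\<close>

lemma splitting_pivot:
  fixes J' :: "'j set" and sh :: "'j \<Rightarrow> 'j"
  assumes sp: "splitting F C' B' f' J' d' s' t' \<phi>'"
    and inj: "inj_on sh J'" and j0: "j0 \<notin> sh ` J'"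
    and d: "\<And>j. j \<in> J' \<Longrightarrow> d (sh j) = d' j" and s: "\<And>j. j \<in> J' \<Longrightarrow> s (sh j) = s' j"
    and t: "\<And>j. j \<in> J' \<Longrightarrow> t (sh j) = t' j"
    and d0: "d j0 = n" and s0: "s j0 = f n b" and t0: "t j0 = ereal (f (Suc n) a)"
  shows "\<exists>\<phi>. splitting F C B f (insert j0 (sh ` J')) d s t \<phi>"
proof -
  let ?J = "insert j0 (sh ` J')"
  let ?A' = "active J' d' t'"
  define \<phi> where "\<phi> k j = (if j = j0 then \<mu> k else (\<lambda>x. \<phi>' k (inv_into J' sh j) (q k x)))" for k j
  have \<phi>0: "\<phi> k j0 = \<mu> k" for k by (simp add: \<phi>_def)
  have \<phi>sh: "\<phi> k (sh j) = (\<lambda>x. \<phi>' k j (q k x))" if "j \<in> J'" for k j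
    using that inj j0 by (auto simp: \<phi>_def)
  \<comment> \<open>The new bar is finite, hence active in two adjacent degrees, those of
    \<open>b\<close> and \<open>a\<close>.\<close>
  have A: "active ?J d t k = (if k = n \<or> k = Suc n then {j0} else {}) \<union> sh ` ?A' k" for k
    using d t d0 t0 by (auto simp: active_def)
  have AJ: "j \<in> J'" if "j \<in> ?A' k" for j k using that by (simp add: active_def)
  have 1: "finite ?J" using sp by (simp add: splitting_def)
  have 2: "\<forall>j\<in>?J. 0 \<le> s j \<and> ereal (s j) < t j"
    using sp s t s0 t0 filter_nonneg[OF b] ab_less by (auto simp: splitting_def)
  have lin': "linfun F (grade C' k) (\<phi>' k j)" if "j \<in> ?A' k" for j k
    using sp that by (simp add: splitting_def)
  have ex': "\<exists>!x. x \<in> carrier (grade C' k) \<and> (\<forall>j\<in>?A' k. \<phi>' k j x = g j)"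
    if "\<forall>j\<in>?A' k. g j \<in> carrier F" for k g
    using sp that by (simp add: splitting_def)
  have lev': "x \<in> sublevel F C' B' f' k u \<longleftrightarrow>
        (\<forall>j\<in>?A' k. \<phi>' k j x \<noteq> \<zero> \<longrightarrow> (if d' j = k then ereal (s' j) else t' j) \<le> ereal u)"
    if "x \<in> carrier (grade C' k)" for x k u
    using sp that unfolding splitting_def by blast
  have bd': "\<phi>' k j (bd C' (Suc k) x) = (if d' j = k \<and> t' j < \<infinity> then \<phi>' (Suc k) j x else \<zero>)"
    if "x \<in> carrier (grade C' (Suc k))" "j \<in> ?A' k" for x k j
    using sp that unfolding splitting_def by blast
  have qc: "q k x \<in> carrier (grade C' k)" if "x \<in> carrier (V k)" for k x
    using that carrier' by auto
  have 3: "linfun F (V k) (\<phi> k j)" if "j \<in> active ?J d t k" for j k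
  proof -
    have "linfun F (V k) (\<mu> k)" if "k = n \<or> k = Suc n" by (rule linfun_\<mu>[OF that])
    moreover have "linfun F (V k) (\<lambda>x. \<phi>' k i (q k x))" if "i \<in> ?A' k" for i
      using linfun_comp[OF lin'[OF that], of "q k" "V k"]
        coordinate_space.cls_hom[OF cs W_submodule] by (simp add: grade')
    ultimately show ?thesis using that AJ unfolding A by (auto simp: \<phi>0 \<phi>sh split: if_splits)
  qed
  have 4: "\<exists>!x. x \<in> carrier (V k) \<and> (\<forall>j\<in>active ?J d t k. \<phi> k j x = g j)"
    if g: "\<forall>j\<in>active ?J d t k. g j \<in> carrier F" for k g
  proof -
    have "\<forall>j\<in>?A' k. g (sh j) \<in> carrier F" using g unfolding A by auto
    from ex'[OF this] obtain y where y: "y \<in> carrier (grade C' k)" "\<forall>j\<in>?A' k. \<phi>' k j y = g (sh j)"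
      and uy: "\<And>z. z \<in> carrier (grade C' k) \<Longrightarrow> \<forall>j\<in>?A' k. \<phi>' k j z = g (sh j) \<Longrightarrow> z = y" by blast
    have iff: "(\<forall>j\<in>active ?J d t k. \<phi> k j x = g j) \<longleftrightarrow>
        q k x = y \<and> (k = n \<or> k = Suc n \<longrightarrow> \<mu> k x = g j0)" if x: "x \<in> carrier (V k)" for x
    proof -
      have "(\<forall>j\<in>active ?J d t k. \<phi> k j x = g j) \<longleftrightarrow>
          (\<forall>j\<in>?A' k. \<phi>' k j (q k x) = g (sh j)) \<and> (k = n \<or> k = Suc n \<longrightarrow> \<mu> k x = g j0)"
        using AJ unfolding A by (auto simp: \<phi>0 \<phi>sh)
      also have "(\<forall>j\<in>?A' k. \<phi>' k j (q k x) = g (sh j)) \<longleftrightarrow> q k x = y"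
        using uy[OF qc[OF x]] y(2) by blast
      finally show ?thesis .
    qed
    show ?thesis
    proof (cases "k = n \<or> k = Suc n")
      case True
      then have "g j0 \<in> carrier F" using g unfolding A by auto
      from split_ex1[OF True y(1) this]
      show ?thesis using iff True by (simp cong: conj_cong)
    next
      case False
      \<comment> \<open>Away from these degrees \<open>W\<close> is zero, so there is no coordinate
        \<mu> and the quotient is the space itself.\<close>
      have "q k x = x" if "x \<in> carrier (V k)" for x
        using coordinate_space.cls_trivial[OF cs that] W_other False by simp
      moreover have "carrier (grade C' k) = carrier (V k)" using calculation by (auto simp: carrier')
      ultimately show ?thesis using iff False y(1) by (intro ex1I[of _ y]) auto
    qed
  qed
  have 5: "x \<in> sublevel F C B f k u \<longleftrightarrow>
      (\<forall>j\<in>active ?J d t k. \<phi> k j x \<noteq> \<zero> \<longrightarrow> (if d j = k then ereal (s j) else t j) \<le> ereal u)"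
    if x: "x \<in> carrier (V k)" for k u x
  proof -
    have "x \<in> sublevel F C B f k u \<longleftrightarrow>
        (\<forall>s\<in>B k. co k x s \<noteq> \<zero> \<longrightarrow> f k s \<le> u)" using sublevel_iff x by blast
    also have "\<dots> \<longleftrightarrow> q k x \<in> sublevel F C' B' f' k u \<and>
      (k = n \<and> \<mu> k x \<noteq> \<zero> \<longrightarrow> f n b \<le> u) \<and> (k = Suc n \<and> \<mu> k x \<noteq> \<zero> \<longrightarrow> f (Suc n) a \<le> u)"
      unfolding sublevel'_iff[OF x] by (rule sublevel_split[OF x])
    also have "\<dots> \<longleftrightarrow> (\<forall>j\<in>?A' k. \<phi>' k j (q k x) \<noteq> \<zero> \<longrightarrow> (if d' j = k then ereal (s' j) else t' j) \<le> ereal u) \<and>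
      (k = n \<and> \<mu> k x \<noteq> \<zero> \<longrightarrow> f n b \<le> u) \<and> (k = Suc n \<and> \<mu> k x \<noteq> \<zero> \<longrightarrow> f (Suc n) a \<le> u)"
      unfolding lev'[OF qc[OF x]] ..
    also have "\<dots> \<longleftrightarrow> (\<forall>j\<in>active ?J d t k. \<phi> k j x \<noteq> \<zero> \<longrightarrow> (if d j = k then ereal (s j) else t j) \<le> ereal u)"
      using AJ d s t d0 s0 t0 unfolding A by (auto simp: \<phi>0 \<phi>sh)
    finally show ?thesis .
  qed
  have 6: "\<phi> k j (bd C (Suc k) x) = (if d j = k \<and> t j < \<infinity> then \<phi> (Suc k) j x else \<zero>)"
    if x: "x \<in> carrier (V (Suc k))" and j: "j \<in> active ?J d t k" for k j x
  proof -
    consider "j = j0" "k = n \<or> k = Suc n" | i where "i \<in> ?A' k" "j = sh i"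
      using j unfolding A by (auto split: if_splits)
    then show ?thesis
    proof cases
      case 1
      then show ?thesis using bd_\<mu>[OF x] d0 t0 by (auto simp: \<phi>0)
    next
      case 2
      have "\<phi>' k i (q k (bd C (Suc k) x)) = \<phi>' k i (bd C' (Suc k) (q (Suc k) x))"
        using bd'_q[OF x] by simp
      then show ?thesis using bd'[OF qc[OF x] 2(1)] 2 AJ d t by (simp add: \<phi>sh)
    qed
  qed
  show ?thesis
    by (rule exI[of _ \<phi>], rule splittingI[OF 1 _ 3 4 5 6]) (rule bspec[OF 2])
qed

end

context filtered_based_complex
begin

lemma finite_Sigma_B: "finite (Sigma UNIV B)"
proof -
  have "B k = {}" if "carrier (V k) = {\<zero>\<^bsub>V k\<^esub>}" for k
  proof (rule ccontr)
    assume "B k \<noteq> {}"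
    then obtain b where b: "b \<in> B k" by blast
    then have "co k b b = \<one>" using co_basis by simp
    moreover have "b = \<zero>\<^bsub>V k\<^esub>" using B_closed[OF b] that by simp
    ultimately show False using co_zero[OF b] by simp
  qed
  then have "Sigma UNIV B \<subseteq> Sigma {k. carrier (V k) \<noteq> {\<zero>\<^bsub>V k\<^esub>}} B" by auto
  moreover have "finite {k. carrier (V k) \<noteq> {\<zero>\<^bsub>V k\<^esub>}}"
    using based unfolding based_complex_def compact_complex_def by blast
  ultimately show ?thesis using B_finite by (meson finite_SigmaI finite_subset)
qed

lemma dim_eq: "vectorspace.dim F (V k) = card (B k)"
  using vectorspace.dim_basis[OF vs B_finite B_basis] .

lemma finite_dims: "finite {(k, i). i < vectorspace.dim F (V k)}"
proof -
  have "finite {k. B k \<noteq> {}}"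
    using finite_imageI[OF finite_Sigma_B, of fst] by (rule finite_subset[rotated]) force
  moreover have "{(k, i). i < vectorspace.dim F (V k)} \<subseteq> Sigma {k. B k \<noteq> {}} (\<lambda>k. {..<card (B k)})"
    by (auto simp: dim_eq)
  ultimately show ?thesis by (meson finite_SigmaI finite_subset finite_lessThan)
qed

text \<open>Without differential each basis element \<open>b\<close> is a bar of its own, infinite
  from \<open>f b\<close>. The indices consist of a degree and a number below the dimension, which
  is all that \<open>Y_functor\<close> records of the final complex; \<open>h\<close> chooses a
  numbering of the basis.\<close>

lemma splitting_zero_differential:
  fixes e :: "nat \<times> nat \<Rightarrow> 'j"
  assumes z: "zero_differential C" and e: "inj e"
    and d: "\<And>k i. d (e (k, i)) = k" and t: "\<And>k i. t (e (k, i)) = \<infinity>"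
  shows "\<exists>s \<phi>. splitting F C B f (e ` {(k, i). i < vectorspace.dim F (V k)}) d s t \<phi>"
proof -
  let ?J = "e ` {(k, i). i < vectorspace.dim F (V k)}"
  have "\<exists>h. bij_betw h {..<card (B k)} (B k)" for k
    using ex_bij_betw_nat_finite[OF B_finite] by (simp add: atLeast0LessThan)
  then obtain h where h: "\<And>k. bij_betw (h k) {..<card (B k)} (B k)" by metis
  have hB: "h k i \<in> B k" if "i < card (B k)" for k i using bij_betwE[OF h] that by blast
  define s where "s j = (case inv_into UNIV e j of (k, i) \<Rightarrow> f k (h k i))" for j
  define \<phi> where "\<phi> k j x = (case inv_into UNIV e j of (k', i) \<Rightarrow> co k x (h k i))" for k :: nat and j x
  have s: "s (e (k, i)) = f k (h k i)" for k i using e by (simp add: s_def)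
  have \<phi>: "\<phi> k (e (k', i)) = (\<lambda>x. co k x (h k i))" for k k' i using e by (simp add: \<phi>_def fun_eq_iff)
  have A: "active ?J d t k = (\<lambda>i. e (k, i)) ` {..<card (B k)}" for k
    using d t by (auto simp: active_def dim_eq)
  have ball: "(\<forall>i\<in>{..<card (B k)}. P (h k i)) \<longleftrightarrow> (\<forall>b\<in>B k. P b)" for k P
  proof -
    have "(\<forall>i\<in>{..<card (B k)}. P (h k i)) \<longleftrightarrow> (\<forall>b\<in>h k ` {..<card (B k)}. P b)" by blast
    then show ?thesis by (simp only: bij_betw_imp_surj_on[OF h])
  qed
  have ex: "\<exists>!x. x \<in> carrier (V k) \<and> (\<forall>j\<in>active ?J d t k. \<phi> k j x = g j)"
    if g: "\<forall>j\<in>active ?J d t k. g j \<in> carrier F" for k g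
  proof -
    interpret V: coordinate_space F "V k" by (rule cs)
    define c where "c b = g (e (k, inv_into {..<card (B k)} (h k) b))" for b
    have ch: "c (h k i) = g (e (k, i))" if "i < card (B k)" for i
      using that h[of k] by (simp add: c_def bij_betw_def)
    have "\<forall>i\<in>{..<card (B k)}. c (h k i) \<in> carrier F" using g ch unfolding A by auto
    then have cB: "c \<in> B k \<rightarrow> carrier F" using ball[of k "\<lambda>b. c b \<in> carrier F"] by auto
    have "(\<forall>j\<in>active ?J d t k. \<phi> k j x = g j) \<longleftrightarrow> (\<forall>i\<in>{..<card (B k)}. co k x (h k i) = c (h k i))" for x
      unfolding A using ch by (auto simp: \<phi>)
    then have iff: "(\<forall>j\<in>active ?J d t k. \<phi> k j x = g j) \<longleftrightarrow> (\<forall>b\<in>B k. co k x b = c b)" for x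
      using ball[of k "\<lambda>b. co k x b = c b"] by simp
    let ?x = "V.lincomb c (B k)"
    have "?x \<in> carrier (V k)" using B_closed cB by (intro V.lincomb_closed) auto
    moreover have "\<forall>b\<in>B k. co k ?x b = c b" using V.coef_unique[OF B_finite B_basis cB] by blast
    ultimately show ?thesis unfolding iff by (intro ex1I[of _ ?x]) (auto intro!: co_eqI)
  qed
  have lev: "x \<in> sublevel F C B f k u \<longleftrightarrow>
      (\<forall>j\<in>active ?J d t k. \<phi> k j x \<noteq> \<zero> \<longrightarrow> (if d j = k then ereal (s j) else t j) \<le> ereal u)"
    if x: "x \<in> carrier (V k)" for k u x
  proof -
    have "x \<in> sublevel F C B f k u \<longleftrightarrow>
        (\<forall>b\<in>B k. co k x b \<noteq> \<zero> \<longrightarrow> f k b \<le> u)" using sublevel_iff x by blast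
    also have "\<dots> \<longleftrightarrow> (\<forall>i\<in>{..<card (B k)}. co k x (h k i) \<noteq> \<zero> \<longrightarrow> f k (h k i) \<le> u)"
      using ball[of k "\<lambda>b. co k x b \<noteq> \<zero> \<longrightarrow> f k b \<le> u"] by simp
    also have "\<dots> \<longleftrightarrow> (\<forall>j\<in>active ?J d t k. \<phi> k j x \<noteq> \<zero> \<longrightarrow> (if d j = k then ereal (s j) else t j) \<le> ereal u)"
      unfolding A using d s by (auto simp: \<phi>)
    finally show ?thesis .
  qed
  have lin: "linfun F (V k) (\<phi> k j)" if "j \<in> active ?J d t k" for k j
    using that linfun_co[OF hB] unfolding A by (auto simp: \<phi>)
  have bd: "\<phi> k j (bd C (Suc k) x) = (if d j = k \<and> t j < \<infinity> then \<phi> (Suc k) j x else \<zero>)"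
    if "x \<in> carrier (V (Suc k))" "j \<in> active ?J d t k" for k j x
    using z that co_zero[OF hB] t unfolding A zero_differential_def by (auto simp: \<phi>)
  have pos: "\<forall>j\<in>?J. 0 \<le> s j \<and> ereal (s j) < t j"
    using s t filter_nonneg[OF hB] by (auto simp: dim_eq)
  have fin: "finite ?J" using finite_dims by simp
  show ?thesis
    by (rule exI[of _ s], rule exI[of _ \<phi>], rule splittingI[OF fin _ lin ex lev bd]) (rule bspec[OF pos])
qed

end

section \<open>Iterated simplification\<close>

text \<open>The invariant of the algorithm. Weights are constrained on actual pairs only, because
  inherited weights are read through inverses that are arbitrary elsewhere. The orders on ties keep
  \<open>min_pair\<close> well defined.\<close>

definition filter_weighted ::
    "('f, 'r) ring_scheme \<Rightarrow> ('f, 'v) weighted_complex \<Rightarrow> (nat \<Rightarrow> 'v \<Rightarrow> real) \<Rightarrow> bool" where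
  "filter_weighted F D f \<longleftrightarrow>
     filtered_based_complex F (cpx D) (bas D) f \<and>
     (\<forall>k. \<forall>a\<in>bas D (Suc k). \<forall>b\<in>bas D k. wt D (Suc k) a b = \<bar>f (Suc k) a - f k b\<bar>) \<and>
     orders_ties (bas D) (wt D) (ties D)"

lemma linear_order_on_finite_least:
  assumes "finite A" "A \<noteq> {}" "A \<subseteq> X" "linear_order_on X r"
  shows "\<exists>p\<in>A. \<forall>p'\<in>A. (p, p') \<in> r"
  using assms
proof (induction A rule: finite_ne_induct)
  case (singleton x)
  then show ?case by (auto simp: order_on_defs refl_on_def)
next
  case (insert x A)
  then obtain p where p: "p \<in> A" "\<forall>p'\<in>A. (p, p') \<in> r" by auto
  have xX: "x \<in> X" "p \<in> X" using insert.prems p by auto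
  have tr: "trans r" and refl: "(x, x) \<in> r" and tot: "x \<noteq> p \<Longrightarrow> (x, p) \<in> r \<or> (p, x) \<in> r"
    using insert.prems xX by (auto simp: order_on_defs refl_on_def total_on_def)
  show ?case
  proof (cases "(p, x) \<in> r")
    case True
    then show ?thesis using p by blast
  next
    case False
    then have "(x, p) \<in> r" using tot refl by blast
    then have "\<forall>p'\<in>insert x A. (x, p') \<in> r" using p refl tr by (blast dest: transD)
    then show ?thesis by blast
  qed
qed

text \<open>The inherited tie order has this form: the old order restricted to the surviving pairs
  \<open>Y\<close> and carried to their classes by the injection \<open>Q\<close>.\<close>

lemma linear_order_on_image:
  assumes r: "linear_order_on X r" and inj: "inj_on Q Y"
  shows "linear_order_on (Q ` (X \<inter> Y)) {(Q u, Q v) | u v. (u, v) \<in> r \<and> u \<in> Y \<and> v \<in> Y}"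
proof -
  let ?r = "{(Q u, Q v) | u v. (u, v) \<in> r \<and> u \<in> Y \<and> v \<in> Y}"
  have sub: "r \<subseteq> X \<times> X" and refl: "\<And>x. x \<in> X \<Longrightarrow> (x, x) \<in> r" and tr: "trans r"
    and an: "antisym r" and tot: "\<And>x y. x \<in> X \<Longrightarrow> y \<in> X \<Longrightarrow> x \<noteq> y \<Longrightarrow> (x, y) \<in> r \<or> (y, x) \<in> r"
    using r by (auto simp: order_on_defs refl_on_def total_on_def)
  have "?r \<subseteq> Q ` (X \<inter> Y) \<times> Q ` (X \<inter> Y)" using sub by auto
  moreover have "refl_on (Q ` (X \<inter> Y)) ?r" using refl by (auto simp: refl_on_def)
  moreover have "trans ?r"
  proof (rule transI)
    fix x y z assume "(x, y) \<in> ?r" "(y, z) \<in> ?r"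
    then obtain u v v' w where "x = Q u" "y = Q v" "(u, v) \<in> r" "u \<in> Y" "v \<in> Y"
      "y = Q v'" "z = Q w" "(v', w) \<in> r" "v' \<in> Y" "w \<in> Y" by blast
    moreover have "v = v'" using calculation inj by (simp add: inj_on_eq_iff)
    ultimately show "(x, z) \<in> ?r" using tr by (blast dest: transD)
  qed
  moreover have "antisym ?r"
  proof (rule antisymI)
    fix x y assume "(x, y) \<in> ?r" "(y, x) \<in> ?r"
    then obtain u v u' v' where "x = Q u" "y = Q v" "(u, v) \<in> r" "u \<in> Y" "v \<in> Y"
      "y = Q v'" "x = Q u'" "(v', u') \<in> r" "v' \<in> Y" "u' \<in> Y" by blast
    moreover have "v = v'" "u = u'" using calculation inj by (simp_all add: inj_on_eq_iff)
    ultimately show "x = y" using an by (blast dest: antisymD)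
  qed
  moreover have "total_on (Q ` (X \<inter> Y)) ?r"
  proof (rule total_onI)
    fix x y assume "x \<in> Q ` (X \<inter> Y)" "y \<in> Q ` (X \<inter> Y)" "x \<noteq> y"
    then obtain u v where "x = Q u" "y = Q v" "u \<in> X" "v \<in> X" "u \<in> Y" "v \<in> Y" "u \<noteq> v" by blast
    then show "(x, y) \<in> ?r \<or> (y, x) \<in> ?r" using tot by blast
  qed
  ultimately show ?thesis by (simp add: order_on_defs)
qed

context filtered_based_complex
begin

lemma finite_adjacent_pairs: "finite (adjacent_pairs B)"
proof -
  have "adjacent_pairs B \<subseteq> (\<lambda>((k, a), (l, b)). (k, a, b)) ` (Sigma UNIV B \<times> Sigma UNIV B)"
    by (force simp: adjacent_pairs_def)
  then show ?thesis by (rule finite_subset) (use finite_Sigma_B in blast)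
qed

lemma nonzero_differential_pair:
  assumes "\<not> zero_differential C"
  shows "\<exists>k a b. a \<in> B (Suc k) \<and> b \<in> B k \<and> co k (bd C (Suc k) a) b \<noteq> \<zero>"
proof -
  obtain k x where x: "x \<in> carrier (V (Suc k))" "bd C (Suc k) x \<noteq> \<zero>\<^bsub>V k\<^esub>"
    using assms by (auto simp: zero_differential_def)
  then obtain b where b: "b \<in> B k" "co k (bd C (Suc k) x) b \<noteq> \<zero>"
    using coordinate_space.coef_eq_zero_iff[OF cs B_finite B_basis bd_closed[OF x(1)]] by blast
  then show ?thesis using co_bd_nonzero[OF x(1) b] by blast
qed

end

text \<open>The tie order singles out one pair among those of minimal weight and leaves no trace in
  the locale \<open>pivot\<close>; this is why the result holds for every choice of orders.\<close>

lemma min_pair_pivot: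
  assumes D: "filter_weighted F D f" and nz: "\<not> zero_differential (cpx D)"
  obtains n a b where "min_pair F D = (Suc n, a, b)" "pivot F (cpx D) (bas D) f n a b"
    "weight D (min_pair F D) = f (Suc n) a - f n b"
proof -
  interpret filtered_based_complex F "cpx D" "bas D" f using D by (simp add: filter_weighted_def)
  have ot: "linear_order_on {(m, a, b) \<in> adjacent_pairs (bas D). wt D m a b = x} (ties D x)" for x
    using D by (simp add: filter_weighted_def orders_ties_def)
  have wt: "wt D (Suc k) a b = f (Suc k) a - f k b"
    if "a \<in> bas D (Suc k)" "b \<in> bas D k" "co k (bd (cpx D) (Suc k) a) b \<noteq> \<zero>\<^bsub>F\<^esub>" for k a b
    using D that filter_less[OF that] by (auto simp: filter_weighted_def)
  let ?K = "candidates F D"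
  have memK: "(Suc k, a, b) \<in> ?K \<longleftrightarrow>
      a \<in> bas D (Suc k) \<and> b \<in> bas D k \<and> co k (bd (cpx D) (Suc k) a) b \<noteq> \<zero>\<^bsub>F\<^esub>" for k a b
    by (simp add: candidates_def adjacent_pairs_def incidence_co)
  have K0: "(0, a, b) \<notin> ?K" for a b by (simp add: candidates_def adjacent_pairs_def)
  have finK: "finite ?K" using finite_adjacent_pairs by (rule finite_subset[rotated]) (auto simp: candidates_def)
  have neK: "?K \<noteq> {}" using nonzero_differential_pair[OF nz] memK by blast
  define w where "w = Min (weight D ` ?K)"
  \<comment> \<open>All candidates of minimal weight lie in the domain of the single order
    \<open>ties D w\<close>, and finiteness gives a first one.\<close>
  let ?A = "{p \<in> ?K. weight D p = w}"
  have "w \<in> weight D ` ?K" unfolding w_def using finK neK by (intro Min_in) auto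
  then have neA: "?A \<noteq> {}" by auto
  have wle: "w \<le> weight D p" if "p \<in> ?K" for p unfolding w_def using finK that by simp
  have subA: "?A \<subseteq> {(m, a, b) \<in> adjacent_pairs (bas D). wt D m a b = w}"
    by (auto simp: candidates_def weight_def)
  have finA: "finite ?A" using finK by simp
  obtain p where p: "p \<in> ?A" "\<forall>p'\<in>?A. (p, p') \<in> ties D w"
    using linear_order_on_finite_least[OF finA neA subA ot] by blast
  let ?P = "\<lambda>p. p \<in> ?K \<and> (\<forall>p' \<in> ?K. weight D p < weight D p' \<or>
        (weight D p = weight D p' \<and> (p, p') \<in> ties D (weight D p)))"
  have Pp: "?P p"
  proof (intro conjI ballI)
    show "p \<in> ?K" using p by blast
    fix p' assume p': "p' \<in> ?K"
    show "weight D p < weight D p' \<or> (weight D p = weight D p' \<and> (p, p') \<in> ties D (weight D p))"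
    proof (cases "weight D p' = w")
      case True
      then have "(p, p') \<in> ties D w" "weight D p = w" using p p' by blast+
      then show ?thesis using True by simp
    next
      case False
      then show ?thesis using p wle[OF p'] by auto
    qed
  qed
  have "p' = p" if P': "?P p'" for p'
  proof -
    have "weight D p' = weight D p" "(p, p') \<in> ties D (weight D p)" "(p', p) \<in> ties D (weight D p)"
      using Pp P' by force+
    moreover have "antisym (ties D (weight D p))" using ot by (simp add: order_on_defs)
    ultimately show ?thesis by (blast dest: antisymD)
  qed
  then have mp: "min_pair F D = p" unfolding min_pair_def using Pp by (intro the_equality) blast+
  obtain m a b where "p = (m, a, b)" by (cases p)
  then obtain n where pn: "p = (Suc n, a, b)" using Pp K0 by (cases m) auto
  then have ab: "a \<in> bas D (Suc n)" "b \<in> bas D n" "co n (bd (cpx D) (Suc n) a) b \<noteq> \<zero>\<^bsub>F\<^esub>"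
    using Pp memK by auto
  have wp: "weight D p = f (Suc n) a - f n b" using wt[OF ab] by (simp add: pn weight_def)
  have "f (Suc n) a - f n b \<le> f (Suc k) a' - f k b'"
    if "a' \<in> bas D (Suc k)" "b' \<in> bas D k" "co k (bd (cpx D) (Suc k) a') b' \<noteq> \<zero>\<^bsub>F\<^esub>" for k a' b'
  proof -
    have "weight D p \<le> weight D (Suc k, a', b')" using Pp that memK by force
    then show ?thesis using wp wt[OF that] by (simp add: weight_def)
  qed
  then have "pivot F (cpx D) (bas D) f n a b" using ab by unfold_locales auto
  then show thesis using that mp pn wp by blast
qed

section \<open>The invariant under a simplification step\<close>

context pivot
begin

definition pair_cls :: "nat \<times> 'v \<times> 'v \<Rightarrow> nat \<times> 'v \<times> 'v" where
  "pair_cls = (\<lambda>(i, x, y). (i, q i x, q (i - 1) y))"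

definition lift :: "nat \<Rightarrow> 'v \<Rightarrow> 'v" where
  "lift k = inv_into (S k) (q k)"

lemma simplify_eq:
  assumes "cpx D = C" "bas D = B"
  shows "cpx (simplify F D (Suc n, a, b)) = C'" "bas (simplify F D (Suc n, a, b)) = B'"
    "wt (simplify F D (Suc n, a, b)) = (\<lambda>k x y. wt D k (lift k x) (lift (k - 1) y))"
    "ties (simplify F D (Suc n, a, b)) = (\<lambda>r. {(pair_cls u, pair_cls v) | u v.
      (u, v) \<in> ties D r \<and> u \<in> adjacent_pairs S \<and> v \<in> adjacent_pairs S})"
proof -
  show "cpx (simplify F D (Suc n, a, b)) = C'" "bas (simplify F D (Suc n, a, b)) = B'"
    "wt (simplify F D (Suc n, a, b)) = (\<lambda>k x y. wt D k (lift k x) (lift (k - 1) y))"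
    unfolding simplify_def prod.case Let_def assms
    by (simp_all only: weighted_complex.select_convs W_def[symmetric] S_def[symmetric] lift_def)
  have "ties (simplify F D (Suc n, a, b)) = (\<lambda>r. {((i, q i a1, q (i - 1) b1), (j, q j a2, q (j - 1) b2)) | i a1 b1 j a2 b2.
                   ((i, a1, b1), (j, a2, b2)) \<in> ties D r \<and>
                   (i, a1, b1) \<in> adjacent_pairs S \<and> (j, a2, b2) \<in> adjacent_pairs S})"
    unfolding simplify_def prod.case Let_def assms
    by (simp_all only: weighted_complex.select_convs W_def[symmetric] S_def[symmetric])
  also have "\<dots> = (\<lambda>r. {(pair_cls u, pair_cls v) | u v.
      (u, v) \<in> ties D r \<and> u \<in> adjacent_pairs S \<and> v \<in> adjacent_pairs S})"
    by (rule ext) (auto simp: pair_cls_def split: prod.splits)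
  finally show "ties (simplify F D (Suc n, a, b)) = \<dots>" .
qed

lemma filter_weighted_simplify:
  assumes D: "filter_weighted F D f" "cpx D = C" "bas D = B"
  shows "filter_weighted F (simplify F D (Suc n, a, b)) f'"
  unfolding filter_weighted_def simplify_eq[OF D(2,3)]
proof (intro conjI allI ballI)
  show "filtered_based_complex F C' B' f'" ..
  fix k x y assume "x \<in> B' (Suc k)" "y \<in> B' k"
  then have "lift (Suc k) x \<in> B (Suc k)" "lift k y \<in> B k"
    unfolding lift_def using S_sub inv_into_into by (metis subsetD)+
  then show "wt D (Suc k) (lift (Suc k) x) (lift (Suc k - 1) y) = \<bar>f' (Suc k) x - f' k y\<bar>"
    using D by (simp add: filter_weighted_def f'_def lift_def)
next
  have inj: "inj_on pair_cls (adjacent_pairs S)"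
    using q_inj by (auto simp: inj_on_def pair_cls_def adjacent_pairs_def)
  have rep: "lift k (q k s) = s" if "s \<in> S k" for k s
    using q_inj that by (simp add: lift_def)
  show "orders_ties B' (\<lambda>k x y. wt D k (lift k x) (lift (k - 1) y))
     (\<lambda>r. {(pair_cls u, pair_cls v) | u v. (u, v) \<in> ties D r \<and> u \<in> adjacent_pairs S \<and> v \<in> adjacent_pairs S})"
    unfolding orders_ties_def
  proof
    fix r
    let ?X = "{(m, a, b) \<in> adjacent_pairs B. wt D m a b = r}"
    have "linear_order_on ?X (ties D r)" using D by (simp add: filter_weighted_def orders_ties_def)
    moreover have "pair_cls ` (?X \<inter> adjacent_pairs S) =
       {(m, x, y) \<in> adjacent_pairs B'. wt D m (lift m x) (lift (m - 1) y) = r}"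
      (is "_ = ?Z")
    proof
      show "pair_cls ` (?X \<inter> adjacent_pairs S) \<subseteq> ?Z"
        using rep by (auto simp: pair_cls_def adjacent_pairs_def)
      show "?Z \<subseteq> pair_cls ` (?X \<inter> adjacent_pairs S)"
      proof
        fix z assume z: "z \<in> ?Z"
        obtain m x y where zm: "z = (m, x, y)" by (cases z)
        with z obtain s s' where s: "m \<ge> 1" "s \<in> S m" "x = q m s" "s' \<in> S (m - 1)" "y = q (m - 1) s'"
          by (auto simp: adjacent_pairs_def)
        then have "wt D m s s' = r" using z zm rep by simp
        then have "(m, s, s') \<in> ?X \<inter> adjacent_pairs S" using s S_sub by (auto simp: adjacent_pairs_def)
        moreover have "z = pair_cls (m, s, s')" using zm s by (simp add: pair_cls_def)
        ultimately show "z \<in> pair_cls ` (?X \<inter> adjacent_pairs S)" by blast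
      qed
    qed
    ultimately show "linear_order_on ?Z {(pair_cls u, pair_cls v) | u v.
        (u, v) \<in> ties D r \<and> u \<in> adjacent_pairs S \<and> v \<in> adjacent_pairs S}"
      using linear_order_on_image[OF _ inj, of ?X "ties D r"] by (simp only:)
  qed
qed

text \<open>The total number of basis elements is the measure for the induction over the algorithm;
  it drops because \<open>a\<close> disappears.\<close>

lemma card_simplify: "card (Sigma UNIV B') < card (Sigma UNIV B)"
proof -
  have "Sigma UNIV B' = (\<lambda>(k, x). (k, q k x)) ` Sigma UNIV S" by auto
  moreover have fin: "finite (Sigma UNIV S)" using S_sub finite_Sigma_B by (meson Sigma_mono finite_subset subset_UNIV)
  ultimately have "card (Sigma UNIV B') \<le> card (Sigma UNIV S)" by (simp add: card_image_le)
  also have "\<dots> < card (Sigma UNIV B)"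
  proof (rule psubset_card_mono[OF finite_Sigma_B])
    have "(Suc n, a) \<in> Sigma UNIV B - Sigma UNIV S" using a by (simp add: S_def)
    then show "Sigma UNIV S \<subset> Sigma UNIV B" using S_sub by blast
  qed
  finally show ?thesis .
qed

end

text \<open>Peels off the first step, not the last: the induction splits off the first pair and
  treats the rest as a run on the simplified complex.\<close>

lemma stage_Suc: "stage F D (Suc i) = stage F (simplify F D (min_pair F D)) i"
  by (simp add: stage_def funpow_Suc_right del: funpow.simps)

lemma num_steps_zero: "zero_differential (cpx D) \<Longrightarrow> num_steps F D = 0"
  unfolding num_steps_def by (rule Least_eq_0) (simp add: stage_def)

text \<open>The least number in \<open>num_steps\<close> is meaningful only if some stage has zero
  differential; stage \<open>r\<close> of the remaining run supplies it.\<close>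

lemma num_steps_Suc:
  assumes "\<not> zero_differential (cpx D)" "zero_differential (cpx (stage F (simplify F D (min_pair F D)) r))"
  shows "num_steps F D = Suc (num_steps F (simplify F D (min_pair F D)))"
  unfolding num_steps_def stage_Suc[symmetric]
  by (rule Least_Suc[of _ "Suc r"]) (use assms in \<open>simp_all add: stage_Suc, simp add: stage_def\<close>)

text \<open>The index set of \<^const>\<open>Y_functor\<close> up to the summands of weight 0, which do not occur here.\<close>

definition Y_index :: "('f, 'r) ring_scheme \<Rightarrow> ('f, 'v) weighted_complex \<Rightarrow> (nat + nat \<times> nat) set" where
  "Y_index F D = Inl ` {..<num_steps F D} \<union> Inr ` {(k, j). j < vectorspace.dim F (grade (final_complex F D) k)}"

text \<open>Termination belongs to the same induction, since \<open>num_steps\<close> of the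
  remaining run must be known to exist. A step has the degree of \<open>a\<close>, one above the
  degree of its bar, and its weight is the length of the bar.\<close>

lemma simplification_splitting:
  assumes "filter_weighted F D f"
  shows "(\<exists>r. zero_differential (cpx (stage F D r))) \<and>
    (\<exists>d s t \<phi>. splitting F (cpx D) (bas D) f (Y_index F D) d s t \<phi> \<and>
      (\<forall>i<num_steps F D. step_degree F D i = Suc (d (Inl i)) \<and> t (Inl i) = ereal (s (Inl i) + step_weight F D i)) \<and>
      (\<forall>k i. d (Inr (k, i)) = k \<and> t (Inr (k, i)) = \<infinity>))"
  using assms
proof (induction "card (Sigma UNIV (bas D))" arbitrary: D f rule: less_induct)
  case less
  interpret filtered_based_complex F "cpx D" "bas D" f using less.prems by (simp add: filter_weighted_def)
  show ?case
  proof (cases "zero_differential (cpx D)")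
    case True
    have r: "zero_differential (cpx (stage F D 0))" using True by (simp add: stage_def)
    have n: "num_steps F D = 0" by (rule num_steps_zero[OF True])
    then have fc: "final_complex F D = cpx D" by (simp add: final_complex_def stage_def)
    \<comment> \<open>No index \<open>Inl i\<close> occurs in this case; \<open>id\<close> is a
      filler.\<close>
    define d :: "nat + nat \<times> nat \<Rightarrow> nat" where "d = case_sum id fst"
    define t :: "nat + nat \<times> nat \<Rightarrow> ereal" where "t = (\<lambda>_. \<infinity>)"
    obtain s \<phi> where "splitting F (cpx D) (bas D) f (Inr ` {(k, i). i < vectorspace.dim F (grade (cpx D) k)}) d s t \<phi>"
      using splitting_zero_differential[OF True, of "Inr :: nat \<times> nat \<Rightarrow> nat + nat \<times> nat" d t]
      by (auto simp: d_def t_def)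
    then have "splitting F (cpx D) (bas D) f (Y_index F D) d s t \<phi>" by (simp add: Y_index_def n fc)
    then show ?thesis using r n by (intro conjI exI) (auto simp: d_def t_def)
  next
    case False
    obtain n a b where mp: "min_pair F D = (Suc n, a, b)" and pv: "pivot F (cpx D) (bas D) f n a b"
      and w: "weight D (min_pair F D) = f (Suc n) a - f n b"
      by (rule min_pair_pivot[OF less.prems False])
    interpret pivot F "cpx D" "bas D" f n a b by (rule pv)
    let ?D = "simplify F D (min_pair F D)"
    have eqs: "cpx ?D = C'" "bas ?D = B'" unfolding mp by (rule simplify_eq[OF refl refl])+
    have fw: "filter_weighted F ?D f'" unfolding mp by (rule filter_weighted_simplify[OF less.prems refl refl])
    have "card (Sigma UNIV (bas ?D)) < card (Sigma UNIV (bas D))" unfolding eqs by (rule card_simplify)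
    from less.hyps[OF this fw] obtain r d' s' t' \<phi>' where r: "zero_differential (cpx (stage F ?D r))"
      and sp: "splitting F C' B' f' (Y_index F ?D) d' s' t' \<phi>'"
      and st: "\<And>i. i < num_steps F ?D \<Longrightarrow> step_degree F ?D i = Suc (d' (Inl i)) \<and> t' (Inl i) = ereal (s' (Inl i) + step_weight F ?D i)"
      and fr: "\<And>k i. d' (Inr (k, i)) = k \<and> t' (Inr (k, i)) = \<infinity>" unfolding eqs by blast
    have ns: "num_steps F D = Suc (num_steps F ?D)" by (rule num_steps_Suc[OF False r])
    have fc: "final_complex F D = final_complex F ?D" by (simp add: final_complex_def ns stage_Suc)
    \<comment> \<open>The first pair takes number 0, so later pairs move up by one, while infinite
      bars keep their index.\<close>
    let ?sh = "map_sum Suc id :: nat + nat \<times> nat \<Rightarrow> nat + nat \<times> nat"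
    have Y: "Y_index F D = insert (Inl 0) (?sh ` Y_index F ?D)"
      unfolding Y_index_def ns fc lessThan_Suc_eq_insert_0 by (force simp: image_Un image_image)
    define d where "d = case_sum (case_nat n (\<lambda>i. d' (Inl i))) (\<lambda>p. d' (Inr p))"
    define s where "s = case_sum (case_nat (f n b) (\<lambda>i. s' (Inl i))) (\<lambda>p. s' (Inr p))"
    define t where "t = case_sum (case_nat (ereal (f (Suc n) a)) (\<lambda>i. t' (Inl i))) (\<lambda>p. t' (Inr p))"
    have dst: "d (?sh j) = d' j" "s (?sh j) = s' j" "t (?sh j) = t' j" for j
      by (cases j; simp add: d_def s_def t_def)+
    have "inj_on ?sh (Y_index F ?D)" by (rule inj_on_subset[OF sum.inj_map]) auto
    moreover have "Inl 0 \<notin> ?sh ` Y_index F ?D"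
    proof
      assume "Inl 0 \<in> ?sh ` Y_index F ?D"
      then obtain j where "Inl 0 = ?sh j" by blast
      then show False by (cases j) auto
    qed
    ultimately obtain \<phi> where "splitting F (cpx D) (bas D) f (Y_index F D) d s t \<phi>"
      using splitting_pivot[OF sp, of ?sh "Inl 0" d s t] dst unfolding Y
      by (auto simp: d_def s_def t_def)
    moreover have "step_degree F D i = Suc (d (Inl i)) \<and> t (Inl i) = ereal (s (Inl i) + step_weight F D i)"
      if "i < num_steps F D" for i
    proof (cases i)
      case 0
      then show ?thesis using mp w by (simp add: step_degree_def step_weight_def stage_def d_def s_def t_def)
    next
      case (Suc i')
      then show ?thesis
        using st[of i'] that ns by (simp add: step_degree_def step_weight_def stage_Suc d_def s_def t_def)
    qed
    moreover have "d (Inr (k, i)) = k \<and> t (Inr (k, i)) = \<infinity>" for k i using fr by (simp add: d_def t_def)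
    moreover have "zero_differential (cpx (stage F D (Suc r)))" using r by (simp add: stage_Suc)
    ultimately show ?thesis by blast
  qed
qed

section \<open>Homology of a split complex\<close>

abbreviation interval_sum ::
    "('f, 'r) ring_scheme \<Rightarrow> 'j set \<Rightarrow> ('j \<Rightarrow> real) \<Rightarrow> ('j \<Rightarrow> ereal) \<Rightarrow> ('f, 'j \<Rightarrow> 'f) pmodule" where
  "interval_sum F J s t \<equiv> pmodule_sum J (\<lambda>j. interval_module F (s j, t j))"

locale split_complex = filtered_based_complex F C B f
  for F :: "('f, 'r) ring_scheme" (structure) and C :: "('f, 'v) complex_data" and B f +
  fixes J :: "'j set" and d :: "'j \<Rightarrow> nat" and s :: "'j \<Rightarrow> real" and t :: "'j \<Rightarrow> ereal"
    and \<phi> :: "nat \<Rightarrow> 'j \<Rightarrow> 'v \<Rightarrow> 'f"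
  assumes splitting: "splitting F C B f J d s t \<phi>"
begin

abbreviation act :: "nat \<Rightarrow> 'j set" where "act \<equiv> active J d t"

abbreviation sub :: "nat \<Rightarrow> real \<Rightarrow> 'v set" where
  "sub \<equiv> sublevel F C B f"

lemma J_finite: "finite J"
  and bar_bounds: "j \<in> J \<Longrightarrow> 0 \<le> s j \<and> ereal (s j) < t j"
  and linfun_\<phi>: "j \<in> act k \<Longrightarrow> linfun F (V k) (\<phi> k j)"
  using splitting by (auto simp: splitting_def)

lemma \<phi>_ex1: "(\<And>j. j \<in> act k \<Longrightarrow> g j \<in> carrier F) \<Longrightarrow>
    \<exists>!x. x \<in> carrier (V k) \<and> (\<forall>j\<in>act k. \<phi> k j x = g j)"
  using splitting unfolding splitting_def by blast

lemma sub_iff: "x \<in> carrier (V k) \<Longrightarrow> x \<in> sub k u \<longleftrightarrow>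
    (\<forall>j\<in>act k. \<phi> k j x \<noteq> \<zero> \<longrightarrow> (if d j = k then ereal (s j) else t j) \<le> ereal u)"
  using splitting unfolding splitting_def by blast

lemma \<phi>_bd: "x \<in> carrier (V (Suc k)) \<Longrightarrow> j \<in> act k \<Longrightarrow>
    \<phi> k j (bd C (Suc k) x) = (if d j = k \<and> t j < \<infinity> then \<phi> (Suc k) j x else \<zero>)"
  using splitting unfolding splitting_def by blast

lemma \<phi>_closed: "j \<in> act k \<Longrightarrow> x \<in> carrier (V k) \<Longrightarrow> \<phi> k j x \<in> carrier F"
  by (rule linfun_closed[OF linfun_\<phi>])

lemma \<phi>_zero: "j \<in> act k \<Longrightarrow> \<phi> k j \<zero>\<^bsub>V k\<^esub> = \<zero>"
  by (rule coordinate_space.linfun_zero[OF cs linfun_\<phi>])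

lemma \<phi>_eqI:
  assumes "x \<in> carrier (V k)" "y \<in> carrier (V k)" "\<And>j. j \<in> act k \<Longrightarrow> \<phi> k j x = \<phi> k j y"
  shows "x = y"
  using \<phi>_ex1[of k "\<lambda>j. \<phi> k j y"] \<phi>_closed assms by blast

lemma zero_closed: "\<zero>\<^bsub>V k\<^esub> \<in> carrier (V k)"
proof -
  interpret V: coordinate_space F "V k" by (rule cs)
  show ?thesis by simp
qed

section \<open>Cycles and boundaries in coordinates\<close>

definition cyc :: "nat \<Rightarrow> real \<Rightarrow> 'v set" where
  "cyc n u = {x \<in> sub n u. n > 0 \<longrightarrow> bd C n x = \<zero>\<^bsub>V (n - 1)\<^esub>}"

definition bdry :: "nat \<Rightarrow> real \<Rightarrow> 'v set" where
  "bdry n u = bd C (Suc n) ` sub (Suc n) u"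

text \<open>The differential sends the upper generator of each finite bar to its lower one. So it is
  injective on the span of the upper generators and kills the lower ones.\<close>

lemma bd_eq_zero_iff:
  assumes x: "x \<in> carrier (V (Suc k))"
  shows "bd C (Suc k) x = \<zero>\<^bsub>V k\<^esub> \<longleftrightarrow> (\<forall>j\<in>act (Suc k). d j \<noteq> Suc k \<longrightarrow> \<phi> (Suc k) j x = \<zero>)"
proof
  assume 0: "bd C (Suc k) x = \<zero>\<^bsub>V k\<^esub>"
  show "\<forall>j\<in>act (Suc k). d j \<noteq> Suc k \<longrightarrow> \<phi> (Suc k) j x = \<zero>"
  proof (intro ballI impI)
    fix j assume "j \<in> act (Suc k)" "d j \<noteq> Suc k"
    then have "j \<in> act k" "d j = k" "t j < \<infinity>" by (auto simp: active_def)
    then show "\<phi> (Suc k) j x = \<zero>" using \<phi>_bd[OF x, of j] 0 \<phi>_zero by simp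
  qed
next
  assume 0: "\<forall>j\<in>act (Suc k). d j \<noteq> Suc k \<longrightarrow> \<phi> (Suc k) j x = \<zero>"
  show "bd C (Suc k) x = \<zero>\<^bsub>V k\<^esub>"
  proof (rule \<phi>_eqI[OF bd_closed[OF x] zero_closed])
    fix j assume j: "j \<in> act k"
    have "d j = k \<and> t j < \<infinity> \<Longrightarrow> j \<in> act (Suc k) \<and> d j \<noteq> Suc k" using j by (auto simp: active_def)
    then show "\<phi> k j (bd C (Suc k) x) = \<phi> k j \<zero>\<^bsub>V k\<^esub>" using \<phi>_bd[OF x j] 0 \<phi>_zero[OF j] by auto
  qed
qed

lemma cyc_iff:
  assumes x: "x \<in> carrier (V n)"
  shows "x \<in> cyc n u \<longleftrightarrow> (\<forall>j\<in>act n. \<phi> n j x \<noteq> \<zero> \<longrightarrow> d j = n \<and> s j \<le> u)"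
proof -
  have "x \<in> cyc n u \<longleftrightarrow> x \<in> sub n u \<and> (\<forall>j\<in>act n. d j \<noteq> n \<longrightarrow> \<phi> n j x = \<zero>)"
  proof (cases n)
    case 0
    then show ?thesis by (auto simp: cyc_def active_def)
  next
    case (Suc k)
    then show ?thesis using bd_eq_zero_iff[of x k] x by (auto simp: cyc_def)
  qed
  then show ?thesis unfolding sub_iff[OF x] by auto
qed

text \<open>Up to cycles, the only preimages are combinations of upper generators, and that of bar
  \<open>j\<close> enters at time \<open>t j\<close>.\<close>

lemma bdry_iff:
  assumes x: "x \<in> carrier (V n)"
  shows "x \<in> bdry n u \<longleftrightarrow> (\<forall>j\<in>act n. \<phi> n j x \<noteq> \<zero> \<longrightarrow> d j = n \<and> t j \<le> ereal u)"
proof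
  assume "x \<in> bdry n u"
  then obtain y where y: "y \<in> sub (Suc n) u" "x = bd C (Suc n) y" by (auto simp: bdry_def)
  then have yc: "y \<in> carrier (V (Suc n))" using sublevel_iff by blast
  show "\<forall>j\<in>act n. \<phi> n j x \<noteq> \<zero> \<longrightarrow> d j = n \<and> t j \<le> ereal u"
  proof (intro ballI impI)
    fix j assume j: "j \<in> act n" "\<phi> n j x \<noteq> \<zero>"
    then have dt: "d j = n" "t j < \<infinity>" "\<phi> (Suc n) j y \<noteq> \<zero>"
      using \<phi>_bd[OF yc j(1)] y(2) by (auto split: if_splits)
    then have "j \<in> act (Suc n)" using j by (auto simp: active_def)
    then have "t j \<le> ereal u" using y(1) dt unfolding sub_iff[OF yc] by force
    then show "d j = n \<and> t j \<le> ereal u" using dt by simp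
  qed
next
  assume z: "\<forall>j\<in>act n. \<phi> n j x \<noteq> \<zero> \<longrightarrow> d j = n \<and> t j \<le> ereal u"
  \<comment> \<open>The preimage has, at each upper generator, the coordinate of \<open>x\<close> at
    the lower one.\<close>
  define g where "g j = (if d j = n then \<phi> n j x else \<zero>)" for j
  have gc: "g j \<in> carrier F" if "j \<in> act (Suc n)" for j
    using that \<phi>_closed[OF _ x, of j] by (auto simp: g_def active_def)
  from \<phi>_ex1[of "Suc n" g, OF this] obtain y where y: "y \<in> carrier (V (Suc n))" "\<forall>j\<in>act (Suc n). \<phi> (Suc n) j y = g j"
    by blast
  have "y \<in> sub (Suc n) u"
    unfolding sub_iff[OF y(1)]
  proof (intro ballI impI)
    fix j assume j: "j \<in> act (Suc n)" "\<phi> (Suc n) j y \<noteq> \<zero>"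
    then have "d j = n" "\<phi> n j x \<noteq> \<zero>" using y(2) by (auto simp: g_def split: if_splits)
    moreover have "j \<in> act n" using j calculation by (auto simp: active_def)
    ultimately show "(if d j = Suc n then ereal (s j) else t j) \<le> ereal u" using z by auto
  qed
  moreover have "x = bd C (Suc n) y"
  proof (rule \<phi>_eqI[OF x bd_closed[OF y(1)]])
    fix j assume j: "j \<in> act n"
    show "\<phi> n j x = \<phi> n j (bd C (Suc n) y)"
    proof (cases "d j = n \<and> t j < \<infinity>")
      case True
      then have "j \<in> act (Suc n)" using j by (auto simp: active_def)
      then show ?thesis using \<phi>_bd[OF y(1) j] True y(2) by (simp add: g_def)
    next
      case False
      \<comment> \<open>A non-zero coordinate would give degree \<open>n\<close> and
        \<open>t j \<le> u\<close>, and the latter excludes an infinite bar.\<close>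
      have "\<phi> n j x = \<zero>"
      proof (rule ccontr)
        assume "\<phi> n j x \<noteq> \<zero>"
        then have "d j = n" "t j \<le> ereal u" using z j by blast+
        then show False using False by (cases "t j") auto
      qed
      then show ?thesis unfolding \<phi>_bd[OF y(1) j] if_not_P[OF False] .
    qed
  qed
  ultimately show "x \<in> bdry n u" by (auto simp: bdry_def)
qed

lemma sub_carrier: "sub k u \<subseteq> carrier (V k)" using sublevel_iff by blast

text \<open>In coordinates the inclusion is the inequality \<open>s j < t j\<close>.\<close>

lemma bdry_cyc: "bdry n u \<subseteq> cyc n u"
proof
  fix x assume x: "x \<in> bdry n u"
  then have xc: "x \<in> carrier (V n)" using sub_carrier bd_closed by (fastforce simp: bdry_def)
  show "x \<in> cyc n u" unfolding cyc_iff[OF xc]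
  proof (intro ballI impI)
    fix j assume j: "j \<in> act n" "\<phi> n j x \<noteq> \<zero>"
    then have dj: "d j = n" "t j \<le> ereal u" using x unfolding bdry_iff[OF xc] by auto
    have "ereal (s j) < t j" using bar_bounds[of j] j by (simp add: active_def)
    then have "ereal (s j) \<le> ereal u" using dj by (meson less_le_trans less_imp_le)
    then show "d j = n \<and> s j \<le> u" using dj by simp
  qed
qed

lemma submodule_\<phi>:
  "submodule F {x \<in> carrier (V n). \<forall>j\<in>act n. \<phi> n j x \<noteq> \<zero> \<longrightarrow> P j} (V n)"
proof -
  interpret V: coordinate_space F "V n" by (rule cs)
  show ?thesis
    by unfold_locales
      (auto simp: \<phi>_zero linfun_add[OF linfun_\<phi>] linfun_smult[OF linfun_\<phi>], (metis l_zero \<phi>_closed)+)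
qed

abbreviation hom_at :: "nat \<Rightarrow> real \<Rightarrow> ('f, 'v) module" where
  "hom_at n u \<equiv> quot ((V n)\<lparr>carrier := cyc n u\<rparr>) (bdry n u)"

text \<open>\<open>cls\<close> uses only the addition of its space, so a change of carrier does not
  affect the chosen representatives.\<close>

lemma phomology_eq:
  "pobj (phomology n (filtered_complex F C B f)) u = hom_at n u"
  "pmap (phomology n (filtered_complex F C B f)) u v x = cls ((V n)\<lparr>carrier := cyc n v\<rparr>) (bdry n v) x"
  by (simp_all add: phomology_def homology_def filtered_complex_def cycles_def boundaries_def cyc_def bdry_def cls_def)

lemma cyc_carrier: "cyc n u \<subseteq> carrier (V n)" using sub_carrier by (auto simp: cyc_def)

lemma cyc_set: "cyc n u = {x \<in> carrier (V n). \<forall>j\<in>act n. \<phi> n j x \<noteq> \<zero> \<longrightarrow> d j = n \<and> s j \<le> u}"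
  using cyc_iff cyc_carrier by blast

lemma bdry_set: "bdry n u = {x \<in> carrier (V n). \<forall>j\<in>act n. \<phi> n j x \<noteq> \<zero> \<longrightarrow> d j = n \<and> t j \<le> ereal u}"
  using bdry_iff bdry_cyc cyc_carrier by blast

lemma cyc_cs: "coordinate_space F ((V n)\<lparr>carrier := cyc n u\<rparr>)"
proof -
  interpret V: coordinate_space F "V n" by (rule cs)
  have "Module.module F ((V n)\<lparr>carrier := cyc n u\<rparr>)"
    unfolding cyc_set by (rule V.submodule_is_module[OF submodule_\<phi>])
  then show ?thesis by (simp add: coordinate_space_def vectorspace_def field_axioms)
qed

lemma bdry_submodule: "submodule F (bdry n u) ((V n)\<lparr>carrier := cyc n u\<rparr>)"
proof -
  interpret Z: coordinate_space F "(V n)\<lparr>carrier := cyc n u\<rparr>" by (rule cyc_cs)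
  have *: "submodule F (bdry n u) (V n)" unfolding bdry_set by (rule submodule_\<phi>)
  show ?thesis
    using submodule.m_closed[OF *] submodule.zero_closed[OF *] submodule.smult_closed[OF *] bdry_cyc
    by unfold_locales auto
qed

lemma hom_at_cs: "coordinate_space F (hom_at n u)"
  by (rule coordinate_space.quot_coordinate_space[OF cyc_cs bdry_submodule])

text \<open>Representatives of one class may differ in the coordinates of bars that are dead at time
  \<open>u\<close>. Truncation to living bars makes the coordinate a function of the class
  (\<open>coord_hcls\<close>).\<close>

definition coord :: "nat \<Rightarrow> real \<Rightarrow> 'j \<Rightarrow> 'v \<Rightarrow> 'f" where
  "coord n u j x = (if s j \<le> u \<and> ereal u < t j then \<phi> n j x else \<zero>)"

abbreviation hcls :: "nat \<Rightarrow> real \<Rightarrow> 'v \<Rightarrow> 'v" where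
  "hcls n u \<equiv> cls ((V n)\<lparr>carrier := cyc n u\<rparr>) (bdry n u)"

lemma act_lower: "j \<in> J \<Longrightarrow> d j = n \<Longrightarrow> j \<in> act n" by (simp add: active_def)

lemma linfun_coord:
  assumes "j \<in> J" "d j = n"
  shows "linfun F ((V n)\<lparr>carrier := cyc n u\<rparr>) (coord n u j)"
  using linfun_\<phi>[OF act_lower[OF assms]] cyc_carrier[of n u]
  by (auto simp: linfun_def coord_def subset_iff)

lemma coord_bdry:
  assumes "j \<in> J" "d j = n" "x \<in> bdry n u"
  shows "coord n u j x = \<zero>"
  using act_lower[OF assms(1,2)] assms(3) unfolding bdry_set by (auto simp: coord_def)

lemma coord_hcls: "j \<in> J \<Longrightarrow> d j = n \<Longrightarrow> x \<in> cyc n u \<Longrightarrow> coord n u j (hcls n u x) = coord n u j x"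
  using coordinate_space.linfun_cls[OF cyc_cs bdry_submodule linfun_coord coord_bdry] by simp

lemma linfun_coord_hom: "j \<in> J \<Longrightarrow> d j = n \<Longrightarrow> linfun F (hom_at n u) (coord n u j)"
  using coordinate_space.linfun_quot[OF cyc_cs bdry_submodule linfun_coord coord_bdry] by blast

lemma hom_at_carrier: "carrier (hom_at n u) = hcls n u ` cyc n u"
  by (simp add: coordinate_space.quot_sel[OF cyc_cs])

lemma hom_at_sub: "carrier (hom_at n u) \<subseteq> cyc n u"
  using coordinate_space.cls_closed[OF cyc_cs bdry_submodule] by (auto simp: hom_at_carrier)

lemma coord_eqI:
  assumes x: "x \<in> carrier (hom_at n u)" and y: "y \<in> carrier (hom_at n u)"
    and eq: "\<And>j. j \<in> J \<Longrightarrow> d j = n \<Longrightarrow> coord n u j x = coord n u j y"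
  shows "x = y"
proof (rule coordinate_space.eq_of_linfuns[OF hom_at_cs, where J = "{j \<in> J. d j = n}" and \<theta> = "coord n u"])
  fix z assume z: "z \<in> carrier (hom_at n u)" and z0: "\<And>j. j \<in> {j \<in> J. d j = n} \<Longrightarrow> coord n u j z = \<zero>"
  obtain x where xz: "x \<in> cyc n u" "z = hcls n u x" using z by (auto simp: hom_at_carrier)
  have xc: "x \<in> carrier (V n)" using xz cyc_carrier by blast
  have "x \<in> bdry n u" unfolding bdry_iff[OF xc]
  proof (intro ballI impI)
    fix j assume j: "j \<in> act n" "\<phi> n j x \<noteq> \<zero>"
    then have dj: "d j = n" "s j \<le> u" using xz cyc_iff[OF xc] by auto
    then have "coord n u j x = \<zero>" using z0[of j] coord_hcls[of j n x u] xz j by (auto simp: active_def)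
    then show "d j = n \<and> t j \<le> ereal u" using j dj by (auto simp: coord_def split: if_splits)
  qed
  then have "hcls n u x = hcls n u \<zero>\<^bsub>V n\<^esub>"
    using coordinate_space.cls_eq_zero_iff[OF cyc_cs bdry_submodule, of x n u] xz by simp
  then show "z = \<zero>\<^bsub>hom_at n u\<^esub>" by (simp add: coordinate_space.quot_sel[OF cyc_cs] xz)
qed (use x y eq linfun_coord_hom in auto)

lemma coord_surj:
  assumes g: "\<And>j. j \<in> J \<Longrightarrow> d j = n \<Longrightarrow> g j \<in> carrier F"
    and g0: "\<And>j. j \<in> J \<Longrightarrow> d j = n \<Longrightarrow> \<not> (s j \<le> u \<and> ereal u < t j) \<Longrightarrow> g j = \<zero>"
  shows "\<exists>x\<in>carrier (hom_at n u). \<forall>j\<in>J. d j = n \<longrightarrow> coord n u j x = g j"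
proof -
  have "\<And>j. j \<in> act n \<Longrightarrow> (if d j = n then g j else \<zero>) \<in> carrier F" using g by (auto simp: active_def)
  from \<phi>_ex1[of n "\<lambda>j. if d j = n then g j else \<zero>", OF this] obtain x where xc: "x \<in> carrier (V n)"
    and x: "\<And>j. j \<in> act n \<Longrightarrow> \<phi> n j x = (if d j = n then g j else \<zero>)" by blast
  have xz: "x \<in> cyc n u" unfolding cyc_iff[OF xc]
  proof (intro ballI impI)
    fix j assume j: "j \<in> act n" "\<phi> n j x \<noteq> \<zero>"
    then have "d j = n" "g j \<noteq> \<zero>" using x[OF j(1)] by (auto split: if_splits)
    then show "d j = n \<and> s j \<le> u" using g0[of j] j by (auto simp: active_def)
  qed
  have "coord n u j (hcls n u x) = g j" if "j \<in> J" "d j = n" for j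
    using coord_hcls[OF that xz] x[OF act_lower[OF that]] g0[OF that] that by (auto simp: coord_def)
  then show ?thesis using xz by (auto simp: hom_at_carrier)
qed

text \<open>At each time the coordinates of the living bars are a full system of coordinates on
  homology. A chain keeps its coordinates under inclusion of sublevel complexes, so only the
  truncation changes with time.\<close>

theorem phomology_iso:
  "pmodule_iso F (phomology n (filtered_complex F C B f))
    (interval_sum F {j \<in> J. d j = n} s t)"
  unfolding pmodule_iso_def phomology_eq
proof (intro exI[of _ "\<lambda>u x. \<lambda>j\<in>{j \<in> J. d j = n}. coord n u j x"] conjI allI impI ballI)
  fix u :: real assume "0 \<le> u"
  let ?Jn = "{j \<in> J. d j = n}"
  let ?Q = "pobj (interval_sum F ?Jn s t) u"
  let ?\<eta> = "\<lambda>x. \<lambda>j\<in>?Jn. coord n u j x"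
  have Q: "carrier ?Q = (\<Pi>\<^sub>E j\<in>?Jn. if s j \<le> u \<and> ereal u < t j then carrier F else {\<zero>})"
    by (auto simp: pmodule_sum_def mod_sum_def interval_module_def line_def zero_space_def intro!: PiE_cong)
  have Q_add: "g \<oplus>\<^bsub>?Q\<^esub> h = (\<lambda>j\<in>?Jn. g j \<oplus> h j)" for g h
    by (auto simp: pmodule_sum_def mod_sum_def interval_module_def line_def zero_space_def)
  have Q_smult: "c \<odot>\<^bsub>?Q\<^esub> g = (\<lambda>j\<in>?Jn. c \<otimes> g j)" for c g
    by (auto simp: pmodule_sum_def mod_sum_def interval_module_def line_def zero_space_def)
  have cl: "coord n u j x \<in> carrier F" if "j \<in> J" "d j = n" "x \<in> carrier (hom_at n u)" for j x
    using linfun_closed[OF linfun_coord_hom[OF that(1,2)] that(3)] .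
  have \<eta>Q: "?\<eta> x \<in> carrier ?Q" if "x \<in> carrier (hom_at n u)" for x
    unfolding Q using cl[OF _ _ that] by auto (auto simp: coord_def)
  show "?\<eta> \<in> lin_hom F (hom_at n u) ?Q"
    unfolding lin_hom_def Q_add Q_smult
    using \<eta>Q linfun_add[OF linfun_coord_hom] linfun_smult[OF linfun_coord_hom]
    by (auto intro!: restrict_ext)
  show "bij_betw ?\<eta> (carrier (hom_at n u)) (carrier ?Q)"
    unfolding bij_betw_def
  proof
    show "inj_on ?\<eta> (carrier (hom_at n u))"
    proof (rule inj_onI)
      fix x y assume xy: "x \<in> carrier (hom_at n u)" "y \<in> carrier (hom_at n u)" and eq: "?\<eta> x = ?\<eta> y"
      have "coord n u j x = coord n u j y" if "j \<in> J" "d j = n" for j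
        using fun_cong[OF eq, of j] that by simp
      then show "x = y" by (rule coord_eqI[OF xy])
    qed
    show "?\<eta> ` carrier (hom_at n u) = carrier ?Q"
    proof
      show "?\<eta> ` carrier (hom_at n u) \<subseteq> carrier ?Q" using \<eta>Q by blast
      show "carrier ?Q \<subseteq> ?\<eta> ` carrier (hom_at n u)"
      proof
        fix g assume g: "g \<in> carrier ?Q"
        have "g j \<in> carrier F" if "j \<in> J" "d j = n" for j
          using g that unfolding Q by (auto simp: PiE_iff split: if_splits)
        moreover have "g j = \<zero>" if "j \<in> J" "d j = n" "\<not> (s j \<le> u \<and> ereal u < t j)" for j
          using g that unfolding Q PiE_iff by (auto split: if_splits)
        ultimately have "\<exists>x\<in>carrier (hom_at n u). \<forall>j\<in>J. d j = n \<longrightarrow> coord n u j x = g j"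
          by (rule coord_surj)
        then obtain x where x: "x \<in> carrier (hom_at n u)" "\<And>j. j \<in> J \<Longrightarrow> d j = n \<Longrightarrow> coord n u j x = g j"
          by blast
        have "g = ?\<eta> x"
          by (rule PiE_ext[OF g[unfolded Q] \<eta>Q[OF x(1), unfolded Q]]) (use x in auto)
        then show "g \<in> ?\<eta> ` carrier (hom_at n u)" using x(1) by blast
      qed
    qed
  qed
next
  fix u v :: real and x assume uv: "0 \<le> u \<and> u \<le> v" and x: "x \<in> carrier (hom_at n u)"
  have xz: "x \<in> cyc n u" using x hom_at_sub by blast
  have xc: "x \<in> carrier (V n)" using xz cyc_carrier by blast
  have xv: "x \<in> cyc n v" using xz uv unfolding cyc_iff[OF xc] by force
  \<comment> \<open>A bar alive at \<open>v\<close> is not dead at \<open>u\<close>; if it is not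
    yet born at \<open>u\<close>, a cycle of time \<open>u\<close> has coordinate 0 there.\<close>
  have "coord n v j (hcls n v x) = (if s j \<le> u \<and> ereal v < t j then coord n u j x else \<zero>)"
    if j: "j \<in> J" "d j = n" for j
  proof -
    have "ereal v < t j \<Longrightarrow> ereal u < t j" using uv by (meson ereal_less_eq(3) le_less_trans)
    moreover have "\<not> s j \<le> u \<Longrightarrow> \<phi> n j x = \<zero>" using xz act_lower[OF j] unfolding cyc_iff[OF xc] by blast
    ultimately show ?thesis using coord_hcls[OF j xv] uv by (auto simp: coord_def)
  qed
  then show "(\<lambda>j\<in>{j \<in> J. d j = n}. coord n v j (hcls n v x)) =
      pmap (interval_sum F {j \<in> J. d j = n} s t) u v
        (\<lambda>j\<in>{j \<in> J. d j = n}. coord n u j x)"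
    by (auto simp: pmodule_sum_def interval_module_def intro!: restrict_ext)
qed

end

section \<open>Uniqueness of barcodes\<close>

text \<open>For \<open>K\<close> inside \<open>J\<close>, the copy of F^K in F^J under extension by
  zero. The spaces and the images of structure maps in the sums below all have this form, so their
  dimensions are cardinalities.\<close>

definition supp_fun :: "('f, 'r) ring_scheme \<Rightarrow> 'j set \<Rightarrow> 'j set \<Rightarrow> ('j \<Rightarrow> 'f) set" where
  "supp_fun F J K = {g \<in> J \<rightarrow>\<^sub>E carrier F. \<forall>j\<in>J - K. g j = \<zero>\<^bsub>F\<^esub>}"

lemma supp_fun_eq_PiE:
  fixes F :: "('a, 'r) ring_scheme" and J :: "'b set"
  assumes "ring F"
  shows "supp_fun F J K = (\<Pi>\<^sub>E j\<in>J. if j \<in> K then carrier F else {\<zero>\<^bsub>F\<^esub>})"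
proof -
  interpret ring F by fact
  have 1: "g \<in> supp_fun F J K \<longleftrightarrow>
      (\<forall>i\<in>J. g i \<in> carrier F \<and> (i \<notin> K \<longrightarrow> g i = \<zero>\<^bsub>F\<^esub>)) \<and> g \<in> extensional J" for g
    unfolding supp_fun_def PiE_iff by blast
  have 2: "(g i \<in> carrier F \<and> (i \<notin> K \<longrightarrow> g i = \<zero>\<^bsub>F\<^esub>)) \<longleftrightarrow> g i \<in> (if i \<in> K then carrier F else {\<zero>\<^bsub>F\<^esub>})"
    for g :: "'b \<Rightarrow> 'a" and i by auto
  show ?thesis by (rule Set.set_eqI) (simp only: 1 2 PiE_iff)
qed

text \<open>The dimension of F^K is computed twice by \<open>dim_eq_card_dual\<close>: with the
  evaluations at \<open>K\<close>, and with the evaluations at \<open>K'\<close> after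
  \<psi>.\<close>

lemma card_eq_of_linear_bij:
  fixes \<psi> :: "('j \<Rightarrow> 'f) \<Rightarrow> ('k \<Rightarrow> 'f)"
  assumes F: "field F" and fin: "finite J" "finite J'" and K: "K \<subseteq> J" "K' \<subseteq> J'"
    and bij: "bij_betw \<psi> (supp_fun F J K) (supp_fun F J' K')"
    and add: "\<And>g h. g \<in> supp_fun F J K \<Longrightarrow> h \<in> supp_fun F J K \<Longrightarrow>
      \<psi> (\<lambda>j\<in>J. g j \<oplus>\<^bsub>F\<^esub> h j) = (\<lambda>j\<in>J'. \<psi> g j \<oplus>\<^bsub>F\<^esub> \<psi> h j)"
    and smult: "\<And>c g. c \<in> carrier F \<Longrightarrow> g \<in> supp_fun F J K \<Longrightarrow>
      \<psi> (\<lambda>j\<in>J. c \<otimes>\<^bsub>F\<^esub> g j) = (\<lambda>j\<in>J'. c \<otimes>\<^bsub>F\<^esub> \<psi> g j)"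
  shows "card K = card K'"
proof -
  interpret field F by (rule F)
  have "vectorspace F (func_space K)"
    unfolding vectorspace_def using func_space_is_module F by blast
  then interpret V: coordinate_space F "func_space K" by (simp add: coordinate_space_def)
  have VK: "carrier (func_space K) = K \<rightarrow>\<^sub>E carrier F" by (simp add: func_space_def)
  define emb where "emb g = (\<lambda>j\<in>J. if j \<in> K then g j else \<zero>\<^bsub>F\<^esub>)" for g :: "'j \<Rightarrow> 'f"
  have emb: "emb g \<in> supp_fun F J K" if "g \<in> K \<rightarrow>\<^sub>E carrier F" for g
    using that by (auto simp: emb_def supp_fun_def PiE_iff)
  have emb_restrict: "emb (restrict u K) = u" if "u \<in> supp_fun F J K" for u
    using that K by (auto simp: emb_def supp_fun_def PiE_iff extensional_def fun_eq_iff)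
  have restrict_emb: "restrict (emb g) K = g" if "g \<in> K \<rightarrow>\<^sub>E carrier F" for g
    using that K by (auto simp: emb_def PiE_iff extensional_def fun_eq_iff)
  have emb_add: "emb (g \<oplus>\<^bsub>func_space K\<^esub> h) = (\<lambda>j\<in>J. emb g j \<oplus>\<^bsub>F\<^esub> emb h j)" for g h
    by (auto simp: emb_def func_space_def fun_eq_iff)
  have emb_smult: "emb (c \<odot>\<^bsub>func_space K\<^esub> g) = (\<lambda>j\<in>J. c \<otimes>\<^bsub>F\<^esub> emb g j)" if "c \<in> carrier F" for c g
    using that by (auto simp: emb_def func_space_def fun_eq_iff)
  have \<psi>c: "\<psi> u \<in> supp_fun F J' K'" if "u \<in> supp_fun F J K" for u using bij that by (auto simp: bij_betw_def)
  have finK: "finite K" "finite K'" using K fin by (auto intro: finite_subset)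
  have "V.dim = card K"
  proof (rule V.dim_eq_card_dual[where \<theta> = "\<lambda>j g. g j"])
    show "linfun F (func_space K) (\<lambda>g. g j)" if "j \<in> K" for j
      using that by (auto simp: linfun_def func_space_def)
    show "\<exists>!x. x \<in> carrier (func_space K) \<and> (\<forall>j\<in>K. x j = g j)" if "\<And>j. j \<in> K \<Longrightarrow> g j \<in> carrier F" for g
      using that unfolding VK
      by (intro ex1I[of _ "restrict g K"]) (auto intro: PiE_ext)
  qed (rule finK)
  moreover have "V.dim = card K'"
  proof (rule V.dim_eq_card_dual[where \<theta> = "\<lambda>j g. \<psi> (emb g) j"])
    show "linfun F (func_space K) (\<lambda>g. \<psi> (emb g) j)" if j: "j \<in> K'" for j
    proof -
      have "\<psi> (emb g) j \<in> carrier F" if "g \<in> K \<rightarrow>\<^sub>E carrier F" for g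
        using \<psi>c[OF emb[OF that]] j K by (auto simp: supp_fun_def)
      moreover have "j \<in> J'" using j K by blast
      ultimately show ?thesis
        unfolding linfun_def VK by (auto simp: emb_add emb_smult add[OF emb emb] smult[OF _ emb])
    qed
    show "\<exists>!x. x \<in> carrier (func_space K) \<and> (\<forall>j\<in>K'. \<psi> (emb x) j = g j)"
      if g: "\<And>j. j \<in> K' \<Longrightarrow> g j \<in> carrier F" for g
    proof -
      define h where "h = (\<lambda>j\<in>J'. if j \<in> K' then g j else \<zero>\<^bsub>F\<^esub>)"
      have h: "h \<in> supp_fun F J' K'" using g by (auto simp: h_def supp_fun_def)
      then have "h \<in> \<psi> ` supp_fun F J K" by (simp only: bij_betw_imp_surj_on[OF bij])
      then obtain u where u: "u \<in> supp_fun F J K" "\<psi> u = h" by (rule imageE) simp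
      have iff: "(\<forall>j\<in>K'. \<psi> (emb x) j = g j) \<longleftrightarrow> x = restrict u K" if x: "x \<in> K \<rightarrow>\<^sub>E carrier F" for x
      proof
        assume *: "\<forall>j\<in>K'. \<psi> (emb x) j = g j"
        have m: "\<psi> (emb x) \<in> supp_fun F J' K'" by (rule \<psi>c[OF emb[OF x]])
        have "\<psi> (emb x) = h"
        proof (rule PiE_ext)
          show "\<psi> (emb x) \<in> J' \<rightarrow>\<^sub>E carrier F" "h \<in> J' \<rightarrow>\<^sub>E carrier F"
            using m h by (simp_all add: supp_fun_def)
          show "\<psi> (emb x) j = h j" if "j \<in> J'" for j
            using that * m by (cases "j \<in> K'") (simp_all add: h_def supp_fun_def)
        qed
        then have "emb x = u" using bij u emb[OF x] by (metis bij_betw_def inj_onD)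
        then show "x = restrict u K" using restrict_emb[OF x] by simp
      next
        assume "x = restrict u K"
        then show "\<forall>j\<in>K'. \<psi> (emb x) j = g j" using emb_restrict[OF u(1)] u(2) K by (auto simp: h_def)
      qed
      have "restrict u K \<in> K \<rightarrow>\<^sub>E carrier F" using u K by (auto simp: supp_fun_def)
      then show ?thesis unfolding VK
        by - (rule ex1I[of _ "restrict u K"], auto simp only: iff)
    qed
  qed (rule finK)
  ultimately show ?thesis by simp
qed

text \<open>With \<open>p\<close> and \<open>p'\<close> as structure maps, this shows that a natural
  isomorphism matches their images, which makes ranks invariants.\<close>

lemma bij_betw_image_natural:
  assumes h: "bij_betw h A A'" and h2: "inj_on h2 D" and p: "p ` A \<subseteq> D"
    and nat: "\<And>x. x \<in> A \<Longrightarrow> h2 (p x) = p' (h x)"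
  shows "bij_betw h2 (p ` A) (p' ` A')"
proof -
  have "h2 ` p ` A = p' ` h ` A" using nat by (auto simp: image_iff)
  then show ?thesis using h inj_on_subset[OF h2 p] by (simp add: bij_betw_def)
qed

section \<open>Ranks of structure maps in sums of intervals\<close>

lemma interval_sum_sel:
  assumes "ring F"
  shows "carrier (pobj (interval_sum F J s t) u)
      = supp_fun F J {j \<in> J. s j \<le> u \<and> ereal u < t j}"
    "g \<oplus>\<^bsub>pobj (interval_sum F J s t) u\<^esub> h = (\<lambda>j\<in>J. g j \<oplus>\<^bsub>F\<^esub> h j)"
    "c \<odot>\<^bsub>pobj (interval_sum F J s t) u\<^esub> g = (\<lambda>j\<in>J. c \<otimes>\<^bsub>F\<^esub> g j)"
    "pmap (interval_sum F J s t) u v g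
      = (\<lambda>j\<in>J. if s j \<le> u \<and> ereal v < t j then g j else \<zero>\<^bsub>F\<^esub>)"
  unfolding supp_fun_eq_PiE[OF assms]
  by (auto simp: pmodule_sum_def mod_sum_def interval_module_def line_def zero_space_def intro!: PiE_cong restrict_ext)

text \<open>Internal maps and differentials of the sums act by setting coordinates outside some
  \<open>L\<close> to zero, so images of coordinate subspaces are again coordinate
  subspaces.\<close>

lemma supp_fun_truncate:
  assumes "ring F"
  shows "(\<lambda>g. \<lambda>j\<in>J. if j \<in> L then g j else \<zero>\<^bsub>F\<^esub>) ` supp_fun F J K = supp_fun F J (K \<inter> L)"
proof
  interpret ring F by fact
  show "(\<lambda>g. \<lambda>j\<in>J. if j \<in> L then g j else \<zero>\<^bsub>F\<^esub>) ` supp_fun F J K \<subseteq> supp_fun F J (K \<inter> L)"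
    by (auto simp: supp_fun_def PiE_iff split: if_splits)
  show "supp_fun F J (K \<inter> L) \<subseteq> (\<lambda>g. \<lambda>j\<in>J. if j \<in> L then g j else \<zero>\<^bsub>F\<^esub>) ` supp_fun F J K"
  proof
    fix g assume g: "g \<in> supp_fun F J (K \<inter> L)"
    then have "g = (\<lambda>j\<in>J. if j \<in> L then g j else \<zero>\<^bsub>F\<^esub>)"
      by (auto simp: supp_fun_def fun_eq_iff PiE_iff extensional_def)
    moreover have "g \<in> supp_fun F J K" using g by (auto simp: supp_fun_def)
    ultimately show "g \<in> (\<lambda>g. \<lambda>j\<in>J. if j \<in> L then g j else \<zero>\<^bsub>F\<^esub>) ` supp_fun F J K" by blast
  qed
qed

text \<open>The image of the internal map from \<open>u\<close> to \<open>v\<close> has one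
  dimension for each interval containing both times.\<close>

lemma interval_sum_rank:
  assumes F: "field F" and fin: "finite J" "finite J'"
    and iso: "pmodule_iso F (interval_sum F J s t)
      (interval_sum F J' s' t')"
    and uv: "0 \<le> u" "u \<le> v"
  shows "card {j \<in> J. s j \<le> u \<and> ereal v < t j} = card {j \<in> J'. s' j \<le> u \<and> ereal v < t' j}"
proof -
  interpret field F by (rule F)
  note sel = interval_sum_sel[OF ring_axioms]
  let ?P = "interval_sum F J s t"
  let ?Q = "interval_sum F J' s' t'"
  obtain \<eta> where \<eta>: "\<And>w. 0 \<le> w \<Longrightarrow> \<eta> w \<in> lin_hom F (pobj ?P w) (pobj ?Q w) \<and>
        bij_betw (\<eta> w) (carrier (pobj ?P w)) (carrier (pobj ?Q w))"
    and nat: "\<And>w z x. 0 \<le> w \<and> w \<le> z \<Longrightarrow> x \<in> carrier (pobj ?P w) \<Longrightarrow> \<eta> z (pmap ?P w z x) = pmap ?Q w z (\<eta> w x)"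
    using iso unfolding pmodule_iso_def by blast
  have v0: "0 \<le> v" using uv by simp
  have im: "pmap (interval_sum F I a b) u v `
      carrier (pobj (interval_sum F I a b) u)
      = supp_fun F I {j \<in> I. a j \<le> u \<and> ereal v < b j}" for I :: "'i set" and a b
  proof -
    have "pmap (interval_sum F I a b) u v
        = (\<lambda>g. \<lambda>j\<in>I. if j \<in> {j. a j \<le> u \<and> ereal v < b j} then g j else \<zero>\<^bsub>F\<^esub>)"
      by (simp add: sel fun_eq_iff)
    moreover have "{j \<in> I. a j \<le> u \<and> ereal u < b j} \<inter> {j. a j \<le> u \<and> ereal v < b j} = {j \<in> I. a j \<le> u \<and> ereal v < b j}"
      using uv by (auto intro: le_less_trans[of "ereal u" "ereal v"])
    ultimately show ?thesis by (simp only: sel(1) supp_fun_truncate[OF ring_axioms])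
  qed
  let ?K = "{j \<in> J. s j \<le> u \<and> ereal v < t j}" and ?K' = "{j \<in> J'. s' j \<le> u \<and> ereal v < t' j}"
  have sub: "supp_fun F J ?K \<subseteq> carrier (pobj ?P v)"
    using uv by (auto simp: sel supp_fun_def)
  have "bij_betw (\<eta> v) (pmap ?P u v ` carrier (pobj ?P u)) (pmap ?Q u v ` carrier (pobj ?Q u))"
  proof (rule bij_betw_image_natural)
    show "bij_betw (\<eta> u) (carrier (pobj ?P u)) (carrier (pobj ?Q u))" using \<eta> uv by blast
    show "inj_on (\<eta> v) (carrier (pobj ?P v))" using \<eta>[OF v0] by (simp add: bij_betw_def)
    show "pmap ?P u v ` carrier (pobj ?P u) \<subseteq> carrier (pobj ?P v)" unfolding im by (rule sub)
    show "\<eta> v (pmap ?P u v x) = pmap ?Q u v (\<eta> u x)" if "x \<in> carrier (pobj ?P u)" for x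
      using nat uv that by blast
  qed
  then have bij: "bij_betw (\<eta> v) (supp_fun F J ?K) (supp_fun F J' ?K')" unfolding im .
  have hom: "\<eta> v \<in> lin_hom F (pobj ?P v) (pobj ?Q v)" using \<eta>[OF v0] by blast
  show ?thesis
    using card_eq_of_linear_bij[OF F fin _ _ bij] lin_hom_add[OF hom]
      lin_hom_smult[OF hom] sub unfolding sel by blast
qed

text \<open>The multiplicity of \<open>[x, y)\<close> is an alternating sum of four ranks, with
  thresholds at \<open>x\<close> and \<open>y\<close> and slightly below them.\<close>

lemma interval_sum_unique:
  assumes F: "field F" and fin: "finite J" "finite J'"
    and iso: "pmodule_iso F (interval_sum F J s t)
      (interval_sum F J' s' t')"
    and b: "\<forall>j\<in>J. 0 \<le> s j \<and> ereal (s j) < t j" and b': "\<forall>j\<in>J'. 0 \<le> s' j \<and> ereal (s' j) < t' j"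
  shows "card {j \<in> J. s j = x \<and> t j = y} = card {j \<in> J'. s' j = x \<and> t' j = y}"
proof (cases "0 \<le> x \<and> ereal x < y")
  case False
  then have "{j \<in> J. s j = x \<and> t j = y} = {}" "{j \<in> J'. s' j = x \<and> t' j = y} = {}" using b b' by auto
  then show ?thesis by (simp only: card.empty)
next
  case True
  note rank = interval_sum_rank[OF F fin iso]
  have "finite (s ` J \<union> s' ` J')" "finite (t ` J \<union> t' ` J')" using fin by auto
  from real_gap_below[OF this(1), of x] ereal_gap_below[OF this(2), of x y] True
  obtain c e where c: "c < x" "\<forall>z\<in>s ` J \<union> s' ` J'. c < z \<longrightarrow> x \<le> z"
    and e: "x \<le> e" "ereal e < y" "\<forall>z\<in>t ` J \<union> t' ` J'. ereal e < z \<longrightarrow> y \<le> z" by blast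
  \<comment> \<open>The threshold below \<open>x\<close> may be negative, where the functor has no
    values; but no interval starts there.\<close>
  have known: "card {j \<in> J. s j \<le> w \<and> ereal v < t j} = card {j \<in> J'. s' j \<le> w \<and> ereal v < t' j}"
    if "w \<le> v" "0 \<le> v" for w v
  proof (cases "0 \<le> w")
    case True
    then show ?thesis using rank that by blast
  next
    case False
    then have "{j \<in> J. s j \<le> w \<and> ereal v < t j} = {}" "{j \<in> J'. s' j \<le> w \<and> ereal v < t' j} = {}"
      using b b' by force+
    then show ?thesis by (simp only: card.empty)
  qed
  \<comment> \<open>For \<open>y = \<infinity>\<close> no end exceeds \<open>y\<close>, and both
    counts are 0.\<close>
  have known2: "card {j \<in> J. s j \<le> w \<and> y < t j} = card {j \<in> J'. s' j \<le> w \<and> y < t' j}" if "w \<le> x" for w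
  proof (cases y)
    case (real r)
    then show ?thesis using known[of w r] that True by simp
  qed (use True in auto)
  show ?thesis
  proof (rule card_eq_of_quadrants[OF fin, where ?p1.0 = "\<lambda>z. z \<le> x" and ?p2.0 = "\<lambda>z. z \<le> c"
        and ?q1.0 = "\<lambda>z. ereal e < z" and ?q2.0 = "\<lambda>z. y < z"])
    show "card {j \<in> J. p (s j) \<and> q (t j)} = card {j \<in> J'. p (s' j) \<and> q (t' j)}"
      if "p \<in> {\<lambda>z. z \<le> x, \<lambda>z. z \<le> c}" "q \<in> {\<lambda>z. ereal e < z, \<lambda>z. y < z}" for p q
      using that known[of x e] known[of c e] known2[of x] known2[of c] c(1) e(1) True by auto
    show "(z \<le> c \<longrightarrow> z \<le> x) \<and> (z = x \<longleftrightarrow> z \<le> x \<and> \<not> z \<le> c)" if "z \<in> s ` J \<union> s' ` J'" for z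
      using c that by force
    show "(y < z \<longrightarrow> ereal e < z) \<and> (z = y \<longleftrightarrow> ereal e < z \<and> \<not> y < z)" if "z \<in> t ` J \<union> t' ` J'" for z
      using e that by (metis less_trans linorder_not_less order_antisym)
  qed
qed

section \<open>Composition, inversion and reindexing of isomorphisms\<close>

lemma module_hom_comp:
  "g \<in> lin_hom F U V \<Longrightarrow> h \<in> lin_hom F V W \<Longrightarrow>
    (\<lambda>x. h (g x)) \<in> lin_hom F U W"
  by (auto simp: lin_hom_def Pi_def)

lemma pmodule_iso_trans:
  assumes "pmodule_iso F P Q" "pmodule_iso F Q R"
  shows "pmodule_iso F P R"
proof -
  obtain \<eta> where 1: "\<And>t. 0 \<le> t \<Longrightarrow> \<eta> t \<in> lin_hom F (pobj P t) (pobj Q t)"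
      "\<And>t. 0 \<le> t \<Longrightarrow> bij_betw (\<eta> t) (carrier (pobj P t)) (carrier (pobj Q t))"
      "\<And>s t x. 0 \<le> s \<and> s \<le> t \<Longrightarrow> x\<in>carrier (pobj P s) \<Longrightarrow> \<eta> t (pmap P s t x) = pmap Q s t (\<eta> s x)"
    using assms(1) unfolding pmodule_iso_def by blast
  obtain \<zeta> where 2: "\<And>t. 0 \<le> t \<Longrightarrow> \<zeta> t \<in> lin_hom F (pobj Q t) (pobj R t)"
      "\<And>t. 0 \<le> t \<Longrightarrow> bij_betw (\<zeta> t) (carrier (pobj Q t)) (carrier (pobj R t))"
      "\<And>s t x. 0 \<le> s \<and> s \<le> t \<Longrightarrow> x\<in>carrier (pobj Q s) \<Longrightarrow> \<zeta> t (pmap Q s t x) = pmap R s t (\<zeta> s x)"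
    using assms(2) unfolding pmodule_iso_def by blast
  show ?thesis
    unfolding pmodule_iso_def
  proof (intro exI[of _ "\<lambda>t x. \<zeta> t (\<eta> t x)"] conjI allI impI ballI)
    show "(\<lambda>x. \<zeta> t (\<eta> t x)) \<in> lin_hom F (pobj P t) (pobj R t)" if "0 \<le> t" for t
      using module_hom_comp 1(1) 2(1) that by blast
    show "bij_betw (\<lambda>x. \<zeta> t (\<eta> t x)) (carrier (pobj P t)) (carrier (pobj R t))" if "0 \<le> t" for t
      using bij_betw_trans[OF 1(2) 2(2)] that by (simp add: comp_def)
    show "\<zeta> t (\<eta> t (pmap P s t x)) = pmap R s t (\<zeta> s (\<eta> s x))"
      if "0 \<le> s \<and> s \<le> t" "x \<in> carrier (pobj P s)" for s t x
      using 1(3)[OF that] 2(3)[OF that(1)] bij_betwE[OF 1(2)] that by auto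
  qed
qed

text \<open>Linearity and naturality of the inverse follow by cancelling \<eta>, for which sums,
  multiples and internal maps must stay in the carriers of \<open>P\<close>; \<open>cs\<close> and
  \<open>pm\<close> provide this.\<close>

lemma pmodule_iso_sym:
  assumes iso: "pmodule_iso F P Q"
    and cs: "\<And>t. 0 \<le> t \<Longrightarrow> coordinate_space F (pobj P t)"
    and pm: "\<And>s t x. 0 \<le> s \<Longrightarrow> s \<le> t \<Longrightarrow> x \<in> carrier (pobj P s) \<Longrightarrow> pmap P s t x \<in> carrier (pobj P t)"
  shows "pmodule_iso F Q P"
proof -
  obtain \<eta> where \<eta>: "\<And>t. 0 \<le> t \<Longrightarrow> \<eta> t \<in> lin_hom F (pobj P t) (pobj Q t)"
    and bij: "\<And>t. 0 \<le> t \<Longrightarrow> bij_betw (\<eta> t) (carrier (pobj P t)) (carrier (pobj Q t))"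
    and nat: "\<And>s t x. 0 \<le> s \<and> s \<le> t \<Longrightarrow> x\<in>carrier (pobj P s) \<Longrightarrow> \<eta> t (pmap P s t x) = pmap Q s t (\<eta> s x)"
    using iso unfolding pmodule_iso_def by blast
  define \<zeta> where "\<zeta> t = inv_into (carrier (pobj P t)) (\<eta> t)" for t
  have bij': "bij_betw (\<zeta> t) (carrier (pobj Q t)) (carrier (pobj P t))" if "0 \<le> t" for t
    unfolding \<zeta>_def by (rule bij_betw_inv_into[OF bij[OF that]])
  have z1: "\<zeta> t (\<eta> t x) = x" if "0 \<le> t" "x \<in> carrier (pobj P t)" for t x
    using bij[OF that(1)] that(2) by (simp add: \<zeta>_def bij_betw_def)
  have z2: "\<zeta> t y \<in> carrier (pobj P t)" "\<eta> t (\<zeta> t y) = y" if "0 \<le> t" "y \<in> carrier (pobj Q t)" for t y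
    using bij_betwE[OF bij'[OF that(1)]] that bij[OF that(1)] by (auto simp: \<zeta>_def bij_betw_def f_inv_into_f)
  show ?thesis
    unfolding pmodule_iso_def
  proof (intro exI[of _ \<zeta>] conjI allI impI ballI)
    fix t :: real assume t: "0 \<le> t"
    interpret V: coordinate_space F "pobj P t" by (rule cs[OF t])
    show "bij_betw (\<zeta> t) (carrier (pobj Q t)) (carrier (pobj P t))" by (rule bij'[OF t])
    have "\<zeta> t (x \<oplus>\<^bsub>pobj Q t\<^esub> y) = \<zeta> t x \<oplus>\<^bsub>pobj P t\<^esub> \<zeta> t y"
      if "x \<in> carrier (pobj Q t)" "y \<in> carrier (pobj Q t)" for x y
      using z1[OF t, of "\<zeta> t x \<oplus>\<^bsub>pobj P t\<^esub> \<zeta> t y"] z2[OF t that(1)] z2[OF t that(2)]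
        lin_hom_add[OF \<eta>[OF t], of "\<zeta> t x" "\<zeta> t y"] by simp
    moreover have "\<zeta> t (c \<odot>\<^bsub>pobj Q t\<^esub> y) = c \<odot>\<^bsub>pobj P t\<^esub> \<zeta> t y"
      if "c \<in> carrier F" "y \<in> carrier (pobj Q t)" for c y
      using z1[OF t, of "c \<odot>\<^bsub>pobj P t\<^esub> \<zeta> t y"] z2[OF t that(2)] that(1)
        lin_hom_smult[OF \<eta>[OF t], of c "\<zeta> t y"] by simp
    ultimately show "\<zeta> t \<in> lin_hom F (pobj Q t) (pobj P t)"
      using z2(1)[OF t] by (auto simp: lin_hom_def)
  next
    fix s t :: real and y assume st: "0 \<le> s \<and> s \<le> t" and y: "y \<in> carrier (pobj Q s)"
    have s: "0 \<le> s" and t: "0 \<le> t" using st by auto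
    have "pmap Q s t y = \<eta> t (pmap P s t (\<zeta> s y))"
      using nat[OF st z2(1)[OF s y]] z2(2)[OF s y] by simp
    then show "\<zeta> t (pmap Q s t y) = pmap P s t (\<zeta> s y)"
      using z1[OF t] pm[OF s _ z2(1)[OF s y]] st by simp
  qed
qed

definition reindex :: "'j set \<Rightarrow> ('j \<Rightarrow> 'k) \<Rightarrow> 'k set \<Rightarrow> ('j \<Rightarrow> 'a) \<Rightarrow> 'k \<Rightarrow> 'a" where
  "reindex J h J' g = (\<lambda>k\<in>J'. g (inv_into J h k))"

lemma mod_sum_reindex:
  assumes h: "bij_betw h J J'" and V: "\<And>j. j \<in> J \<Longrightarrow> V' (h j) = V j"
  shows "reindex J h J' \<in> lin_hom F (mod_sum J V) (mod_sum J' V')"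
    and "bij_betw (reindex J h J') (carrier (mod_sum J V)) (carrier (mod_sum J' V'))"
proof -
  have inv: "inv_into J h k \<in> J" "h (inv_into J h k) = k" if "k \<in> J'" for k
    using h that by (auto simp: bij_betw_def inv_into_into f_inv_into_f)
  have inv2: "inv_into J h (h j) = j" "h j \<in> J'" if "j \<in> J" for j using h that by (auto simp: bij_betw_def)
  have V': "V (inv_into J h k) = V' k" if "k \<in> J'" for k using V[OF inv(1)[OF that]] inv(2)[OF that] by simp
  have cl: "reindex J h J' g \<in> carrier (mod_sum J' V')" if "g \<in> carrier (mod_sum J V)" for g
    using that inv V' by (fastforce simp: mod_sum_def reindex_def PiE_iff)
  then show "reindex J h J' \<in> lin_hom F (mod_sum J V) (mod_sum J' V')"
    using inv V' by (auto simp: lin_hom_def mod_sum_def reindex_def intro!: restrict_ext)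
  show "bij_betw (reindex J h J') (carrier (mod_sum J V)) (carrier (mod_sum J' V'))"
  proof (rule bij_betwI[where g = "\<lambda>g. \<lambda>j\<in>J. g (h j)"])
    show "reindex J h J' \<in> carrier (mod_sum J V) \<rightarrow> carrier (mod_sum J' V')" using cl by blast
    show "(\<lambda>g. \<lambda>j\<in>J. g (h j)) \<in> carrier (mod_sum J' V') \<rightarrow> carrier (mod_sum J V)"
      using inv2 V by (fastforce simp: mod_sum_def PiE_iff)
    show "(\<lambda>j\<in>J. reindex J h J' x (h j)) = x" if "x \<in> carrier (mod_sum J V)" for x
      using that inv2 by (auto simp: mod_sum_def reindex_def PiE_iff extensional_def fun_eq_iff)
    show "reindex J h J' (\<lambda>j\<in>J. y (h j)) = y" if "y \<in> carrier (mod_sum J' V')" for y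
      using that inv by (auto simp: mod_sum_def reindex_def PiE_iff extensional_def fun_eq_iff)
  qed
qed

lemma pmodule_sum_reindex:
  assumes h: "bij_betw h J J'" and P: "\<And>j. j \<in> J \<Longrightarrow> P' (h j) = P j"
  shows "pmodule_iso F (pmodule_sum J P) (pmodule_sum J' P')"
  unfolding pmodule_iso_def
proof (intro exI[of _ "\<lambda>_. reindex J h J'"] conjI allI impI ballI)
  have inv: "inv_into J h k \<in> J" "h (inv_into J h k) = k" if "k \<in> J'" for k
    using h that by (auto simp: bij_betw_def inv_into_into f_inv_into_f)
  have P': "P (inv_into J h k) = P' k" if "k \<in> J'" for k using P[OF inv(1)[OF that]] inv(2)[OF that] by simp
  show "reindex J h J' \<in> lin_hom F (pobj (pmodule_sum J P) t) (pobj (pmodule_sum J' P') t)" for t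
    unfolding pmodule_sum_def pmodule.select_convs using P by (intro mod_sum_reindex h) auto
  show "bij_betw (reindex J h J') (carrier (pobj (pmodule_sum J P) t)) (carrier (pobj (pmodule_sum J' P') t))" for t
    unfolding pmodule_sum_def pmodule.select_convs using P by (intro mod_sum_reindex h) auto
  show "reindex J h J' (pmap (pmodule_sum J P) s t x) = pmap (pmodule_sum J' P') s t (reindex J h J' x)" for s t x
    using inv P' by (auto simp: pmodule_sum_def reindex_def intro!: restrict_ext)
qed

lemma pcomplex_sum_reindex:
  assumes h: "bij_betw h J J'" and P: "\<And>j. j \<in> J \<Longrightarrow> P' (h j) = P j"
  shows "pcomplex_iso F (pcomplex_sum J P) (pcomplex_sum J' P')"
  unfolding pcomplex_iso_def
proof (intro exI[of _ "\<lambda>_ _. reindex J h J'"] conjI allI impI ballI)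
  have inv: "inv_into J h k \<in> J" "h (inv_into J h k) = k" if "k \<in> J'" for k
    using h that by (auto simp: bij_betw_def inv_into_into f_inv_into_f)
  have P': "P (inv_into J h k) = P' k" if "k \<in> J'" for k using P[OF inv(1)[OF that]] inv(2)[OF that] by simp
  show "reindex J h J' \<in> lin_hom F
      (grade (cobj (pcomplex_sum J P) t) k) (grade (cobj (pcomplex_sum J' P') t) k)" for t k
    unfolding pcomplex_sum_def complex_sum_def pcomplex.select_convs complex_data.select_convs
    using P by (intro mod_sum_reindex h) auto
  show "bij_betw (reindex J h J') (carrier (grade (cobj (pcomplex_sum J P) t) k))
      (carrier (grade (cobj (pcomplex_sum J' P') t) k))" for t k
    unfolding pcomplex_sum_def complex_sum_def pcomplex.select_convs complex_data.select_convs
    using P by (intro mod_sum_reindex h) auto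
  show "reindex J h J' (bd (cobj (pcomplex_sum J P) t) (Suc k) x) =
      bd (cobj (pcomplex_sum J' P') t) (Suc k) (reindex J h J' x)" for t k x
    using inv P' by (auto simp: pcomplex_sum_def complex_sum_def reindex_def intro!: restrict_ext)
  show "reindex J h J' (cmap (pcomplex_sum J P) s t k x) = cmap (pcomplex_sum J' P') s t k (reindex J h J' x)" for s t k x
    using inv P' by (auto simp: pcomplex_sum_def reindex_def intro!: restrict_ext)
qed

section \<open>Uniqueness of tagged barcodes\<close>

text \<open>The summands that are non-zero in degree \<open>k\<close> at time \<open>u\<close>. The
  first clause covers both phases, disk and sphere, because \<open>s \<le> t\<close>.\<close>

definition alive :: "'j set \<Rightarrow> ('j \<Rightarrow> nat) \<Rightarrow> ('j \<Rightarrow> ereal) \<Rightarrow> ('j \<Rightarrow> ereal) \<Rightarrow> nat \<Rightarrow> real \<Rightarrow> 'j set" where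
  "alive J n s t k u = {j \<in> J. (k = n j \<and> ereal u < t j) \<or> (Suc k = n j \<and> ereal u < s j)}"

abbreviation sphere_sum ::
    "('f, 'r) ring_scheme \<Rightarrow> 'j set \<Rightarrow> ('j \<Rightarrow> nat) \<Rightarrow> ('j \<Rightarrow> ereal) \<Rightarrow> ('j \<Rightarrow> ereal) \<Rightarrow> ('f, 'j \<Rightarrow> 'f) pcomplex" where
  "sphere_sum F J n s t \<equiv> pcomplex_sum J (\<lambda>j. interval_sphere F (n j) (s j, t j))"

lemma sphere_sum_sel:
  assumes F: "ring F" and st: "\<forall>j\<in>J. s j \<le> t j"
  shows "carrier (grade (cobj (sphere_sum F J n s t) u) k) = supp_fun F J (alive J n s t k u)"
    "g \<oplus>\<^bsub>grade (cobj (sphere_sum F J n s t) u) k\<^esub> h = (\<lambda>j\<in>J. g j \<oplus>\<^bsub>F\<^esub> h j)"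
    "c \<odot>\<^bsub>grade (cobj (sphere_sum F J n s t) u) k\<^esub> g = (\<lambda>j\<in>J. c \<otimes>\<^bsub>F\<^esub> g j)"
    "bd (cobj (sphere_sum F J n s t) u) k g = (\<lambda>j\<in>J. if j \<in> {j. k = n j \<and> ereal u < s j} then g j else \<zero>\<^bsub>F\<^esub>)"
    "cmap (sphere_sum F J n s t) u v k g = (\<lambda>j\<in>J. if j \<in> alive J n s t k v then g j else \<zero>\<^bsub>F\<^esub>)"
proof -
  have 1: "grade (cobj (interval_sphere F (n j) (s j, t j)) u) k =
      (if (k = n j \<and> ereal u < t j) \<or> (Suc k = n j \<and> ereal u < s j) then line F else zero_space F)"
    if "j \<in> J" for j
    using less_le_trans[OF _ bspec[OF st that], of "ereal u"]
    by (auto simp: interval_sphere_def disk_def sphere_def zero_complex_def)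
  have 2: "bd (cobj (interval_sphere F (n j) (s j, t j)) u) k v = (if k = n j \<and> ereal u < s j then v else \<zero>\<^bsub>F\<^esub>)"
    for j v
    by (auto simp: interval_sphere_def disk_def sphere_def zero_complex_def)
  show "carrier (grade (cobj (sphere_sum F J n s t) u) k) = supp_fun F J (alive J n s t k u)"
    unfolding supp_fun_eq_PiE[OF F]
    by (auto simp: pcomplex_sum_def complex_sum_def mod_sum_def 1 alive_def intro!: PiE_cong)
      (auto simp: line_def zero_space_def)
  show "g \<oplus>\<^bsub>grade (cobj (sphere_sum F J n s t) u) k\<^esub> h = (\<lambda>j\<in>J. g j \<oplus>\<^bsub>F\<^esub> h j)"
    by (auto simp: pcomplex_sum_def complex_sum_def mod_sum_def 1 line_def zero_space_def intro!: restrict_ext)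
  show "c \<odot>\<^bsub>grade (cobj (sphere_sum F J n s t) u) k\<^esub> g = (\<lambda>j\<in>J. c \<otimes>\<^bsub>F\<^esub> g j)"
    by (auto simp: pcomplex_sum_def complex_sum_def mod_sum_def 1 line_def zero_space_def intro!: restrict_ext)
  show "bd (cobj (sphere_sum F J n s t) u) k g = (\<lambda>j\<in>J. if j \<in> {j. k = n j \<and> ereal u < s j} then g j else \<zero>\<^bsub>F\<^esub>)"
    by (auto simp: pcomplex_sum_def complex_sum_def 2 intro!: restrict_ext)
  show "cmap (sphere_sum F J n s t) u v k g = (\<lambda>j\<in>J. if j \<in> alive J n s t k v then g j else \<zero>\<^bsub>F\<^esub>)"
    by (auto simp: pcomplex_sum_def interval_sphere_def alive_def intro!: restrict_ext)
qed

definition dying :: "('f, 'r) ring_scheme \<Rightarrow> 'j set \<Rightarrow> ('f, 'j \<Rightarrow> 'f) pcomplex \<Rightarrow> nat \<Rightarrow> real \<Rightarrow> ('j \<Rightarrow> 'f) set" where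
  "dying F J P k y = {g \<in> carrier (grade (cobj P 0) k). cmap P 0 y k g = (\<lambda>j\<in>J. \<zero>\<^bsub>F\<^esub>)}"

text \<open>
  The marginals of \<open>s\<close> and \<open>t\<close> do not determine a multiset of tagged intervals; their joint
  distribution is read off from the boundaries, alive at time \<open>x\<close>, of chains that vanish at time \<open>y\<close>.
\<close>

lemma sphere_sum_images:
  assumes F: "ring F" and st: "\<forall>j\<in>J. 0 < t j \<and> 0 \<le> s j \<and> s j \<le> t j" and x: "0 \<le> x"
  shows "bd (cobj (sphere_sum F J n s t) u) (Suc k) ` carrier (grade (cobj (sphere_sum F J n s t) u) (Suc k))
      = supp_fun F J {j \<in> J. n j = Suc k \<and> ereal u < s j}"
    "(\<lambda>g. cmap (sphere_sum F J n s t) 0 x k (bd (cobj (sphere_sum F J n s t) 0) (Suc k) g)) `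
        dying F J (sphere_sum F J n s t) (Suc k) y
      = supp_fun F J {j \<in> J. n j = Suc k \<and> ereal x < s j \<and> t j \<le> ereal y}"
proof -
  interpret ring F by (rule F)
  have le: "\<forall>j\<in>J. s j \<le> t j" using st by blast
  note sel = sphere_sum_sel[OF F le]
  have "alive J n s t (Suc k) u \<inter> {j. Suc k = n j \<and> ereal u < s j} = {j \<in> J. n j = Suc k \<and> ereal u < s j}"
    using le less_le_trans[of "ereal u"] by (fastforce simp: alive_def)
  then show "bd (cobj (sphere_sum F J n s t) u) (Suc k) ` carrier (grade (cobj (sphere_sum F J n s t) u) (Suc k))
      = supp_fun F J {j \<in> J. n j = Suc k \<and> ereal u < s j}"
    unfolding sel(1) sel(4)[abs_def] supp_fun_truncate[OF F] by simp
  have dy: "dying F J (sphere_sum F J n s t) (Suc k) y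
      = supp_fun F J (alive J n s t (Suc k) 0 - alive J n s t (Suc k) y)"
  proof -
    have "(\<lambda>j\<in>J. if j \<in> alive J n s t (Suc k) y then g j else \<zero>\<^bsub>F\<^esub>) = (\<lambda>j\<in>J. \<zero>\<^bsub>F\<^esub>) \<longleftrightarrow>
        (\<forall>j\<in>J. j \<in> alive J n s t (Suc k) y \<longrightarrow> g j = \<zero>\<^bsub>F\<^esub>)" for g
      by (auto simp: fun_eq_iff restrict_def)
    then show ?thesis unfolding dying_def sel by (auto simp: supp_fun_def)
  qed
  have eq: "(alive J n s t (Suc k) 0 - alive J n s t (Suc k) y) \<inter> {j. Suc k = n j \<and> ereal 0 < s j} \<inter> alive J n s t k x
      = {j \<in> J. n j = Suc k \<and> ereal x < s j \<and> t j \<le> ereal y}"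
    using st le_less_trans[of "ereal 0" "ereal x"] x by (fastforce simp: alive_def zero_ereal_def not_less)
  show "(\<lambda>g. cmap (sphere_sum F J n s t) 0 x k (bd (cobj (sphere_sum F J n s t) 0) (Suc k) g)) `
        dying F J (sphere_sum F J n s t) (Suc k) y
      = supp_fun F J {j \<in> J. n j = Suc k \<and> ereal x < s j \<and> t j \<le> ereal y}"
  proof -
    have "bd (cobj (sphere_sum F J n s t) 0) (Suc k) ` dying F J (sphere_sum F J n s t) (Suc k) y =
        supp_fun F J ((alive J n s t (Suc k) 0 - alive J n s t (Suc k) y) \<inter> {j. Suc k = n j \<and> ereal 0 < s j})"
      unfolding dy sel(4)[abs_def] by (rule supp_fun_truncate[OF F])
    moreover have "cmap (sphere_sum F J n s t) 0 x k ` supp_fun F J Z = supp_fun F J (Z \<inter> alive J n s t k x)" for Z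
      unfolding sel(5)[abs_def] by (rule supp_fun_truncate[OF F])
    ultimately show ?thesis unfolding image_image[symmetric] eq[symmetric] by (simp only:)
  qed
qed

text \<open>\<eta> commutes with differentials and internal maps, so it matches the whole spaces and
  also the subspaces in \<open>sphere_sum_images\<close>; each count is the dimension of one of
  these.\<close>

lemma sphere_sum_ranks:
  assumes F: "field F" and fin: "finite J" "finite J'"
    and st: "\<forall>j\<in>J. 0 < t j \<and> 0 \<le> s j \<and> s j \<le> t j" and st': "\<forall>j\<in>J'. 0 < t' j \<and> 0 \<le> s' j \<and> s' j \<le> t' j"
    and iso: "pcomplex_iso F (sphere_sum F J n s t) (sphere_sum F J' n' s' t')"
    and x: "0 \<le> x" and y: "0 \<le> y"
  shows "card (alive J n s t k x) = card (alive J' n' s' t' k x)"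
    and "card {j \<in> J. n j = Suc k \<and> ereal x < s j} = card {j \<in> J'. n' j = Suc k \<and> ereal x < s' j}"
    and "card {j \<in> J. n j = Suc k \<and> ereal x < s j \<and> t j \<le> ereal y} =
      card {j \<in> J'. n' j = Suc k \<and> ereal x < s' j \<and> t' j \<le> ereal y}"
proof -
  interpret field F by (rule F)
  let ?P = "sphere_sum F J n s t" and ?Q = "sphere_sum F J' n' s' t'"
  have le: "\<forall>j\<in>J. s j \<le> t j" "\<forall>j\<in>J'. s' j \<le> t' j" using st st' by blast+
  note selP = sphere_sum_sel[OF ring_axioms le(1)] and selQ = sphere_sum_sel[OF ring_axioms le(2)]
  note imP = sphere_sum_images[OF ring_axioms st] and imQ = sphere_sum_images[OF ring_axioms st']
  obtain \<eta> where \<eta>: "(\<forall>u\<ge>0. \<forall>k.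
      \<eta> u k \<in> lin_hom F (grade (cobj ?P u) k) (grade (cobj ?Q u) k) \<and>
      bij_betw (\<eta> u k) (carrier (grade (cobj ?P u) k)) (carrier (grade (cobj ?Q u) k))) \<and>
    (\<forall>u\<ge>0. \<forall>k. \<forall>g\<in>carrier (grade (cobj ?P u) (Suc k)).
      \<eta> u k (bd (cobj ?P u) (Suc k) g) = bd (cobj ?Q u) (Suc k) (\<eta> u (Suc k) g)) \<and>
    (\<forall>u v. 0 \<le> u \<and> u \<le> v \<longrightarrow> (\<forall>k. \<forall>g\<in>carrier (grade (cobj ?P u) k).
      \<eta> v k (cmap ?P u v k g) = cmap ?Q u v k (\<eta> u k g)))"
    using iso[unfolded pcomplex_iso_def] by (rule exE)
  note hom = conjunct1[OF \<eta>, rule_format, THEN conjunct1]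
    and bij = conjunct1[OF \<eta>, rule_format, THEN conjunct2]
    and ch = conjunct2[OF \<eta>, THEN conjunct1, rule_format]
    and nat = conjunct2[OF \<eta>, THEN conjunct2, rule_format]
  have cardI: "card K = card K'"
    if u: "0 \<le> u" and K: "K \<subseteq> alive J n s t k u" "K' \<subseteq> J'"
      and b: "bij_betw (\<eta> u k) (supp_fun F J K) (supp_fun F J' K')" for u k K K'
  proof -
    have sub: "supp_fun F J K \<subseteq> carrier (grade (cobj ?P u) k)" unfolding selP(1) using K by (auto simp: supp_fun_def)
    have KJ: "K \<subseteq> J" using K by (auto simp: alive_def)
    show ?thesis
    proof (rule card_eq_of_linear_bij[OF F fin KJ K(2) b])
      fix g h assume "g \<in> supp_fun F J K" "h \<in> supp_fun F J K"
      then show "\<eta> u k (\<lambda>j\<in>J. g j \<oplus>\<^bsub>F\<^esub> h j) = (\<lambda>j\<in>J'. \<eta> u k g j \<oplus>\<^bsub>F\<^esub> \<eta> u k h j)"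
        using lin_hom_add[OF hom[OF u, of k], of g h] sub unfolding selP(2) selQ(2) by blast
    next
      fix c g assume "c \<in> carrier F" "g \<in> supp_fun F J K"
      then show "\<eta> u k (\<lambda>j\<in>J. c \<otimes>\<^bsub>F\<^esub> g j) = (\<lambda>j\<in>J'. c \<otimes>\<^bsub>F\<^esub> \<eta> u k g j)"
        using lin_hom_smult[OF hom[OF u, of k], of c g] sub unfolding selP(3) selQ(3) by blast
    qed
  qed
  have inj: "inj_on (\<eta> u k) (carrier (grade (cobj ?P u) k))" if "0 \<le> u" for u k
    using bij[OF that, of k] by (simp add: bij_betw_def)
  have aliveJ: "alive J' n' s' t' k u \<subseteq> J'" for k u by (auto simp: alive_def)
  show "card (alive J n s t k x) = card (alive J' n' s' t' k x)"
    by (rule cardI[OF x subset_refl aliveJ]) (use bij[OF x, of k] in \<open>simp only: selP selQ\<close>)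
  have supp_mono: "supp_fun F J K \<subseteq> carrier (grade (cobj ?P u) k)" if "K \<subseteq> alive J n s t k u" for K u k
    unfolding selP(1) using that by (auto simp: supp_fun_def)
  show "card {j \<in> J. n j = Suc k \<and> ereal x < s j} = card {j \<in> J'. n' j = Suc k \<and> ereal x < s' j}"
  proof (rule cardI[OF x])
    show sub: "{j \<in> J. n j = Suc k \<and> ereal x < s j} \<subseteq> alive J n s t k x" by (auto simp: alive_def)
    have "bij_betw (\<eta> x k) (bd (cobj ?P x) (Suc k) ` carrier (grade (cobj ?P x) (Suc k)))
        (bd (cobj ?Q x) (Suc k) ` carrier (grade (cobj ?Q x) (Suc k)))"
    proof (rule bij_betw_image_natural[OF bij[OF x] inj[OF x]])
      show "bd (cobj ?P x) (Suc k) ` carrier (grade (cobj ?P x) (Suc k)) \<subseteq> carrier (grade (cobj ?P x) k)"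
        unfolding imP(1)[OF x] by (rule supp_mono[OF sub])
    qed (rule ch[OF x])
    then show "bij_betw (\<eta> x k) (supp_fun F J {j \<in> J. n j = Suc k \<and> ereal x < s j})
        (supp_fun F J' {j \<in> J'. n' j = Suc k \<and> ereal x < s' j})"
      unfolding imP(1)[OF x] imQ(1)[OF x] .
  qed auto
  have zP: "(\<lambda>j\<in>J. \<zero>\<^bsub>F\<^esub>) \<in> carrier (grade (cobj ?P u) k)" for u k unfolding selP(1) by (auto simp: supp_fun_def)
  \<comment> \<open>A homomorphism is only required to respect sums and scalar multiples, so zero is
    written as a multiple by the scalar 0.\<close>
  have \<eta>0: "\<eta> u k (\<lambda>j\<in>J. \<zero>\<^bsub>F\<^esub>) = (\<lambda>j\<in>J'. \<zero>\<^bsub>F\<^esub>)" if u: "0 \<le> u" for u k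
  proof -
    have "\<eta> u k (\<lambda>j\<in>J. \<zero>\<^bsub>F\<^esub>) \<in> carrier (grade (cobj ?Q u) k)" using bij_betwE[OF bij[OF u]] zP by blast
    then have c: "\<eta> u k (\<lambda>j\<in>J. \<zero>\<^bsub>F\<^esub>) j \<in> carrier F" if "j \<in> J'" for j
      using that unfolding selQ(1) by (auto simp: supp_fun_def)
    have "\<eta> u k (\<zero>\<^bsub>F\<^esub> \<odot>\<^bsub>grade (cobj ?P u) k\<^esub> (\<lambda>j\<in>J. \<zero>\<^bsub>F\<^esub>)) = \<zero>\<^bsub>F\<^esub> \<odot>\<^bsub>grade (cobj ?Q u) k\<^esub> \<eta> u k (\<lambda>j\<in>J. \<zero>\<^bsub>F\<^esub>)"
      by (rule lin_hom_smult[OF hom[OF u] zero_closed zP])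
    moreover have "(\<lambda>j\<in>J. \<zero>\<^bsub>F\<^esub> \<otimes>\<^bsub>F\<^esub> (\<lambda>j\<in>J. \<zero>\<^bsub>F\<^esub>) j) = (\<lambda>j\<in>J. \<zero>\<^bsub>F\<^esub>)" by (auto intro!: restrict_ext)
    moreover have "(\<lambda>j\<in>J'. \<zero>\<^bsub>F\<^esub> \<otimes>\<^bsub>F\<^esub> \<eta> u k (\<lambda>j\<in>J. \<zero>\<^bsub>F\<^esub>) j) = (\<lambda>j\<in>J'. \<zero>\<^bsub>F\<^esub>)"
      using c by (auto intro!: restrict_ext)
    ultimately show ?thesis unfolding selP(3) selQ(3) by simp
  qed
  \<comment> \<open>Kernels of internal maps correspond under \<eta>: vanishing is compared at time
    \<open>y\<close>, where \<eta> is injective.\<close>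
  have dying_bij: "bij_betw (\<eta> 0 k) (dying F J ?P k y) (dying F J' ?Q k y)" for k
  proof -
    have cm: "cmap ?P 0 y k g \<in> carrier (grade (cobj ?P y) k)" if "g \<in> carrier (grade (cobj ?P 0) k)" for g
      using that unfolding selP(1,5) by (auto simp: supp_fun_def)
    have mem: "g \<in> dying F J ?P k y \<longleftrightarrow> \<eta> 0 k g \<in> dying F J' ?Q k y" if g: "g \<in> carrier (grade (cobj ?P 0) k)" for g
    proof -
      have "cmap ?P 0 y k g = (\<lambda>j\<in>J. \<zero>\<^bsub>F\<^esub>) \<longleftrightarrow> \<eta> y k (cmap ?P 0 y k g) = \<eta> y k (\<lambda>j\<in>J. \<zero>\<^bsub>F\<^esub>)"
        using inj_on_eq_iff[OF inj[OF y] cm[OF g] zP] by simp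
      also have "\<dots> \<longleftrightarrow> cmap ?Q 0 y k (\<eta> 0 k g) = (\<lambda>j\<in>J'. \<zero>\<^bsub>F\<^esub>)"
        using nat[of 0 y g k] g y \<eta>0[OF y] by simp
      finally show ?thesis using g bij_betwE[OF bij[of 0 k]] by (simp add: dying_def)
    qed
    have "\<eta> 0 k ` dying F J ?P k y = dying F J' ?Q k y"
    proof
      show "\<eta> 0 k ` dying F J ?P k y \<subseteq> dying F J' ?Q k y" using mem by (auto simp: dying_def)
      show "dying F J' ?Q k y \<subseteq> \<eta> 0 k ` dying F J ?P k y"
      proof
        fix h assume h: "h \<in> dying F J' ?Q k y"
        then have "h \<in> \<eta> 0 k ` carrier (grade (cobj ?P 0) k)"
          using bij_betw_imp_surj_on[OF bij[of 0 k]] by (simp add: dying_def)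
        then obtain g where "g \<in> carrier (grade (cobj ?P 0) k)" "h = \<eta> 0 k g" by blast
        then show "h \<in> \<eta> 0 k ` dying F J ?P k y" using mem h by blast
      qed
    qed
    moreover have "inj_on (\<eta> 0 k) (dying F J ?P k y)"
      by (rule inj_on_subset[OF inj[of 0 k]]) (auto simp: dying_def)
    ultimately show ?thesis by (simp add: bij_betw_def)
  qed
  show "card {j \<in> J. n j = Suc k \<and> ereal x < s j \<and> t j \<le> ereal y} =
      card {j \<in> J'. n' j = Suc k \<and> ereal x < s' j \<and> t' j \<le> ereal y}"
  proof (rule cardI[OF x])
    show sub: "{j \<in> J. n j = Suc k \<and> ereal x < s j \<and> t j \<le> ereal y} \<subseteq> alive J n s t k x" by (auto simp: alive_def)
    have "bij_betw (\<eta> x k) ((\<lambda>g. cmap ?P 0 x k (bd (cobj ?P 0) (Suc k) g)) ` dying F J ?P (Suc k) y)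
        ((\<lambda>g. cmap ?Q 0 x k (bd (cobj ?Q 0) (Suc k) g)) ` dying F J' ?Q (Suc k) y)"
    proof (rule bij_betw_image_natural[OF dying_bij inj[OF x]])
      show "(\<lambda>g. cmap ?P 0 x k (bd (cobj ?P 0) (Suc k) g)) ` dying F J ?P (Suc k) y \<subseteq> carrier (grade (cobj ?P x) k)"
        unfolding imP(2)[OF x] by (rule supp_mono[OF sub])
      fix g assume "g \<in> dying F J ?P (Suc k) y"
      then have g: "g \<in> carrier (grade (cobj ?P 0) (Suc k))" by (simp add: dying_def)
      have "bd (cobj ?P 0) (Suc k) g \<in> carrier (grade (cobj ?P 0) k)"
      proof -
        have "bd (cobj ?P 0) (Suc k) g \<in> supp_fun F J {j \<in> J. n j = Suc k \<and> ereal 0 < s j}"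
          unfolding imP(1)[OF x, symmetric] using g by (rule imageI)
        moreover have "{j \<in> J. n j = Suc k \<and> ereal 0 < s j} \<subseteq> alive J n s t k 0" by (auto simp: alive_def)
        ultimately show ?thesis using supp_mono by blast
      qed
      then show "\<eta> x k (cmap ?P 0 x k (bd (cobj ?P 0) (Suc k) g)) =
          cmap ?Q 0 x k (bd (cobj ?Q 0) (Suc k) (\<eta> 0 (Suc k) g))"
        using nat[of 0 x "bd (cobj ?P 0) (Suc k) g" k] ch[of 0 g k] g x by simp
    qed
    then show "bij_betw (\<eta> x k) (supp_fun F J {j \<in> J. n j = Suc k \<and> ereal x < s j \<and> t j \<le> ereal y})
        (supp_fun F J' {j \<in> J'. n' j = Suc k \<and> ereal x < s' j \<and> t' j \<le> ereal y})"
      unfolding imP(2)[OF x] imQ(2)[OF x] .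
  qed auto
qed

text \<open>Differences of the three kinds of ranks give the counts of tags in quadrants
  \<open>s > v\<close> and \<open>t > u\<close>; inclusion-exclusion over four quadrants isolates
  one tag.\<close>

lemma sphere_sum_unique:
  assumes F: "field F" and fin: "finite J" "finite J'"
    and st: "\<forall>j\<in>J. 0 < t j \<and> 0 \<le> s j \<and> s j \<le> t j \<and> (n j = 0 \<longrightarrow> s j = 0)"
    and st': "\<forall>j\<in>J'. 0 < t' j \<and> 0 \<le> s' j \<and> s' j \<le> t' j \<and> (n' j = 0 \<longrightarrow> s' j = 0)"
    and iso: "pcomplex_iso F (sphere_sum F J n s t) (sphere_sum F J' n' s' t')"
  shows "card {j \<in> J. n j = k \<and> s j = a \<and> t j = b} = card {j \<in> J'. n' j = k \<and> s' j = a \<and> t' j = b}"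
proof (cases "0 \<le> a \<and> 0 < b")
  case False
  then have "{j \<in> J. n j = k \<and> s j = a \<and> t j = b} = {}" "{j \<in> J'. n' j = k \<and> s' j = a \<and> t' j = b} = {}"
    using st st' by auto
  then show ?thesis by (simp only: card.empty)
next
  case True
  have st1: "\<forall>j\<in>J. 0 < t j \<and> 0 \<le> s j \<and> s j \<le> t j" and st1': "\<forall>j\<in>J'. 0 < t' j \<and> 0 \<le> s' j \<and> s' j \<le> t' j"
    using st st' by blast+
  note ranks = sphere_sum_ranks[OF F fin st1 st1' iso]
  let ?J = "{j \<in> J. n j = k}" and ?J' = "{j \<in> J'. n' j = k}"
  have finJ: "finite ?J" "finite ?J'" using fin by auto
  \<comment> \<open>The dimension in degree \<open>k\<close> also counts the lower halves of disks
    of degree \<open>k + 1\<close>; the rank of the differential removes them.\<close>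
  have all: "card {j \<in> ?J. ereal u < t j} = card {j \<in> ?J'. ereal u < t' j}" if u: "0 \<le> u" for u
  proof -
    have alive_card: "card (alive I m v w k u) = card {j \<in> I. m j = k \<and> ereal u < w j} + card {j \<in> I. m j = Suc k \<and> ereal u < v j}"
      if "finite I" for I :: "'i set" and m v w
    proof -
      have "alive I m v w k u = {j \<in> I. m j = k \<and> ereal u < w j} \<union> {j \<in> I. m j = Suc k \<and> ereal u < v j}"
        by (auto simp: alive_def)
      then show ?thesis using that by (simp add: card_Un_disjoint disjoint_iff)
    qed
    show ?thesis
      using ranks(1)[OF u u, of k] ranks(2)[OF u u, of k]
        alive_card[OF fin(1), of n s t]
        alive_card[OF fin(2), of n' s' t'] by simp
  qed
  have both: "card {j \<in> ?J. ereal v < s j \<and> ereal u < t j} = card {j \<in> ?J'. ereal v < s' j \<and> ereal u < t' j}"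
    if u: "0 \<le> u" and v: "0 \<le> v" for u v
  proof (cases k)
    \<comment> \<open>In degree 0 every tag has \<open>s = 0\<close>, so both sets are
      empty.\<close>
    case 0
    then have "{j \<in> ?J. ereal v < s j \<and> ereal u < t j} = {}" "{j \<in> ?J'. ereal v < s' j \<and> ereal u < t' j} = {}"
      using st st' v by (auto simp: zero_ereal_def)
    then show ?thesis by (simp only: card.empty)
  next
    case (Suc k')
    have diff: "card {j \<in> I. m j = Suc k' \<and> ereal v < p j \<and> ereal u < w j} =
        card {j \<in> I. m j = Suc k' \<and> ereal v < p j} - card {j \<in> I. m j = Suc k' \<and> ereal v < p j \<and> w j \<le> ereal u}"
      if "finite I" for I :: "'i set" and m p w
    proof -
      have "{j \<in> I. m j = Suc k' \<and> ereal v < p j \<and> ereal u < w j} =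
          {j \<in> I. (m j = Suc k' \<and> ereal v < p j) \<and> \<not> (m j = Suc k' \<and> ereal v < p j \<and> w j \<le> ereal u)}"
        by auto
      then show ?thesis using card_diff_pred[OF that, of "\<lambda>j. m j = Suc k' \<and> ereal v < p j \<and> w j \<le> ereal u"
          "\<lambda>j. m j = Suc k' \<and> ereal v < p j"] by simp
    qed
    show ?thesis
      using ranks(2)[OF v u, of k'] ranks(3)[OF v u, of k'] Suc
        diff[OF fin(1), of n s t]
        diff[OF fin(2), of n' s' t'] by simp
  qed
  have finv: "finite (s ` J \<union> s' ` J')" "finite (t ` J \<union> t' ` J')" using fin by auto
  \<comment> \<open>The counts cover non-negative thresholds only. For \<open>a = 0\<close> there is
    none strictly below \<open>a\<close>, but then \<open>0 \<le> s\<close> makes the lower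
    condition vacuous.\<close>
  have "\<exists>p1. (p1 = (\<lambda>z. True) \<or> (\<exists>e\<ge>0. p1 = (\<lambda>z. ereal e < z))) \<and>
      (\<forall>z\<in>s ` J \<union> s' ` J'. (a < z \<longrightarrow> p1 z) \<and> (z = a \<longleftrightarrow> p1 z \<and> \<not> a < z))"
  proof (cases "a = 0")
    case a0: True
    have "(a < z \<longrightarrow> True) \<and> (z = a \<longleftrightarrow> True \<and> \<not> a < z)" if "z \<in> s ` J \<union> s' ` J'" for z
    proof -
      have "0 \<le> z" using that st st' by auto
      then show ?thesis using a0 by auto
    qed
    then show ?thesis by (intro exI[of _ "\<lambda>z. True"]) simp
  next
    case False
    then have "ereal 0 < a" using \<open>0 \<le> a \<and> 0 < b\<close> by (simp add: zero_ereal_def[symmetric] less_le)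
    from ereal_gap_below[OF finv(1) this] obtain e where e: "0 \<le> e" "ereal e < a"
      "\<forall>z\<in>s ` J \<union> s' ` J'. ereal e < z \<longrightarrow> a \<le> z" by blast
    have "(a < z \<longrightarrow> ereal e < z) \<and> (z = a \<longleftrightarrow> ereal e < z \<and> \<not> a < z)" if "z \<in> s ` J \<union> s' ` J'" for z
      using e(2) bspec[OF e(3) that] by auto
    then show ?thesis using e(1) by (intro exI[of _ "\<lambda>z. ereal e < z"]) blast
  qed
  then obtain p1 where p1: "p1 = (\<lambda>z. True) \<or> (\<exists>e\<ge>0. p1 = (\<lambda>z. ereal e < z))"
    and p1z: "\<forall>z\<in>s ` J \<union> s' ` J'. (a < z \<longrightarrow> p1 z) \<and> (z = a \<longleftrightarrow> p1 z \<and> \<not> a < z)"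
    by (elim exE conjE)
  have "ereal 0 < b" using True by (simp add: zero_ereal_def)
  from ereal_gap_below[OF finv(2) this] obtain e where e: "0 \<le> e" "ereal e < b"
    "\<forall>z\<in>t ` J \<union> t' ` J'. ereal e < z \<longrightarrow> b \<le> z" by blast
  \<comment> \<open>For \<open>a = \<infinity>\<close> the condition \<open>a < z\<close> never
    holds.\<close>
  have p2: "(\<lambda>z. a < z) = (\<lambda>z. False) \<or> (\<exists>e\<ge>0. (\<lambda>z. a < z) = (\<lambda>z. ereal e < z))"
  proof (cases a)
    case (real r)
    then show ?thesis using True by (intro disjI2 exI[of _ r]) auto
  qed (use True in auto)
  have q2: "(\<lambda>z. b < z) = (\<lambda>z. False) \<or> (\<exists>e\<ge>0. (\<lambda>z. b < z) = (\<lambda>z. ereal e < z))"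
  proof (cases b)
    case (real r)
    then show ?thesis using True by (intro disjI2 exI[of _ r]) auto
  qed (use True in auto)
  have known: "card {j \<in> ?J. p (s j) \<and> q (t j)} = card {j \<in> ?J'. p (s' j) \<and> q (t' j)}"
    if p: "p = (\<lambda>z. True) \<or> p = (\<lambda>z. False) \<or> (\<exists>e\<ge>0. p = (\<lambda>z. ereal e < z))"
      and q: "q = (\<lambda>z. False) \<or> (\<exists>e\<ge>0. q = (\<lambda>z. ereal e < z))" for p q
    using p q
  proof (elim disjE exE conjE)
    fix e assume "0 \<le> e" "q = (\<lambda>z. ereal e < z)" "p = (\<lambda>z. True)"
    then show ?thesis using all[of e] by simp
  next
    fix e e' assume "0 \<le> e" "q = (\<lambda>z. ereal e < z)" "0 \<le> e'" "p = (\<lambda>z. ereal e' < z)"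
    then show ?thesis using both[of e e'] by simp
  qed auto
  have "card {j \<in> ?J. s j = a \<and> t j = b} = card {j \<in> ?J'. s' j = a \<and> t' j = b}"
  proof (rule card_eq_of_quadrants[OF finJ, where ?p1.0 = p1 and ?p2.0 = "\<lambda>z. a < z"
        and ?q1.0 = "\<lambda>z. ereal e < z" and ?q2.0 = "\<lambda>z. b < z"])
    show "card {j \<in> ?J. p (s j) \<and> q (t j)} = card {j \<in> ?J'. p (s' j) \<and> q (t' j)}"
      if "p \<in> {p1, \<lambda>z. a < z}" "q \<in> {\<lambda>z. ereal e < z, \<lambda>z. b < z}" for p q
      using that p1 p2 q2 e(1) by (intro known) blast+
    show "(a < z \<longrightarrow> p1 z) \<and> (z = a \<longleftrightarrow> p1 z \<and> \<not> a < z)" if "z \<in> s ` ?J \<union> s' ` ?J'" for z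
      using that by (intro bspec[OF p1z]) auto
    show "(b < z \<longrightarrow> ereal e < z) \<and> (z = b \<longleftrightarrow> ereal e < z \<and> \<not> b < z)" if "z \<in> t ` ?J \<union> t' ` ?J'" for z
    proof -
      have "z \<in> t ` J \<union> t' ` J'" using that by auto
      from bspec[OF e(3) this] show ?thesis using e(2) by auto
    qed
  qed
  then show ?thesis by (simp add: conj_assoc)
qed

section \<open>The bijection of barcodes\<close>

text \<open>The given sum is a barcode after renumbering. Any other barcode is compared with it
  through \<open>P\<close>, which requires inverting the given isomorphism.\<close>

lemma Bar_eq:
  fixes J :: "'j set"
  assumes F: "field F" and fin: "finite J" and b: "\<forall>j\<in>J. 0 \<le> s j \<and> ereal (s j) < t j"
    and iso: "pmodule_iso F P (interval_sum F J s t)"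
    and cs: "\<And>u. 0 \<le> u \<Longrightarrow> coordinate_space F (pobj P u)"
    and pm: "\<And>u v x. 0 \<le> u \<Longrightarrow> u \<le> v \<Longrightarrow> x \<in> carrier (pobj P u) \<Longrightarrow> pmap P u v x \<in> carrier (pobj P v)"
  shows "Bar F P = image_mset (\<lambda>j. (s j, t j)) (mset_set J)"
  unfolding Bar_def
proof (rule the_equality)
  let ?M = "image_mset (\<lambda>j. (s j, t j)) (mset_set J)"
  obtain h where h: "bij_betw h J {(I, i). i < count ?M I}" "\<forall>j\<in>J. fst (h j) = (s j, t j)"
    using finite_bij_count[OF fin refl] by blast
  have "pmodule_iso F (interval_sum F J s t)
      (pmodule_sum {(I, i). i < count ?M I} (\<lambda>(I, i). interval_module F I))"
    by (rule pmodule_sum_reindex[OF h(1)]) (use h(2) in \<open>simp add: case_prod_beta\<close>)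
  from pmodule_iso_trans[OF iso this] show "is_barcode F P ?M"
    using b fin by (auto simp: is_barcode_def)
  fix M assume M: "is_barcode F P M"
  let ?J' = "{(I, i). i < count M I}"
  have eq: "(\<lambda>(I, i). interval_module F I) = (\<lambda>j. interval_module F (fst (fst j), snd (fst j)))"
    by (rule ext) (simp add: case_prod_beta)
  have iso': "pmodule_iso F (interval_sum F J s t)
      (interval_sum F ?J' (\<lambda>j. fst (fst j)) (\<lambda>j. snd (fst j)))"
    using pmodule_iso_trans[OF pmodule_iso_sym[OF iso cs pm]] M unfolding is_barcode_def eq by blast
  have b': "\<forall>j\<in>?J'. 0 \<le> fst (fst j) \<and> ereal (fst (fst j)) < snd (fst j)"
  proof
    fix j assume j: "j \<in> ?J'"
    have "fst j \<in># M" using j by (cases j) (auto simp: count_greater_zero_iff[symmetric] simp del: count_greater_zero_iff)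
    then show "0 \<le> fst (fst j) \<and> ereal (fst (fst j)) < snd (fst j)"
      using M by (auto simp: is_barcode_def case_prod_beta)
  qed
  show "M = ?M"
  proof (rule multiset_eqI)
    fix I :: bar
    obtain x y where I: "I = (x, y)" by (cases I)
    have "{j \<in> ?J'. fst (fst j) = x \<and> snd (fst j) = y} = {j \<in> ?J'. fst j = I}"
      unfolding I by (simp add: prod_eq_iff)
    then have "count M I = card {j \<in> ?J'. fst (fst j) = x \<and> snd (fst j) = y}" by (simp only: card_copies)
    also have "\<dots> = card {j \<in> J. s j = x \<and> t j = y}"
      using interval_sum_unique[OF F fin finite_copies iso' b b'] by simp
    also have "\<dots> = count ?M I" using count_image_mset_set[OF fin, of "\<lambda>j. (s j, t j)" I] by (simp add: I)
    finally show "count M I = count ?M I" .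
  qed
qed

text \<open>The functor is itself a sum of interval spheres, so another tagged barcode is compared
  with it directly, without an inverse.\<close>

lemma tBar_eq:
  fixes J :: "'j set"
  assumes F: "field F" and fin: "finite J"
    and st: "\<forall>j\<in>J. 0 < t j \<and> 0 \<le> s j \<and> s j \<le> t j \<and> (n j = 0 \<longrightarrow> s j = 0)"
  shows "tBar F (sphere_sum F J n s t) = (\<lambda>k. image_mset (\<lambda>j. (s j, t j)) (mset_set {j \<in> J. n j = k}))"
  unfolding tBar_def
proof (rule the_equality)
  let ?M = "\<lambda>k. image_mset (\<lambda>j. (s j, t j)) (mset_set {j \<in> J. n j = k})"
  obtain h where h: "bij_betw h J (occurrences ?M)" "\<forall>j\<in>J. \<exists>i. h j = (n j, (s j, t j), i)"
    using occurrences_bij[OF fin, of ?M "\<lambda>j. (s j, t j)" n] by blast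
  have iso: "pcomplex_iso F (sphere_sum F J n s t)
      (pcomplex_sum (occurrences ?M) (\<lambda>(n, I, i). interval_sphere F n I))"
    by (rule pcomplex_sum_reindex[OF h(1)]) (use h(2) in force)
  have "{k. ?M k \<noteq> {#}} \<subseteq> n ` J" using fin by (auto simp: mset_set_empty_iff)
  then have "finite {k. ?M k \<noteq> {#}}" by (rule finite_subset) (use fin in simp)
  then show "is_tagged_barcode F (sphere_sum F J n s t) ?M"
    using st fin iso by (auto simp: is_tagged_barcode_def)
  fix M assume M: "is_tagged_barcode F (sphere_sum F J n s t) M"
  let ?J' = "occurrences M"
  have finJ': "finite ?J'" using M by (intro finite_occurrences) (simp add: is_tagged_barcode_def)
  have eq: "(\<lambda>(n, I, i). interval_sphere F n I) =
      (\<lambda>j. interval_sphere F (fst j) (fst (fst (snd j)), snd (fst (snd j))))"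
    by (rule ext) (simp add: case_prod_beta)
  have iso': "pcomplex_iso F (sphere_sum F J n s t)
      (sphere_sum F ?J' fst (\<lambda>j. fst (fst (snd j))) (\<lambda>j. snd (fst (snd j))))"
    using M unfolding is_tagged_barcode_def eq by blast
  have st': "\<forall>j\<in>?J'. 0 < snd (fst (snd j)) \<and> 0 \<le> fst (fst (snd j)) \<and> fst (fst (snd j)) \<le> snd (fst (snd j)) \<and>
      (fst j = 0 \<longrightarrow> fst (fst (snd j)) = 0)"
  proof
    fix j assume j: "j \<in> ?J'"
    have "fst (snd j) \<in># M (fst j)"
      using j by (auto simp: occurrences_def count_greater_zero_iff[symmetric] simp del: count_greater_zero_iff)
    then show "0 < snd (fst (snd j)) \<and> 0 \<le> fst (fst (snd j)) \<and> fst (fst (snd j)) \<le> snd (fst (snd j)) \<and>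
        (fst j = 0 \<longrightarrow> fst (fst (snd j)) = 0)"
      using M by (fastforce simp: is_tagged_barcode_def case_prod_beta)
  qed
  show "M = ?M"
  proof (rule ext, rule multiset_eqI)
    fix k and I :: tagged_interval
    obtain x y where I: "I = (x, y)" by (cases I)
    have "{j \<in> ?J'. fst j = k \<and> fst (fst (snd j)) = x \<and> snd (fst (snd j)) = y} =
        {j \<in> ?J'. fst j = k \<and> fst (snd j) = I}"
      unfolding I by (simp add: prod_eq_iff)
    then have "count (M k) I = card {j \<in> ?J'. fst j = k \<and> fst (fst (snd j)) = x \<and> snd (fst (snd j)) = y}"
      by (simp only: card_occurrences)
    also have "\<dots> = card {j \<in> J. n j = k \<and> s j = x \<and> t j = y}"
      using sphere_sum_unique[OF F fin finJ' st st' iso'] by simp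
    also have "\<dots> = count (?M k) I"
      using count_image_mset_set[of "{j \<in> J. n j = k}" "\<lambda>j. (s j, t j)" I] fin by (simp add: I conj_assoc)
    finally show "count (M k) I = count (?M k) I" .
  qed
qed

lemma (in split_complex) Bar_phomology:
  "Bar F (phomology n (filtered_complex F C B f)) = image_mset (\<lambda>j. (s j, t j)) (mset_set {j \<in> J. d j = n})"
proof (rule Bar_eq[OF _ _ _ phomology_iso])
  show "field F" by (rule field_axioms)
  show "finite {j \<in> J. d j = n}" using J_finite by simp
  show "coordinate_space F (pobj (phomology n (filtered_complex F C B f)) u)" for u
    unfolding phomology_eq by (rule hom_at_cs)
  fix u v :: real and x
  assume uv: "u \<le> v" and x: "x \<in> carrier (pobj (phomology n (filtered_complex F C B f)) u)"
  have xz: "x \<in> cyc n u" using x hom_at_sub unfolding phomology_eq by blast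
  then have xc: "x \<in> carrier (grade C n)" using cyc_carrier by blast
  have "x \<in> cyc n v" using xz uv unfolding cyc_iff[OF xc] by force
  then show "pmap (phomology n (filtered_complex F C B f)) u v x
      \<in> carrier (pobj (phomology n (filtered_complex F C B f)) v)"
    unfolding phomology_eq hom_at_carrier by (rule imageI)
qed (use bar_bounds in auto)

theorem theorem3p19:
  fixes F :: "('f, 'r) ring_scheme"
    and C :: "('f, 'v) complex_data"
    and B :: "nat \<Rightarrow> 'v set"
    and f :: "nat \<Rightarrow> 'v \<Rightarrow> real"
    and R :: "real \<Rightarrow> (nat \<times> 'v \<times> 'v) rel"
  assumes "field F"
    and "based_complex F C B"
    and "based_filter F C B f"
    and "orders_ties B (filter_weight f) R"
  shows "let bars = (\<lambda>n. Bar F (phomology n (filtered_complex F C B f)));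
             tbars = tBar F (Y_functor F \<lparr>cpx = C, bas = B, wt = filter_weight f, ties = R\<rparr>)
         in \<exists>\<Phi>. bij_betw \<Phi> (occurrences bars) (occurrences tbars) \<and>
              (\<forall>n s t i. (n, (s, t), i) \<in> occurrences bars \<longrightarrow>
                 (\<exists>j. \<Phi> (n, (s, t), i) =
                    (if t < \<infinity> then (Suc n, (t - ereal s, t - ereal s), j)
                     else (n, (0, \<infinity>), j))))"
proof -
  let ?D = "\<lparr>cpx = C, bas = B, wt = filter_weight f, ties = R\<rparr>"
  let ?J = "Y_index F ?D"
  have "filter_weighted F ?D f"
    using assms by (auto simp: filter_weighted_def filtered_based_complex_def filter_weight_def)
  from simplification_splitting[OF this] obtain d s t \<phi>
    where sp: "splitting F C B f ?J d s t \<phi>"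
      and st: "\<And>i. i < num_steps F ?D \<Longrightarrow> step_degree F ?D i = Suc (d (Inl i)) \<and>
          t (Inl i) = ereal (s (Inl i) + step_weight F ?D i)"
      and fr: "\<And>k i. d (Inr (k, i)) = k \<and> t (Inr (k, i)) = \<infinity>" by auto
  interpret split_complex F C B f ?J d s t \<phi>
    by unfold_locales (use assms(2,3) sp in auto)
  \<comment> \<open>The tags of the summands of \<open>Y\<close>, over the index set that also
    carries the bars.\<close>
  define n' where "n' = case_sum (step_degree F ?D) (\<lambda>p :: nat \<times> nat. fst p)"
  define s' where "s' = case_sum (\<lambda>i. ereal (step_weight F ?D i)) (\<lambda>_ :: nat \<times> nat. 0)"
  define t' where "t' = case_sum (\<lambda>i. ereal (step_weight F ?D i)) (\<lambda>_ :: nat \<times> nat. \<infinity>)"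
  \<comment> \<open>A step of degree \<open>d + 1\<close> and weight \<open>t - s\<close> belongs to
    the bar \<open>[s, t)\<close> in degree \<open>d\<close>; this is the formula for the
    bijection.\<close>
  have tag: "if t j < \<infinity> then n' j = Suc (d j) \<and> s' j = t j - ereal (s j) \<and> t' j = t j - ereal (s j) \<and> 0 < t' j
      else n' j = d j \<and> s' j = 0 \<and> t' j = \<infinity>" if j: "j \<in> ?J" for j
  proof (cases j)
    case (Inl i)
    then have "i < num_steps F ?D" using j by (auto simp: Y_index_def)
    then show ?thesis using st[of i] bar_bounds[OF j] Inl by (simp add: n'_def s'_def t'_def)
  next
    case (Inr p)
    then show ?thesis using fr by (cases p) (simp add: n'_def s'_def t'_def)
  qed
  \<comment> \<open>Bars have positive length, so the omission of weight 0 in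
    \<open>Y_functor\<close> removes nothing.\<close>
  have "i < num_steps F ?D \<Longrightarrow> step_weight F ?D i \<noteq> 0" for i
    using st[of i] bar_bounds[of "Inl i"] by (auto simp: Y_index_def)
  then have ind: "Inl ` {i. i < num_steps F ?D \<and> step_weight F ?D i \<noteq> 0} \<union>
      Inr ` {(k, j). j < vectorspace.dim F (grade (final_complex F ?D) k)} = ?J"
    unfolding Y_index_def by auto
  have Y: "Y_functor F ?D = sphere_sum F ?J n' s' t'"
    unfolding Y_functor_def ind
    by (rule arg_cong[where f = "pcomplex_sum _"]) (auto simp: fun_eq_iff n'_def s'_def t'_def split: sum.splits)
  have st': "0 < t' j \<and> 0 \<le> s' j \<and> s' j \<le> t' j \<and> (n' j = 0 \<longrightarrow> s' j = 0)" if "j \<in> ?J" for j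
    using tag[OF that] by (auto split: if_splits)
  then have st'': "\<forall>j\<in>?J. 0 < t' j \<and> 0 \<le> s' j \<and> s' j \<le> t' j \<and> (n' j = 0 \<longrightarrow> s' j = 0)" by blast
  define bars where "bars = (\<lambda>n. Bar F (phomology n (filtered_complex F C B f)))"
  define tbars where "tbars = tBar F (Y_functor F ?D)"
  have bars: "bars k = image_mset (\<lambda>j. (s j, t j)) (mset_set {j \<in> ?J. d j = k})" for k
    unfolding bars_def by (rule Bar_phomology)
  have tbars: "tbars k = image_mset (\<lambda>j. (s' j, t' j)) (mset_set {j \<in> ?J. n' j = k})" for k
    unfolding tbars_def Y tBar_eq[OF assms(1) J_finite st''] ..
  obtain h where h: "bij_betw h ?J (occurrences bars)" "\<forall>j\<in>?J. \<exists>i. h j = (d j, (s j, t j), i)"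
    using occurrences_bij[OF J_finite bars] by blast
  obtain h' where h': "bij_betw h' ?J (occurrences tbars)" "\<forall>j\<in>?J. \<exists>i. h' j = (n' j, (s' j, t' j), i)"
    using occurrences_bij[OF J_finite tbars] by blast
  \<comment> \<open>Each bar goes to the tagged interval with the same index.\<close>
  let ?\<Phi> = "h' \<circ> inv_into ?J h"
  have "bij_betw ?\<Phi> (occurrences bars) (occurrences tbars)"
    by (rule bij_betw_trans[OF bij_betw_inv_into[OF h(1)] h'(1)])
  moreover have "\<exists>j. ?\<Phi> (n, (x, y), i) =
      (if y < \<infinity> then (Suc n, (y - ereal x, y - ereal x), j) else (n, (0, \<infinity>), j))"
    if occ: "(n, (x, y), i) \<in> occurrences bars" for n x y i
  proof -
    obtain j where j: "j \<in> ?J" "h j = (n, (x, y), i)"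
      using occ bij_betw_imp_surj_on[OF h(1)] by (metis imageE)
    have "inv_into ?J h (n, (x, y), i) = j" using bij_betw_inv_into_left[OF h(1) j(1)] j(2) by simp
    moreover have "n = d j" "x = s j" "y = t j" using h(2) j by auto
    moreover obtain i' where "h' j = (n' j, (s' j, t' j), i')" using h'(2) j(1) by blast
    ultimately show ?thesis using tag[OF j(1)] by auto
  qed
  ultimately show ?thesis unfolding Let_def bars_def[symmetric] tbars_def[symmetric] by blast
qed

end
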